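(* Let $0<q<1$, $N\in\frac12\mathbb Z$ and let $r\ge1$ be an integer. Let $\mathcal H_{N,r}$ be the completion of $\mathcal V_N\oplus\mathcal V_{N+r}$, let $\gamma$ be the $\mathbb Z_2$-grading equal to $1$ on the first summand and $-1$ on the second, and let $\pi=\pi_N\oplus\pi_{N+r}$ be the diagonal representation of the standard Podleś sphere algebra $\mathcal A(S^2_q)$. Let $d_N,d_{N+r}$ be complex coefficients and let $D$ be the densely defined operator on $\mathcal H_{N,r}$ given by $$D|l,m\rangle_K=\begin{cases}0,& l<|K'|,\\ d_K\,q^{-l}\,|l,m\rangle_{K'},& l\ge|K'|,\end{cases}$$ for $(K,K')=(N,N+r)$ and for $(K,K')=(N+r,N)$, where $|l,m\rangle_K$ are the basis vectors of $\mathcal V_K$. Then $D$ has bounded commutators with $\pi(a)$ for all $a\in\mathcal A(S^2_q)$, anticommutes with $\gamma$, and satisfies the order-one condition up to the ideal $\mathcal K_q$ (in the sense of real extensions, as defined in the context). Moreover $D$ is selfadjoint if and only if $\overline{d_N}=d_{N+r}$.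
   Context: Notation: $[x]=\frac{q^x-q^{-x}}{q-q^{-1}}$. $\mathcal A(S^2_q)$ is the $*$-algebra generated by $B,B^*,A=A^*$ with relations $AB=q^2BA$, $AB^*=q^{-2}B^*A$, $BB^*=q^{-2}A(1-A)$, $B^*B=A(1-q^2A)$. For $N\in\frac12\mathbb Z$, $\mathcal V_N=\bigoplus_{l=|N|,|N|+1,\dots}V_l$, where $V_l$ has orthonormal basis $|l,m\rangle$, $m=-l,-l+1,\dots,l$. The $*$-representation $\pi_N$ of $\mathcal A(S^2_q)$ on (the completion of) $\mathcal V_N$ is $$\begin{aligned}\pi_N(B)|l,m\rangle=&\ q^m\sqrt{[l+m+1][l+m+2]}\,r^+(l)|l+1,m+1\rangle+q^m\sqrt{[l+m+1][l-m]}\,r^0(l)|l,m+1\rangle\\&+q^m\sqrt{[l-m][l-m-1]}\,r^-(l)|l-1,m+1\rangle,\\ \pi_N(B^* )|l,m\rangle=&\ q^{m-1}\sqrt{[l-m+2][l-m+1]}\,r^-(l+1)|l+1,m-1\rangle+q^{m-1}\sqrt{[l+m][l-m+1]}\,r^0(l)|l,m-1\rangle\\&+q^{m-1}\sqrt{[l+m][l+m-1]}\,r^+(l-1)|l-1,m-1\rangle,\\ \pi_N(A)|l,m\rangle=&-q^{m+l+\frac12}\sqrt{[l-m+1][l+m+1]}\,r^+(l)|l+1,m\rangle\\&+\tfrac{q^{-1/2}}{1+q^2}\Big(\big([l-m+1][l+m]-q^2[l-m][l+m+1]\big)r^0(l)+q^{\frac12}\Big)|l,m\rangle\\&+q^{m-l-\frac12}\sqrt{[l-m][l+m]}\,r^-(l)|l-1,m\rangle,\end{aligned}$$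 with $$r^0(l)=q^{-\frac12}\frac{(q-q^{-1})[l+|N|+1][l-|N|]\pm q^{\pm1}[2|N|]}{[2l][2l+2]},\quad r^+(l)=\frac{q^{-l-\frac32-N}}{[2l+2]}\frac{\sqrt{[l+N+1][l-N+1]}}{\sqrt{[2l+1][2l+3]}},\quad r^-(l)=-q^{2l}r^+(l-1),$$ where $\pm$ is the sign of $N$ (for $N=0$ that term is zero), and terms containing $r^0(0)$ are taken to be $0$. Commutators with $D$ are understood on the algebraic span of the basis vectors; $D$ is taken with its natural (maximal) domain when selfadjointness is discussed. $\mathcal K_q$ is the ideal of operators of exponential decay: the two-sided ideal of bounded operators generated by the diagonal operator $|l,m\rangle\mapsto q^l|l,m\rangle$ (on the direct sum of the Hilbert spaces involved). Order-one condition up to $\mathcal K_q$, in the sense of real extensions: there exist a Hilbert space $\mathcal H'$ of the same kind (here a completion of $\mathcal V_M\oplus\mathcal V_{M+r}$ for some $M\in\frac12\mathbb Z$) with its diagonal representation of $\mathcal A(S^2_q)$, an operator $D'$ on $\mathcal H'$ having bounded commutators with the algebra, and an antiunitary $J$ on $\mathcal H\oplus\mathcal H'$ with $J^2=\pm1$, $J(D\oplus D')=(D\oplus D')J$ and $[J\pi(a)J^{-1},\pi(b)]=0$ for all $a,b$ (with $\pi$ now the representation on $\mathcal H\oplus\mathcal H'$), such that $[J\pi(a)J^{-1},[D\oplus D',\pi(b)]]\in\mathcal K_q$ for all $a,b\in\mathcal A(S^2_q)$. *)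

theory Defs
  imports "HOL-Analysis.Analysis"
begin

section \<open>Hilbert spaces with a distinguished orthonormal basis\<close>

text \<open>
  The Hilbert space with orthonormal basis indexed by the set \<open>X\<close> is the space \<open>ell2 X\<close> of
  square-summable coefficient functions that vanish outside \<open>X\<close>.  Operators are HOL functions
  on coefficient functions; they matter only through their values on \<open>ell2 X\<close> (or on the stated
  domain, for unbounded operators).
\<close>

type_synonym 'x cvec = "'x \<Rightarrow> complex"
type_synonym 'x cop = "'x cvec \<Rightarrow> 'x cvec"

definition ell2 :: "'x set \<Rightarrow> 'x cvec set" where
  "ell2 X = {f. (\<forall>x. x \<notin> X \<longrightarrow> f x = 0) \<and> (\<lambda>x. (cmod (f x))\<^sup>2) summable_on X}"

definition ell2_inner :: "'x set \<Rightarrow> 'x cvec \<Rightarrow> 'x cvec \<Rightarrow> complex" where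
  "ell2_inner X f g = (\<Sum>\<^sub>\<infinity>x\<in>X. cnj (f x) * g x)"

definition ell2_norm :: "'x set \<Rightarrow> 'x cvec \<Rightarrow> real" where
  "ell2_norm X f = sqrt (\<Sum>\<^sub>\<infinity>x\<in>X. (cmod (f x))\<^sup>2)"

definition ket :: "'x \<Rightarrow> 'x cvec" where
  "ket x = (\<lambda>y. if y = x then 1 else 0)"

text \<open>The algebraic span of the basis vectors.\<close>

definition fin_span :: "'x set \<Rightarrow> 'x cvec set" where
  "fin_span X = {f. (\<forall>x. x \<notin> X \<longrightarrow> f x = 0) \<and> finite {x. f x \<noteq> 0}}"

definition linear_subspace :: "'x cvec set \<Rightarrow> bool" where
  "linear_subspace U \<longleftrightarrow>
     (\<lambda>x. 0) \<in> U \<and>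
     (\<forall>f\<in>U. \<forall>g\<in>U. (\<lambda>x. f x + g x) \<in> U) \<and>
     (\<forall>c. \<forall>f\<in>U. (\<lambda>x. c * f x) \<in> U)"

definition linear_op_on :: "'x cvec set \<Rightarrow> 'x cop \<Rightarrow> bool" where
  "linear_op_on U T \<longleftrightarrow>
     (\<forall>f\<in>U. \<forall>g\<in>U. T (\<lambda>x. f x + g x) = (\<lambda>x. T f x + T g x)) \<and>
     (\<forall>c. \<forall>f\<in>U. T (\<lambda>x. c * f x) = (\<lambda>x. c * T f x))"

definition bounded_op :: "'x set \<Rightarrow> 'x cop \<Rightarrow> bool" where
  "bounded_op X T \<longleftrightarrow>
     (\<forall>f\<in>ell2 X. T f \<in> ell2 X) \<and> linear_op_on (ell2 X) T \<and>
     (\<exists>C. \<forall>f\<in>ell2 X. ell2_norm X (T f) \<le> C * ell2_norm X f)"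

text \<open>An operator in the Hilbert space, with domain \<open>U\<close>.\<close>

definition unbounded_op :: "'x set \<Rightarrow> 'x cvec set \<Rightarrow> 'x cop \<Rightarrow> bool" where
  "unbounded_op X U T \<longleftrightarrow>
     U \<subseteq> ell2 X \<and> linear_subspace U \<and> linear_op_on U T \<and> (\<forall>f\<in>U. T f \<in> ell2 X)"

text \<open>
  Selfadjointness of \<open>T\<close> with domain \<open>U\<close>: the left-hand side of the equivalence says that
  \<open>(\<phi>, \<eta>)\<close> is in the graph of the adjoint, the right-hand side that it is in the graph of \<open>T\<close>.
  (If \<open>U\<close> is not dense, \<open>\<eta>\<close> is not determined by \<open>\<phi>\<close> and the condition fails.)
\<close>

definition selfadjoint_op :: "'x set \<Rightarrow> 'x cvec set \<Rightarrow> 'x cop \<Rightarrow> bool" where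
  "selfadjoint_op X U T \<longleftrightarrow>
     unbounded_op X U T \<and>
     (\<forall>\<phi>\<in>ell2 X. \<forall>\<eta>\<in>ell2 X.
        (\<forall>\<psi>\<in>U. ell2_inner X \<phi> (T \<psi>) = ell2_inner X \<eta> \<psi>) \<longleftrightarrow> (\<phi> \<in> U \<and> T \<phi> = \<eta>))"

text \<open>
  \<open>S\<close> is the bounded extension of the commutator \<open>[T, R]\<close>, which is taken on the algebraic span
  of the basis vectors; the span has to be in the domain of \<open>T R\<close> and of \<open>R T\<close>.
\<close>

definition commutator_extension ::
    "'x set \<Rightarrow> 'x cvec set \<Rightarrow> 'x cop \<Rightarrow> 'x cop \<Rightarrow> 'x cop \<Rightarrow> bool" where
  "commutator_extension X U T R S \<longleftrightarrow>
     bounded_op X S \<and>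
     (\<forall>f\<in>fin_span X. f \<in> U \<and> R f \<in> U \<and> S f = (\<lambda>x. T (R f) x - R (T f) x))"

definition has_bounded_commutator :: "'x set \<Rightarrow> 'x cvec set \<Rightarrow> 'x cop \<Rightarrow> 'x cop \<Rightarrow> bool" where
  "has_bounded_commutator X U T R \<longleftrightarrow> (\<exists>S. commutator_extension X U T R S)"

definition antiunitary :: "'x set \<Rightarrow> 'x cop \<Rightarrow> bool" where
  "antiunitary X J \<longleftrightarrow>
     bij_betw J (ell2 X) (ell2 X) \<and>
     (\<forall>f\<in>ell2 X. \<forall>g\<in>ell2 X. J (\<lambda>x. f x + g x) = (\<lambda>x. J f x + J g x)) \<and>
     (\<forall>c. \<forall>f\<in>ell2 X. J (\<lambda>x. c * f x) = (\<lambda>x. cnj c * J f x)) \<and>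
     (\<forall>f\<in>ell2 X. \<forall>g\<in>ell2 X. ell2_inner X (J f) (J g) = cnj (ell2_inner X f g))"

text \<open>
  The operator with prescribed images \<open>c x\<close> of the basis vectors \<open>ket x\<close>, \<open>x \<in> X\<close>, and its maximal
  domain.  For every matrix \<open>c\<close> used below, each row \<open>\<lambda>x. c x y\<close> has finite support, so that the
  series is a finite sum for every coefficient function \<open>f\<close>.
\<close>

definition mat_op :: "'x set \<Rightarrow> ('x \<Rightarrow> 'x cvec) \<Rightarrow> 'x cop" where
  "mat_op X c f = (\<lambda>y. if y \<in> X then (\<Sum>\<^sub>\<infinity>x\<in>X. f x * c x y) else 0)"

definition mat_dom :: "'x set \<Rightarrow> ('x \<Rightarrow> 'x cvec) \<Rightarrow> 'x cvec set" where
  "mat_dom X c = {f \<in> ell2 X. mat_op X c f \<in> ell2 X}"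

text \<open>Direct sums; the basis of the direct sum is the disjoint union \<open>X <+> Y\<close>.\<close>

definition dsum :: "'x cop \<Rightarrow> 'y cop \<Rightarrow> ('x + 'y) cop" where
  "dsum S T f = case_sum (S (\<lambda>x. f (Inl x))) (T (\<lambda>y. f (Inr y)))"

definition dsum_dom :: "'x cvec set \<Rightarrow> 'y cvec set \<Rightarrow> ('x + 'y) cvec set" where
  "dsum_dom U V = {f. (\<lambda>x. f (Inl x)) \<in> U \<and> (\<lambda>y. f (Inr y)) \<in> V}"

text \<open>
  The two-sided ideal of the bounded operators on \<open>ell2 X\<close> generated by the diagonal operator
  \<open>ket x \<mapsto> q^(lev x) ket x\<close>.  The last rule identifies HOL functions that agree on \<open>ell2 X\<close>.
\<close>

inductive exp_decay :: "real \<Rightarrow> 'x set \<Rightarrow> ('x \<Rightarrow> real) \<Rightarrow> 'x cop \<Rightarrow> bool"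
  for q X lev where
  generator: "exp_decay q X lev (\<lambda>f x. complex_of_real (q powr lev x) * f x)"
| add: "exp_decay q X lev S \<Longrightarrow> exp_decay q X lev T \<Longrightarrow> exp_decay q X lev (\<lambda>f x. S f x + T f x)"
| left: "bounded_op X R \<Longrightarrow> exp_decay q X lev S \<Longrightarrow> exp_decay q X lev (\<lambda>f. R (S f))"
| right: "exp_decay q X lev S \<Longrightarrow> bounded_op X R \<Longrightarrow> exp_decay q X lev (\<lambda>f. S (R f))"
| cong: "exp_decay q X lev S \<Longrightarrow> (\<And>f. f \<in> ell2 X \<Longrightarrow> T f = S f) \<Longrightarrow> exp_decay q X lev T"


section \<open>The algebra of the standard Podles sphere\<close>

text \<open>
  The algebra is presented as the quotient of the formal expressions in the generators
  \<open>B\<close>, \<open>B\<^sup>*\<close>, \<open>A\<close> and the complex scalars by the congruence generated by the laws of unital complex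
  associative algebras and the defining relations.  This set of relations is closed under the
  involution \<open>B \<leftrightarrow> B\<^sup>*\<close>, \<open>A\<^sup>* = A\<close>, so the quotient is the \<open>*\<close>-algebra with these relations.
\<close>

datatype podles_expr =
    Gen_B | Gen_Bstar | Gen_A | Scal complex
  | Add podles_expr podles_expr | Mult podles_expr podles_expr

inductive podles_eq :: "real \<Rightarrow> podles_expr \<Rightarrow> podles_expr \<Rightarrow> bool" for q where
  refl: "podles_eq q s s"
| sym: "podles_eq q s t \<Longrightarrow> podles_eq q t s"
| trans: "podles_eq q s t \<Longrightarrow> podles_eq q t u \<Longrightarrow> podles_eq q s u"
| cong_add: "podles_eq q s s' \<Longrightarrow> podles_eq q t t' \<Longrightarrow> podles_eq q (Add s t) (Add s' t')"
| cong_mult: "podles_eq q s s' \<Longrightarrow> podles_eq q t t' \<Longrightarrow> podles_eq q (Mult s t) (Mult s' t')"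
| add_assoc: "podles_eq q (Add (Add s t) u) (Add s (Add t u))"
| add_comm: "podles_eq q (Add s t) (Add t s)"
| add_zero: "podles_eq q (Add (Scal 0) s) s"
| mult_assoc: "podles_eq q (Mult (Mult s t) u) (Mult s (Mult t u))"
| distrib_left: "podles_eq q (Mult s (Add t u)) (Add (Mult s t) (Mult s u))"
| distrib_right: "podles_eq q (Mult (Add s t) u) (Add (Mult s u) (Mult t u))"
| mult_one: "podles_eq q (Mult (Scal 1) s) s"
| mult_zero: "podles_eq q (Mult (Scal 0) s) (Scal 0)"
| scal_add: "podles_eq q (Add (Scal c) (Scal d)) (Scal (c + d))"
| scal_mult: "podles_eq q (Mult (Scal c) (Scal d)) (Scal (c * d))"
| scal_central: "podles_eq q (Mult (Scal c) s) (Mult s (Scal c))"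
| rel_AB: "podles_eq q (Mult Gen_A Gen_B)
             (Mult (Scal (complex_of_real (q powr 2))) (Mult Gen_B Gen_A))"
| rel_ABstar: "podles_eq q (Mult Gen_A Gen_Bstar)
             (Mult (Scal (complex_of_real (q powr -2))) (Mult Gen_Bstar Gen_A))"
| rel_BBstar: "podles_eq q (Mult Gen_B Gen_Bstar)
             (Mult (Scal (complex_of_real (q powr -2)))
               (Mult Gen_A (Add (Scal 1) (Mult (Scal (-1)) Gen_A))))"
| rel_BstarB: "podles_eq q (Mult Gen_Bstar Gen_B)
             (Mult Gen_A (Add (Scal 1) (Mult (Scal (- complex_of_real (q powr 2))) Gen_A)))"

definition podles_algebra :: "real \<Rightarrow> podles_expr set set" where
  "podles_algebra q = UNIV // {(s, t). podles_eq q s t}"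


section \<open>The representations\<close>

definition qnum :: "real \<Rightarrow> real \<Rightarrow> real" where
  "qnum q x = (q powr x - q powr (- x)) / (q - inverse q)"

definition r_zero :: "real \<Rightarrow> real \<Rightarrow> real \<Rightarrow> real" where
  "r_zero q N l =
     (if l = 0 then 0 else
      q powr (- 1/2) *
      (((q - inverse q) * qnum q (l + \<bar>N\<bar> + 1) * qnum q (l - \<bar>N\<bar>)
         + sgn N * q powr sgn N * qnum q (2 * \<bar>N\<bar>))
       / (qnum q (2 * l) * qnum q (2 * l + 2))))"

definition r_plus :: "real \<Rightarrow> real \<Rightarrow> real \<Rightarrow> real" where
  "r_plus q N l =
     q powr (- l - 3/2 - N) / qnum q (2 * l + 2) *
     (sqrt (qnum q (l + N + 1) * qnum q (l - N + 1))
       / sqrt (qnum q (2 * l + 1) * qnum q (2 * l + 3)))"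

definition r_minus :: "real \<Rightarrow> real \<Rightarrow> real \<Rightarrow> real" where
  "r_minus q N l = - (q powr (2 * l)) * r_plus q N (l - 1)"

text \<open>The labels \<open>(l, m)\<close> of the basis of \<open>V\<^sub>N\<close>: \<open>l \<in> |N| + \<nat>\<close> and \<open>m \<in> {-l, -l + 1, \<dots>, l}\<close>.\<close>

definition V_basis :: "real \<Rightarrow> (real \<times> real) set" where
  "V_basis N = {(l, m). l - \<bar>N\<bar> \<in> \<nat> \<and> l + m \<in> \<nat> \<and> l - m \<in> \<nat>}"

text \<open>
  Images of the basis vectors under the generators.  Whenever a label on the right-hand side is
  not in \<open>V_basis N\<close>, its coefficient vanishes.
\<close>

fun piB_ket :: "real \<Rightarrow> real \<Rightarrow> real \<times> real \<Rightarrow> (real \<times> real) cvec" where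
  "piB_ket q N (l, m) = (\<lambda>y.
      complex_of_real (q powr m * sqrt (qnum q (l + m + 1) * qnum q (l + m + 2)) * r_plus q N l)
        * ket (l + 1, m + 1) y
    + complex_of_real (q powr m * sqrt (qnum q (l + m + 1) * qnum q (l - m)) * r_zero q N l)
        * ket (l, m + 1) y
    + complex_of_real (q powr m * sqrt (qnum q (l - m) * qnum q (l - m - 1)) * r_minus q N l)
        * ket (l - 1, m + 1) y)"

fun piBstar_ket :: "real \<Rightarrow> real \<Rightarrow> real \<times> real \<Rightarrow> (real \<times> real) cvec" where
  "piBstar_ket q N (l, m) = (\<lambda>y.
      complex_of_real (q powr (m - 1) * sqrt (qnum q (l - m + 2) * qnum q (l - m + 1))
        * r_minus q N (l + 1)) * ket (l + 1, m - 1) y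
    + complex_of_real (q powr (m - 1) * sqrt (qnum q (l + m) * qnum q (l - m + 1))
        * r_zero q N l) * ket (l, m - 1) y
    + complex_of_real (q powr (m - 1) * sqrt (qnum q (l + m) * qnum q (l + m - 1))
        * r_plus q N (l - 1)) * ket (l - 1, m - 1) y)"

fun piA_ket :: "real \<Rightarrow> real \<Rightarrow> real \<times> real \<Rightarrow> (real \<times> real) cvec" where
  "piA_ket q N (l, m) = (\<lambda>y.
      complex_of_real (- (q powr (m + l + 1/2)) * sqrt (qnum q (l - m + 1) * qnum q (l + m + 1))
        * r_plus q N l) * ket (l + 1, m) y
    + complex_of_real (q powr (- 1/2) / (1 + q powr 2) *
        ((qnum q (l - m + 1) * qnum q (l + m) - q powr 2 * qnum q (l - m) * qnum q (l + m + 1))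
           * r_zero q N l + q powr (1/2))) * ket (l, m) y
    + complex_of_real (q powr (m - l - 1/2) * sqrt (qnum q (l - m) * qnum q (l + m))
        * r_minus q N l) * ket (l - 1, m) y)"

fun expr_op :: "real \<Rightarrow> real \<Rightarrow> podles_expr \<Rightarrow> (real \<times> real) cop" where
  "expr_op q N Gen_B = mat_op (V_basis N) (piB_ket q N)"
| "expr_op q N Gen_Bstar = mat_op (V_basis N) (piBstar_ket q N)"
| "expr_op q N Gen_A = mat_op (V_basis N) (piA_ket q N)"
| "expr_op q N (Scal c) = (\<lambda>f x. c * f x)"
| "expr_op q N (Add s t) = (\<lambda>f x. expr_op q N s f x + expr_op q N t f x)"
| "expr_op q N (Mult s t) = (\<lambda>f. expr_op q N s (expr_op q N t f))"

text \<open>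
  \<open>\<pi>\<^sub>N(a)\<close> is evaluated on an expression that represents the class \<open>a\<close>; the choice is immaterial
  because the images of the generators satisfy the defining relations for \<open>0 < q < 1\<close>, \<open>2 N \<in> \<int>\<close>.
\<close>

definition podles_rep :: "real \<Rightarrow> real \<Rightarrow> podles_expr set \<Rightarrow> (real \<times> real) cop" where
  "podles_rep q N a = expr_op q N (SOME s. s \<in> a)"


section \<open>The operator \<open>D\<close> and the order-one condition\<close>

type_synonym label = "(real \<times> real) + (real \<times> real)"

text \<open>Basis labels of \<open>H\<^bsub>N,r\<^esub>\<close>: \<open>Inl\<close> for the summand \<open>V\<^sub>N\<close>, \<open>Inr\<close> for \<open>V\<^bsub>N+r\<^esub>\<close>.\<close>

definition H_basis :: "real \<Rightarrow> nat \<Rightarrow> label set" where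
  "H_basis N r = V_basis N <+> V_basis (N + real r)"

definition level :: "label \<Rightarrow> real" where
  "level = case_sum fst fst"

definition H_rep :: "real \<Rightarrow> real \<Rightarrow> nat \<Rightarrow> podles_expr set \<Rightarrow> label cop" where
  "H_rep q N r a = dsum (podles_rep q N a) (podles_rep q (N + real r) a)"

definition grading :: "label cop" where
  "grading = dsum (\<lambda>f. f) (\<lambda>f x. - f x)"

fun D_ket :: "real \<Rightarrow> real \<Rightarrow> nat \<Rightarrow> complex \<Rightarrow> complex \<Rightarrow> label \<Rightarrow> label cvec" where
  "D_ket q N r dN dNr (Inl (l, m)) =
     (\<lambda>y. if l < \<bar>N + real r\<bar> then 0
          else dN * complex_of_real (q powr (- l)) * ket (Inr (l, m)) y)"
| "D_ket q N r dN dNr (Inr (l, m)) =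
     (\<lambda>y. if l < \<bar>N\<bar> then 0
          else dNr * complex_of_real (q powr (- l)) * ket (Inl (l, m)) y)"

definition D_op :: "real \<Rightarrow> real \<Rightarrow> nat \<Rightarrow> complex \<Rightarrow> complex \<Rightarrow> label cop" where
  "D_op q N r dN dNr = mat_op (H_basis N r) (D_ket q N r dN dNr)"

definition D_dom :: "real \<Rightarrow> real \<Rightarrow> nat \<Rightarrow> complex \<Rightarrow> complex \<Rightarrow> label cvec set" where
  "D_dom q N r dN dNr = mat_dom (H_basis N r) (D_ket q N r dN dNr)"

definition anticommutes_with_grading :: "label cvec set \<Rightarrow> label cop \<Rightarrow> bool" where
  "anticommutes_with_grading U T \<longleftrightarrow>
     (\<forall>f\<in>U. grading f \<in> U \<and> T (grading f) = (\<lambda>x. - grading (T f) x))"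

text \<open>
  Order-one condition up to the ideal of operators of exponential decay, in the sense of real
  extensions, for the operator \<open>T\<close> with domain \<open>U\<close> on \<open>H\<^bsub>N,r\<^esub>\<close>.  The primed data live on
  \<open>H' = H\<^bsub>M,r\<^esub>\<close>; the equation \<open>J (T \<oplus> T') = (T \<oplus> T') J\<close> is an equality of unbounded operators,
  domains included.
\<close>

definition order_one_up_to_exp_decay ::
    "real \<Rightarrow> real \<Rightarrow> nat \<Rightarrow> label cvec set \<Rightarrow> label cop \<Rightarrow> bool" where
  "order_one_up_to_exp_decay q N r U T \<longleftrightarrow>
    (\<exists>M U' T' J.
       let Z = H_basis N r <+> H_basis M r;
           W = dsum_dom U U';
           DD = dsum T T';
           rep = (\<lambda>a. dsum (H_rep q N r a) (H_rep q M r a));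
           opp = (\<lambda>a f. J (rep a (inv_into (ell2 Z) J f)))
       in 2 * M \<in> \<int> \<and>
          unbounded_op (H_basis M r) U' T' \<and>
          (\<forall>a\<in>podles_algebra q. has_bounded_commutator (H_basis M r) U' T' (H_rep q M r a)) \<and>
          antiunitary Z J \<and>
          (\<exists>\<epsilon>\<in>{1, - 1}. \<forall>f\<in>ell2 Z. J (J f) = (\<lambda>x. \<epsilon> * f x)) \<and>
          (\<forall>f\<in>ell2 Z. J f \<in> W \<longleftrightarrow> f \<in> W) \<and>
          (\<forall>f\<in>W. J (DD f) = DD (J f)) \<and>
          (\<forall>a\<in>podles_algebra q. \<forall>b\<in>podles_algebra q. \<forall>f\<in>ell2 Z.
             opp a (rep b f) = rep b (opp a f)) \<and>
          (\<forall>a\<in>podles_algebra q. \<forall>b\<in>podles_algebra q. \<exists>S.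
             commutator_extension Z W DD (rep b) S \<and>
             exp_decay q Z (case_sum level level) (\<lambda>f x. opp a (S f) x - S (opp a f) x)))"

end

theory Submission
  imports Defs
begin

text \<open>
  Take \<open>M = - N - r\<close>, so that \<open>H'\<close> has the summands \<open>V\<^bsub>-(N+r)\<^esub>\<close> and \<open>V\<^bsub>-N\<^esub>\<close>, let \<open>D'\<close> be the operator \<open>D\<close>
  with coefficients \<open>cnj dNr\<close>, \<open>cnj dN\<close>, and let \<open>J\<close> send \<open>|l, m\<rangle>\<^bsub>K\<^esub>\<close> to \<open>|l, -m\<rangle>\<^bsub>-K\<^esub>\<close> antilinearly.  Then
  \<open>J \<pi>(a) J\<inverse>\<close> acts on \<open>V\<^sub>K\<close> by \<open>\<pi>\<^bsub>-K\<^esub>(a)\<close> with complex conjugated coefficients and \<open>m\<close> replaced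
  by \<open>-m\<close>.  Rescaling \<open>|l, m\<rangle>\<close> by the square root of \<open>[l + m]! [l - m]!\<close> makes the coefficients of
  the generators rational in \<open>q\<^sup>l\<close>, \<open>q\<^sup>m\<close> up to the reduced matrix elements; commutation of \<open>\<pi>\<^sub>K\<close> with
  its conjugate then follows, for each total shift of \<open>l\<close>, from polynomial identities and two
  relations between \<open>r_zero\<close> and \<open>r_plus\<close> for \<open>K\<close> and \<open>-K\<close>.

  The diagonal coefficients of \<open>\<pi>\<^sub>K(g)\<close> depend on \<open>K\<close> only up to \<open>q\<^bsup>2l\<^esup>\<close>, and the off-diagonal ones are
  of order \<open>q\<^sup>l\<close>, so \<open>[D, \<pi>(g)]\<close> is bounded although \<open>D\<close> grows like \<open>q\<^bsup>-l\<^esup>\<close>.  Up to errors of order \<open>q\<^bsup>l+m\<^esup>\<close>,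
  its coefficients do not depend on \<open>m\<close> and vanish unless the shifts of \<open>l\<close> and \<open>m\<close> agree, so they
  preserve \<open>l - m\<close>; up to order \<open>q\<^sup>l\<close>, those of the opposite representation depend on \<open>l - m\<close> only and
  are of order \<open>q\<^bsup>l-m\<^esup>\<close>.  Hence the weights of their commutator are of order \<open>q\<^sup>l\<close>.
\<close>

text \<open>\<open>J\<close> reverses the sign of \<open>K\<close>, so it needs
  \<open>V_{-N}\<close> and \<open>V_{-(N+r)}\<close> next to the given summands. The real extension
  supplies them, and \<open>M = - N - r\<close> lists them in the order \<open>V_M\<close>,
  \<open>V_{M+r}\<close> that the definition demands. The coefficients of \<open>D'\<close> are then
  dictated by commutation with \<open>J\<close>. The obstacle is that the weights of
  \<open>[D, \<pi>(b)]\<close> and those of the opposite representation are both merely of order 1.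
  Decay comes from a product: an error q^(l+m) in the weights of one factor is large only near m =
  -l, where the weights q^(l-m) of the other are small, and q^(l+m) q^(l-m) = q^(2l). Elements of
  the algebra are classes of expressions. Everything is proved for all expressions by induction,
  which covers the representative picked by \<open>SOME\<close>. The exact commutation of the two
  representations has a second use: it makes the order-one commutator compatible with the Leibniz
  rule, so that generators suffice.\<close>

section \<open>Identities for the reduced matrix elements\<close>

text \<open>
  At \<open>l = 0\<close> the value \<open>r_zero = 0\<close> is replaced by the one for which
  \<open>r_zero_recurrence\<close> remains true; the coefficients do not notice, because there
  \<open>r_zero\<close> is multiplied by a vanishing bracket.
\<close>

definition r_zero_reg :: "real \<Rightarrow> real \<Rightarrow> real \<Rightarrow> real" where
  "r_zero_reg q N l = (if l = 0 then r_zero q 0 1 * (q^2 + 1/q^2) / 2 else r_zero q N l)"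

text \<open>The part of \<open>r_plus\<close> that is even in \<open>N\<close>.\<close>

definition r_plus_sym :: "real \<Rightarrow> real \<Rightarrow> real \<Rightarrow> real" where
  "r_plus_sym q N l = q powr (- l - 3/2) / qnum q (2 * l + 2) *
     (sqrt (qnum q (l + N + 1) * qnum q (l - N + 1))
       / sqrt (qnum q (2 * l + 1) * qnum q (2 * l + 3)))"

lemma r_plus_eq: "r_plus q N l = q powr (-N) * r_plus_sym q N l"
proof -
  have "q powr (- l - 3/2 - N) = q powr (-N) * q powr (- l - 3/2)"
    unfolding powr_add[symmetric] by (rule arg_cong[where f="\<lambda>z. q powr z"]) simp
  then show ?thesis by (simp add: r_plus_def r_plus_sym_def)
qed

lemma r_plus_sym_minus: "r_plus_sym q (-N) l = r_plus_sym q N l"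
  by (simp add: r_plus_sym_def mult.commute)

lemma qnum_0 [simp]: "qnum q 0 = 0"
  by (simp add: qnum_def)

lemma qnum_pos:
  assumes "0 < q" "q < 1" "0 < x" shows "0 < qnum q x"
proof -
  have "q powr x < q powr 0" using assms by (intro powr_less_mono') auto
  moreover have "q powr 0 < q powr (-x)" using assms by (intro powr_less_mono') auto
  moreover have "q - inverse q < 0" using assms one_less_inverse_iff[of q] by linarith
  ultimately show ?thesis unfolding qnum_def by (intro divide_neg_neg) auto
qed

lemma qnum_nonneg: "0 < q \<Longrightarrow> q < 1 \<Longrightarrow> 0 \<le> x \<Longrightarrow> 0 \<le> qnum q x"
  using qnum_pos[of q x] by (cases "x = 0") auto

text \<open>Despite \<open>|N|\<close> and the sign of \<open>N\<close> in the definition, only the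
  power q^(-2N) survives: the signed term exactly repairs the product of brackets. Passing from
  \<open>N\<close> to \<open>-N\<close> thus merely inverts \<open>q powr N\<close>.\<close>

lemma r_zero_eq:
  assumes q: "0 < q" "q < 1" and l: "l > 0"
  shows "r_zero q N l = q powr (- 1/2) * (q - 1/q) *
    (q * q powr (2*l) + 1 / (q * q powr (2*l)) - (q + 1/q) / q powr (2*N)) /
    ((q powr (2*l) - 1/q powr (2*l)) * (q^2 * q powr (2*l) - 1 / (q^2 * q powr (2*l))))"
proof -
  define L where "L = q powr l"
  define Z where "Z = q powr N"
  have pos: "L > 0" "Z > 0" "q > 0" using q by (auto simp: L_def Z_def)
  have d: "q - inverse q \<noteq> 0" using q one_less_inverse_iff[of q] by linarith
  have q2: "q powr 2 = q^2" using q by (simp add: powr_numeral)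
  have L2: "q powr (2*l) = L^2" by (simp add: L_def powr_add[symmetric] power2_eq_square)
  have Z2: "q powr (2*N) = Z^2" by (simp add: Z_def powr_add[symmetric] power2_eq_square)
  define Y where "Y = q powr \<bar>N\<bar>"
  have Y: "Y > 0" using q by (simp add: Y_def)
  have Y2: "q powr (2*\<bar>N\<bar>) = Y^2" by (simp add: Y_def powr_add[symmetric] power2_eq_square)
  define k where "k = q - inverse q"
  have qn: "qnum q (l + \<bar>N\<bar> + 1) = (L*Y*q - inverse (L*Y*q)) / k"
      "qnum q (l - \<bar>N\<bar>) = (L/Y - Y/L) / k"
      "qnum q (2*\<bar>N\<bar>) = (Y^2 - inverse (Y^2)) / k"
    using pos unfolding qnum_def powr_minus k_def
    by (simp_all add: powr_add powr_diff L_def[symmetric] Y_def[symmetric] Y2)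
  have sg: "sgn N * q powr sgn N * (Y^2 - inverse (Y^2)) =
    q * L^2 + 1 / (q * L^2) - (q + 1/q) / Z^2 - (L*Y*q - inverse (L*Y*q)) * (L/Y - Y/L)"
  proof -
    have qi: "q powr (-1) = inverse q" using q by (simp add: powr_minus)
    consider "N > 0" | "N = 0" | "N < 0" by linarith
    then show ?thesis
    proof cases
      case 1
      then have "Y = Z" by (simp add: Y_def Z_def)
      moreover have "q * (Z^2 - inverse (Z^2)) = q * L^2 + 1 / (q * L^2) - (q + 1/q) / Z^2 - (L*Z*q - inverse (L*Z*q)) * (L/Z - Z/L)"
        using pos by (simp add: field_simps power2_eq_square)
      ultimately show ?thesis using 1 q by simp
    next
      case 2
      then have "Y = 1" "Z = 1" using q by (simp_all add: Y_def Z_def)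
      moreover have "0 = q * L^2 + 1 / (q * L^2) - (q + 1/q) - (L*q - inverse (L*q)) * (L - 1/L)"
        using pos by (simp add: field_simps power2_eq_square)
      ultimately show ?thesis using 2 by simp
    next
      case 3
      then have Z: "Z = 1/Y" by (simp add: Y_def Z_def powr_minus field_simps)
      have "- inverse q * (Y^2 - inverse (Y^2)) = q * L^2 + 1 / (q * L^2) - (q + 1/q) / (1/Y)^2 - (L*Y*q - inverse (L*Y*q)) * (L/Y - Y/L)"
        using pos Y by (simp add: field_simps power2_eq_square)
      then show ?thesis using 3 q by (simp add: Z qi divide_inverse)
    qed
  qed
  have num: "((q - inverse q) * qnum q (l + \<bar>N\<bar> + 1) * qnum q (l - \<bar>N\<bar>)
         + sgn N * q powr sgn N * qnum q (2 * \<bar>N\<bar>)) =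
    (q * L^2 + 1 / (q * L^2) - (q + 1/q) / Z^2) / (q - inverse q)"
  proof -
    have kn: "k \<noteq> 0" using d by (simp add: k_def)
    have dist: "k * (a/k) * (b/k) + e * (f/k) = (a*b + e*f)/k" for a b e f
      using kn by (simp add: field_simps)
    show ?thesis unfolding qn k_def[symmetric] dist sg by simp
  qed
  have den: "qnum q (2 * l) * qnum q (2 * l + 2) = (L^2 - 1/L^2) * (q^2*L^2 - 1/(q^2*L^2)) / (q - inverse q)^2"
    using pos unfolding qnum_def powr_minus
    by (simp add: powr_add L2 q2 divide_simps power2_eq_square)
  have "r_zero q N l = q powr (- 1/2) * ((q * L^2 + 1 / (q * L^2) - (q + 1/q) / Z^2) / (q - inverse q) / ((L^2 - 1/L^2) * (q^2*L^2 - 1/(q^2*L^2)) / (q - inverse q)^2))"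
    using l unfolding r_zero_def num den by simp
  then show ?thesis using d by (simp add: L2 Z2 power2_eq_square inverse_eq_divide mult.assoc)
qed

text \<open>\<open>W\<close> stands for q^(2l). These are the coefficients of q^(2N) and of the
  constant term in the numerators of \<open>r_zero_recurrence\<close>.\<close>

lemma bracket_recurrence:
  fixes q W :: real assumes "q > 0" "W > 0"
  shows "(q^4*W - 1/(q^4*W)) * (q*W + 1/(q*W)) - (W - 1/W) * (q^3*W+1/(q^3*W)) / q^2
      = (q+1/q) * W * ((q^4*W - 1/(q^4*W)) - (W - 1/W) * q^2)"
    and "(q+1/q) * ((q^4*W - 1/(q^4*W)) - (W - 1/W) / q^2)
      = W*((q^4*W - 1/(q^4*W)) * (q*W + 1/(q*W)) - (W - 1/W) * (q^3*W+1/(q^3*W)) * q^2)"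
  using assms by (simp_all add: field_simps eval_nat_numeral)

text \<open>The two coefficients, of \<open>w + 1/w\<close> and of 1 with w = q^(2N), that are left
  in \<open>r_plus_r_zero_relation\<close> once its denominators are cleared.\<close>

lemma bracket_quadratic:
  fixes q W :: real assumes "q > 0" "W > 0"
  shows "(q^2*W - 1/(q^2*W))^2 - (W - 1/W)^2 = (q-1/q) * (q*W - 1/(q*W)) * (q*W + 1/(q*W)) * (q+1/q)"
    and "(W - 1/W)^2 * (q^2*W + 1/(q^2*W)) - (q^2*W - 1/(q^2*W))^2 * (W + 1/W)
      + (q-1/q) * (q*W - 1/(q*W)) * ((q*W + 1/(q*W))^2 + (q+1/q)^2) = 0"
  using assms by (simp_all add: field_simps eval_nat_numeral)

lemma bracket_neg:
  fixes q W :: real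
  assumes "0 < q" "q < 1" "0 < W" "W < 1"
  shows "q^j * W - 1/(q^j*W) < 0"
proof -
  have "q^j * W \<le> 1 * W" using assms by (intro mult_right_mono) (auto simp: power_le_one)
  then have "q^j * W < 1" "0 < q^j * W" using assms by (simp, linarith, simp)
  then show ?thesis by (smt (verit) less_divide_eq_1_pos)
qed

lemma r_zero_bracket:
  assumes "0 < q" "q < 1" "l > 0"
  defines "W \<equiv> q powr (2*l)"
  shows "r_zero q N l = q powr (- 1/2) * (q - 1/q) *
    (q * W + 1 / (q * W) - (q + 1/q) / (q powr N)^2) / ((W - 1/W) * (q^2 * W - 1 / (q^2 * W)))"
    "r_zero q N (l+1) = q powr (- 1/2) * (q - 1/q) *
    (q^3 * W + 1 / (q^3 * W) - (q + 1/q) / (q powr N)^2) / ((q^2 * W - 1 / (q^2 * W)) * (q^4 * W - 1 / (q^4 * W)))"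
proof -
  have Z: "q powr (2*N) = (q powr N)^2" by (simp add: powr_add[symmetric] power2_eq_square)
  have W1: "q powr (2*(l+1)) = q^2 * W"
    using assms by (simp add: W_def distrib_left powr_add powr_numeral)
  have e: "q * (q^2*W) = q^3 * W" "q^2 * (q^2 * W) = q^4 * W" by (simp_all add: eval_nat_numeral)
  show "r_zero q N l = q powr (- 1/2) * (q - 1/q) *
    (q * W + 1 / (q * W) - (q + 1/q) / (q powr N)^2) / ((W - 1/W) * (q^2 * W - 1 / (q^2 * W)))"
    unfolding r_zero_eq[OF assms(1-3)] W_def Z ..
  have "l + 1 > 0" using assms by simp
  show "r_zero q N (l+1) = q powr (- 1/2) * (q - 1/q) *
    (q^3 * W + 1 / (q^3 * W) - (q + 1/q) / (q powr N)^2) / ((q^2 * W - 1 / (q^2 * W)) * (q^4 * W - 1 / (q^4 * W)))"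
    unfolding r_zero_eq[OF assms(1,2) \<open>l + 1 > 0\<close>] W1 Z e ..
qed

text \<open>Over the common denominator both sides have first degree in \<open>Z^2\<close>, and
  \<open>bracket_recurrence\<close> compares the coefficients. Used for \<open>N\<close> and for
  \<open>-N\<close>, the relation expresses the diagonal elements on two neighbouring levels for one
  sign through those for the other.\<close>

lemma r_zero_recurrence:
  assumes q: "0 < q" "q < 1" and l: "l > 0 \<or> l = 0 \<and> N = 0"
  defines "L \<equiv> q powr l" and "Z \<equiv> q powr N"
  shows "Z^2 * (- r_zero_reg q N l / L + r_zero_reg q N (l+1) / (L*q^2)) = L * r_zero_reg q (-N) l - L*q^2 * r_zero_reg q (-N) (l+1)"
  using l
proof
  assume l: "l > 0"
  define W where "W = L^2"
  have L: "L > 0" "L < 1" "Z > 0" using q l powr_less_mono'[of q 0 l] by (auto simp: L_def Z_def)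
  have W: "W > 0" "W < 1" using L by (auto simp: W_def power_less_one_iff)
  have W': "q powr (2*l) = W" by (simp add: W_def L_def powr_add[symmetric] power2_eq_square)
  define c0 d0 d2 d4 g g1 c where "c0 = q powr (- 1/2) * (q - 1/q)"
    and "d0 = W - 1/W" and "d2 = q^2*W - 1/(q^2*W)" and "d4 = q^4*W - 1/(q^4*W)"
    and "g = q*W + 1/(q*W)" and "g1 = q^3*W + 1/(q^3*W)" and "c = q + 1/q"
  note abbr = this
  have nz: "d0 \<noteq> 0" "d2 \<noteq> 0" "d4 \<noteq> 0"
    using bracket_neg[of q W 0] bracket_neg[of q W 2] bracket_neg[of q W 4] q W by (auto simp: abbr)
  have Zm: "(q powr (-N))^2 = 1 / Z^2" by (simp add: Z_def powr_minus field_simps)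
  note rr = r_zero_bracket[OF q l, unfolded W', folded abbr]
  have a: "r_zero_reg q N l = c0 * ((g - c/Z^2) / (d0*d2))" "r_zero_reg q N (l+1) = c0 * ((g1 - c/Z^2) / (d2*d4))"
    using l rr[of N] by (simp_all add: r_zero_reg_def Z_def)
  have b: "r_zero_reg q (-N) l = c0 * ((g - c*Z^2) / (d0*d2))" "r_zero_reg q (-N) (l+1) = c0 * ((g1 - c*Z^2) / (d2*d4))"
    using l rr[of "-N"] by (simp_all add: r_zero_reg_def Zm)
  have e1: "d4 * g - d0 * g1 / q^2 = c * L^2 * (d4 - d0 * q^2)"
    and e2: "c * (d4 - d0 / q^2) = L^2 * (d4 * g - d0 * g1 * q^2)"
    using bracket_recurrence[OF q(1) W(1), folded abbr] by (simp_all add: W_def)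
  have "Z^2 * (- ((g - c/Z^2) / (d0*d2)) / L + ((g1 - c/Z^2) / (d2*d4)) / (L*q^2))
     = (- (Z^2 * (d4 * g - d0 * g1 / q^2)) + c * (d4 - d0 / q^2)) / (L * d0 * d2 * d4)"
    using nz L q by (simp add: field_simps)
  also have "\<dots> = (- (Z^2 * (c * L^2 * (d4 - d0 * q^2))) + L^2 * (d4 * g - d0 * g1 * q^2)) / (L * d0 * d2 * d4)"
    by (simp only: e1 e2)
  also have "\<dots> = L * ((g - c*Z^2) / (d0*d2)) - L*q^2 * ((g1 - c*Z^2) / (d2*d4))"
    using nz L q by (simp add: field_simps power2_eq_square)
  finally have fin: "c0 * (Z^2 * (- ((g - c/Z^2) / (d0*d2)) / L + ((g1 - c/Z^2) / (d2*d4)) / (L*q^2)))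
     = c0 * (L * ((g - c*Z^2) / (d0*d2)) - L*q^2 * ((g1 - c*Z^2) / (d2*d4)))" by simp
  have m: "Z^2 * (- (c0 * x) / L + (c0 * y) / (L*q^2)) = c0 * (Z^2 * (- x / L + y / (L*q^2)))"
    and "L * (c0 * x) - L*q^2 * (c0 * y) = c0 * (L * x - L*q^2 * y)" for x y
    by (simp_all add: algebra_simps)
  show ?thesis unfolding a b m(1) by (rule HOL.trans[OF fin]) (simp add: algebra_simps)
next
  assume l: "l = 0 \<and> N = 0"
  \<comment> \<open>Here \<open>L = Z = 1\<close> and the relation reads
    \<open>2 * r_zero_reg q 0 0 = (q^2 + 1/q^2) * r_zero q 0 1\<close>; the value of
    \<open>r_zero_reg\<close> at 0 was chosen to satisfy it.\<close>
  show ?thesis using l q by (simp add: L_def Z_def r_zero_reg_def field_simps)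
qed

text \<open>This is the factor that must vanish for the paths which return to their level. Each term
  depends on \<open>N\<close> only through \<open>w + 1/w\<close> with w = q^(2N), because
  \<open>N\<close> and \<open>-N\<close> enter symmetrically.\<close>

lemma r_plus_r_zero_relation:
  assumes q: "0 < q" "q < 1" and l: "l > 0" "l \<ge> \<bar>N\<bar>" "l = 1/2 \<longrightarrow> \<bar>N\<bar> = 1/2" "l \<ge> 1/2"
  defines "W \<equiv> q powr (2*l)" and "k \<equiv> q - 1/q"
  shows "q^2 * W * (q^3*W - 1/(q^3*W)) * (r_plus_sym q N l)^2 / k  + r_zero_reg q N l * r_zero_reg q (-N) l
    - W * (W/q - q/W) * (r_plus_sym q N (l-1))^2 / k = 0"
proof -
  have W: "W > 0" "W < 1" using q l powr_less_mono'[of q 0 "2*l"] by (auto simp: W_def)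
  define w where "w = (q powr N)^2"
  have w: "w > 0" using q by (simp add: w_def)
  have kn: "k < 0" using bracket_neg[of q 1 1] q unfolding k_def
    by (smt (verit) divide_less_eq_1 less_divide_eq_1_pos)
  define d0 d1 d2 d3 g c where "d0 = W - 1/W" and "d1 = q*W - 1/(q*W)" and "d2 = q^2*W - 1/(q^2*W)"
    and "d3 = q^3*W - 1/(q^3*W)"
    and "g = q*W + 1/(q*W)" and "c = q + 1/q"
  note abbr = this
  have nz: "d0 < 0" "d1 < 0" "d2 < 0" "d3 < 0"
    using bracket_neg[of q W 0] bracket_neg[of q W 1] bracket_neg[of q W 2] bracket_neg[of q W 3] q W by (auto simp: abbr)
  have h2: "(q powr (- 1/2))^2 = 1/q" using q by (simp add: powr_minus field_simps power2_eq_square powr_add[symmetric])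
  have Zm: "(q powr (-N))^2 = 1 / w" by (simp add: w_def powr_minus field_simps)
  note rr = r_zero_bracket[OF q l(1), folded W_def, folded abbr k_def]
  have ab: "r_zero_reg q N l * r_zero_reg q (-N) l = (k^2 / q) * (g - c/w) * (g - c*w) / (d0*d2)^2"
  proof -
    have gen: "(h*k*X/D) * (h*k*Y/D) = h^2 * k^2 * X * Y / D^2" for h X Y D :: real
      by (simp add: power2_eq_square)
    have "r_zero_reg q N l * r_zero_reg q (-N) l = r_zero q N l * r_zero q (-N) l" using l by (simp add: r_zero_reg_def)
    also have "\<dots> = (k^2 / q) * (g - c/w) * (g - c*w) / (d0*d2)^2"
      unfolding rr(1) Zm w_def[symmetric] gen h2 by simp
    finally show ?thesis .
  qed
  have Q: "qnum q x = (q powr x - 1 / q powr x)/k" for x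
    using q by (simp add: qnum_def k_def powr_minus inverse_eq_divide)
  have qW: "q powr (2*l+1) = q*W" "q powr (2*l+2) = q^2*W" "q powr (2*l+3) = q^3*W"
      "q powr (2*l) = W" "q powr (2*l-1) = W/q"
    using q by (simp_all add: W_def powr_add powr_diff powr_numeral)
  have qd: "qnum q (2*l+1) = d1/k" "qnum q (2*l+2) = d2/k" "qnum q (2*l+3) = d3/k" "qnum q (2*l) = d0/k"
    unfolding Q qW abbr by simp_all
  have Wl: "W = (q powr l)^2" by (simp add: W_def powr_add[symmetric] power2_eq_square)
  have LN: "q powr (l+N+1) * q powr (l-N+1) = q^2*W" "q powr (l+N+1) / q powr (l-N+1) = w"
     "q powr (l+N) * q powr (l-N) = W" "q powr (l+N) / q powr (l-N) = w"
    using q unfolding Wl w_def by (simp_all add: powr_add powr_diff power2_eq_square)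
  \<comment> \<open>A product of two brackets depends only on the product and the quotient of the
    two powers, here a multiple of \<open>W\<close> and \<open>w\<close>.\<close>
  have br: "(x - 1/x) * (y - 1/y) = x*y + 1/(x*y) - (x/y + 1/(x/y))" if "x > 0" "y > 0" for x y :: real
    using that by (simp add: field_simps)
  have n1: "qnum q (l+N+1) * qnum q (l-N+1) = (q^2*W + 1/(q^2*W) - (w+1/w)) / k^2"
    using br[of "q powr (l+N+1)" "q powr (l-N+1)"] q unfolding LN Q by (simp add: power2_eq_square)
  have n0: "qnum q (l+N) * qnum q (l-N) = (W + 1/W - (w+1/w)) / k^2"
    using br[of "q powr (l+N)" "q powr (l-N)"] q unfolding LN Q by (simp add: power2_eq_square)
  have n1': "qnum q (l+N+1) * qnum q (l-N+1) \<ge> 0" "qnum q (l+N) * qnum q (l-N) \<ge> 0"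
    using l q by (auto intro!: mult_nonneg_nonneg qnum_nonneg)
  have p1: "(q powr (- l - 3/2))^2 = 1/(q^3*W)" "(q powr (- (l-1) - 3/2))^2 = 1/(q*W)"
  proof -
    have sq: "(q powr x)^2 = q powr (2*x)" for x by (simp add: power2_eq_square powr_add[symmetric])
    have "2 * (- l - 3/2) = - (2*l+3)" "2 * (- (l-1) - 3/2) = - (2*l+1)" by simp_all
    then show "(q powr (- l - 3/2))^2 = 1/(q^3*W)" "(q powr (- (l-1) - 3/2))^2 = 1/(q*W)"
      unfolding sq using q by (simp_all only: powr_minus_divide qW)
  qed
  have sq: "(sqrt A)^2 / (sqrt B)^2 = A / B" if "A \<ge> 0" "B \<ge> 0" for A B using that by simp
  have k1: "(r_plus_sym q N l)^2 = 1/(q^3*W) * (k/d2)^2 * ((q^2*W + 1/(q^2*W) - (w+1/w)) / (d1*d3))"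
  proof -
    have "d1/k * (d3/k) \<ge> 0" using nz kn by (intro mult_nonneg_nonneg divide_nonpos_neg) auto
    from sq[OF n1'(1)[unfolded n1] this] show ?thesis
      unfolding r_plus_sym_def qd n1 power_mult_distrib power_divide p1 using kn by (simp add: power2_eq_square)
  qed
  have k0: "W * (W/q - q/W) * (r_plus_sym q N (l-1))^2 / k = 1/q * (W + 1/W - (w+1/w)) * k / (d0^2 * d1)"
  \<comment> \<open>At \<open>l = 1/2\<close> the bracket \<open>[2l - 1]\<close> in the denominator
    of \<open>r_plus_sym q N (l - 1)\<close> is zero. The left side vanishes by
    \<open>W/q - q/W = 0\<close>, and the right side because \<open>|N| = 1/2\<close> makes
    \<open>[l + N] [l - N]\<close> zero.\<close>
  proof (cases "l = 1/2")
    case True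
    then have "l + N = 0 \<or> l - N = 0" using l by (auto simp: abs_if split: if_splits)
    then have "qnum q (l+N) * qnum q (l-N) = 0" by auto
    then have "(W + 1/W - (w+1/w)) = 0" using n0 kn by simp
    moreover have "2 * l = 1" using True by simp
    then have "W = q" using q by (simp only: W_def powr_one)
    ultimately show ?thesis using q by simp
  next
    case False
    then have l1: "2*l - 1 > 0" using l by simp
    then have d: "W/q - q/W < 0" using q qW(5) powr_less_mono'[of q 0 "2*l-1"] bracket_neg[of q "W/q" 0] W by simp
    have qd1: "qnum q (2*l-1) = (W/q - q/W)/k" unfolding Q qW by simp
    have sh: "2*(l-1)+2 = 2*l" "2*(l-1)+1 = 2*l-1" "2*(l-1)+3 = 2*l+1" "l-1+N+1 = l+N" "l-1-N+1=l-N" by simp_all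
    have "(r_plus_sym q N (l-1))^2 = 1/(q*W) * (k/d0)^2 * ((W + 1/W - (w+1/w)) / ((W/q - q/W)*d1))"
    proof -
      have "(W/q - q/W)/k * (d1/k) \<ge> 0" using nz kn d by (intro mult_nonneg_nonneg divide_nonpos_neg) auto
      from sq[OF n1'(2)[unfolded n0] this] show ?thesis
        unfolding r_plus_sym_def sh qd qd1 n0 power_mult_distrib power_divide p1 using kn by (simp add: power2_eq_square)
    qed
    moreover have "W * D * (1/(q*W) * (k/d0)^2 * (X / (D*d1))) / k = 1/q * X * k / (d0^2 * d1)" if "D < 0" for D X
      using that nz W kn q by (simp add: field_simps power2_eq_square)
    ultimately show ?thesis using d by simp
  qed
  have e1: "d2^2 - d0^2 = k * d1 * g * c"
    and e2: "d0^2 * (q^2*W + 1/(q^2*W)) - d2^2 * (W + 1/W) + k * d1 * (g^2 + c^2) = 0"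
    using bracket_quadratic[OF q(1) W(1), folded abbr k_def] by simp_all
  \<comment> \<open>This factor clears all denominators in \<open>d0\<close>, \<open>d1\<close>,
    \<open>d2\<close>; what remains is linear in \<open>w + 1/w\<close>.\<close>
  have "q * ((d0*d2)^2 * d1 / k) * (q^2 * W * d3 * (r_plus_sym q N l)^2 / k  + r_zero_reg q N l * r_zero_reg q (-N) l
    - W * (W/q - q/W) * (r_plus_sym q N (l-1))^2 / k) =
    d0^2 * (q^2*W + 1/(q^2*W) - (w+1/w)) + k * d1 * ((g - c/w) * (g - c*w)) - d2^2 * (W + 1/W - (w+1/w))"
  proof -
    have t1: "q * ((d0*d2)^2 * d1 / k) * (q^2 * W * d3 * (r_plus_sym q N l)^2 / k) = d0^2 * (q^2*W + 1/(q^2*W) - (w+1/w))"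
    proof -
      have gen: "q * ((d0*d2)^2 * d1 / k) * (q^2 * W * d3 * (1/(q^3*W) * (k/d2)^2 * (X / (d1*d3))) / k) = d0^2 * X" for X
        using nz kn q W by (simp add: field_simps eval_nat_numeral)
      show ?thesis unfolding k1 gen ..
    qed
    have t2: "q * ((d0*d2)^2 * d1 / k) * (r_zero_reg q N l * r_zero_reg q (-N) l) = k * d1 * ((g - c/w) * (g - c*w))"
      unfolding ab using nz kn q W by (simp add: field_simps power2_eq_square)
    have t3: "q * ((d0*d2)^2 * d1 / k) * (W * (W/q - q/W) * (r_plus_sym q N (l-1))^2 / k) = d2^2 * (W + 1/W - (w+1/w))"
    proof -
      have gen: "q * ((d0*d2)^2 * d1 / k) * (1/q * X * k / (d0^2 * d1)) = d2^2 * X" for X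
        using nz kn q W by (simp add: field_simps power2_eq_square)
      show ?thesis unfolding k0 gen ..
    qed
    have "C * (X + Y - Z) = u + v - t" if "C * X = u" "C * Y = v" "C * Z = t" for C X Y Z u v t :: real
      using that by (simp add: algebra_simps)
    from this[OF t1 t2 t3] show ?thesis .
  qed
  also have "(g - c/w) * (g - c*w) = g^2 + c^2 - g*c*(w + 1/w)"
    using w by (simp add: field_simps power2_eq_square)
  also have "d0^2 * (q^2*W + 1/(q^2*W) - (w+1/w)) + k * d1 * (g^2 + c^2 - g*c*(w + 1/w)) - d2^2 * (W + 1/W - (w+1/w))
     = (d0^2 * (q^2*W + 1/(q^2*W)) - d2^2 * (W + 1/W) + k * d1 * (g^2 + c^2)) + (w+1/w) * ((d2^2 - d0^2) - k * d1 * g * c)"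
    by (simp add: algebra_simps)
  also have "\<dots> = 0" using e1 e2 by simp
  finally show ?thesis using nz kn q unfolding abbr by simp
qed

abbreviation "gens \<equiv> {Gen_B, Gen_Bstar, Gen_A}"

section \<open>Commutation of the matrix coefficients\<close>

text \<open>
  The Laurent polynomials, in \<open>L = q\<^sup>l\<close> and \<open>M = q\<^sup>m\<close> with inverses \<open>L'\<close> and \<open>M'\<close>, that remain
  of the coefficients when the gauge by \<open>sqrt_qfact\<close> has removed the square roots of brackets and
  the factors that depend on \<open>N\<close> have been split off.
\<close>

fun lcoef :: "real \<Rightarrow> real \<Rightarrow> podles_expr \<Rightarrow> real \<Rightarrow> real \<Rightarrow> real \<Rightarrow> real \<Rightarrow> real \<Rightarrow> real" where
  "lcoef q q' Gen_B \<sigma> L L' M M' = (if \<sigma> = 1 then M else if \<sigma> = 0 then L - M^2 * L'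
     else - (L^2 * M * (L*M' - M*L') * (L*M'*q' - M*q*L')))"
| "lcoef q q' Gen_Bstar \<sigma> L L' M M' = (if \<sigma> = 1 then - (q * L^2 * M) else if \<sigma> = 0 then (L*M^2 - L') * q'
     else M * (L*M - L'*M') * (L*M*q' - q*L'*M') * q')"
| "lcoef q q' Gen_A \<sigma> L L' M M' = (if \<sigma> = 1 then - (q * M * L * (1+q^2))
     else if \<sigma> = 0 then (1+q^2) * M^2 - L'^2 - q^2 * L^2
     else - (M * L * (L*M' - M*L') * (L*M - L'*M') * (1+q^2)))"
| "lcoef q q' _ \<sigma> L L' M M' = 0"

text \<open>The power of \<open>q\<close> with exponent \<open>mshift g\<close>, written with
  \<open>q\<close> and \<open>q'\<close> so that \<open>lcoef_comm\<close> stays a statement about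
  polynomials.\<close>

fun qmshift :: "real \<Rightarrow> real \<Rightarrow> podles_expr \<Rightarrow> real" where
  "qmshift q q' Gen_B = q" | "qmshift q q' Gen_Bstar = q'" | "qmshift q q' _ = 1"

fun mshift :: "podles_expr \<Rightarrow> real" where
  "mshift Gen_B = 1" | "mshift Gen_Bstar = -1" | "mshift _ = 0"

text \<open>\<open>\<sigma>\<close> is the shift of \<open>l\<close>, and the last branch stands for
  \<open>\<sigma> = -1\<close>: this is the coefficient of
  \<open>|l + \<sigma>, m + mshift g>\<close> in the image of \<open>|l, m>\<close>.\<close>

fun coef :: "real \<Rightarrow> real \<Rightarrow> podles_expr \<Rightarrow> real \<Rightarrow> real \<Rightarrow> real \<Rightarrow> real" where
  "coef q N Gen_B \<sigma> l m =
    (if \<sigma> = 1 then q powr m * sqrt (qnum q (l + m + 1) * qnum q (l + m + 2)) * r_plus q N l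
     else if \<sigma> = 0 then q powr m * sqrt (qnum q (l + m + 1) * qnum q (l - m)) * r_zero q N l
     else q powr m * sqrt (qnum q (l - m) * qnum q (l - m - 1)) * r_minus q N l)"
| "coef q N Gen_Bstar \<sigma> l m =
    (if \<sigma> = 1 then q powr (m - 1) * sqrt (qnum q (l - m + 2) * qnum q (l - m + 1)) * r_minus q N (l + 1)
     else if \<sigma> = 0 then q powr (m - 1) * sqrt (qnum q (l + m) * qnum q (l - m + 1)) * r_zero q N l
     else q powr (m - 1) * sqrt (qnum q (l + m) * qnum q (l + m - 1)) * r_plus q N (l - 1))"
| "coef q N Gen_A \<sigma> l m =
    (if \<sigma> = 1 then - (q powr (m + l + 1/2)) * sqrt (qnum q (l - m + 1) * qnum q (l + m + 1)) * r_plus q N l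
     else if \<sigma> = 0 then q powr (- 1/2) / (1 + q powr 2) *
        ((qnum q (l - m + 1) * qnum q (l + m) - q powr 2 * qnum q (l - m) * qnum q (l + m + 1))
           * r_zero q N l + q powr (1/2))
     else q powr (m - l - 1/2) * sqrt (qnum q (l - m) * qnum q (l + m)) * r_minus q N l)"
| "coef q N _ \<sigma> l m = 0"

context
  fixes q q' L L' M M' :: real and g g' :: podles_expr
  assumes q: "q * q' = 1" and L: "L * L' = 1" and M: "M * M' = 1" and g: "g \<in> gens" "g' \<in> gens"
begin

text \<open>\<open>w\<close> marks the weights of a first step from \<open>(l, m)\<close>,
  \<open>z\<close> those of a second step. Primes mark the opposite generator \<open>g'\<close>, for
  which \<open>m\<close> is reversed, so that \<open>M\<close> and \<open>M'\<close> trade places.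
  The second step of \<open>g\<close> starts at \<open>m - mshift g'\<close>, that of
  \<open>g'\<close> at \<open>m + mshift g\<close>.\<close>

abbreviation "Ew \<sigma> \<equiv> lcoef q q' g \<sigma> L L' M M'"
abbreviation "Ew' \<sigma> \<equiv> lcoef q q' g' \<sigma> L L' M' M"
abbreviation "Ez \<sigma> k k' \<equiv> lcoef q q' g \<sigma> k k' (M * qmshift q' q g') (M' * qmshift q q' g')"
abbreviation "Ez' \<sigma> k k' \<equiv> lcoef q q' g' \<sigma> k k' (M' * qmshift q' q g) (M * qmshift q q' g)"

text \<open>Two-step paths sorted by their total shift of \<open>l\<close>: the first two identities
  belong to 2 and -2, the next two to 0, the fifth and sixth to 1, the last two to -1. Those for 1
  and -1 have the shape of \<open>c1\<close> and \<open>c2\<close> in \<open>lin_solve\<close>, the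
  last pair with \<open>L * q'\<close> in place of \<open>L\<close>. With inverses kept as separate
  variables they are identities of Laurent polynomials, decided by normalisation for each of the
  nine pairs of generators.\<close>

lemma lcoef_comm:
  shows "Ez' 1 (L*q) (L'*q') * Ew 1 = Ez 1 (L*q) (L'*q') * Ew' 1" (is ?X1)
    "Ez' (-1) (L*q') (L'*q) * Ew (-1) = Ez (-1) (L*q') (L'*q) * Ew' (-1)" (is ?X2)
    "(q - q') * (Ez' (-1) (L*q) (L'*q') * Ew 1 - Ez (-1) (L*q) (L'*q') * Ew' 1)
      = q^2 * L^2 * (q^3*L^2 - q'^3*L'^2) * (Ez' 0 L L' * Ew 0 - Ez 0 L L' * Ew' 0)" (is ?X3)
    "(q - q') * (Ez' 1 (L*q') (L'*q) * Ew (-1) - Ez 1 (L*q') (L'*q) * Ew' (-1))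
      = - (L^2 * (L^2*q' - q*L'^2)) * (Ez' 0 L L' * Ew 0 - Ez 0 L L' * Ew' 0)" (is ?X4)
    "Ez' 1 L L' * Ew 0 * (L^3*q^4 - L') + - (Ez 0 (L*q) (L'*q') * Ew' 1) * q^2 * (L^3-L') + - (Ez 1 L L' * Ew' 0) * L * (1-q^4) = 0" (is ?X5)
    "Ez' 1 L L' * Ew 0 * (L'*q'^2 - L^3*q^6) + - (Ez 0 (L*q) (L'*q') * Ew' 1) * q^2 * (L'*q'^2 - L^3*q^2)
      + Ez' 0 (L*q) (L'*q') * Ew 1 * L * (1-q^4) = 0" (is ?X6)
    "- (Ez 0 (L*q') (L'*q) * Ew' (-1)) * ((L*q')^3*q^4 - L'*q) + Ez' (-1) L L' * Ew 0 * q^2 * ((L*q')^3 - L'*q)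
      + Ez' 0 (L*q') (L'*q) * Ew (-1) * (L*q') * (1-q^4) = 0" (is ?X7)
    "- (Ez 0 (L*q') (L'*q) * Ew' (-1)) * ((L'*q)*q'^2 - (L*q')^3*q^6) + Ez' (-1) L L' * Ew 0 * q^2 * ((L'*q)*q'^2 - (L*q')^3*q^2)
      + - (Ez (-1) L L' * Ew' 0) * (L*q') * (1-q^4) = 0" (is ?X8)
proof -
  have [simp]: "q * (q' * x) = x" "L * (L' * x) = x" "M * (M' * x) = x" for x
    using q L M by (simp_all add: mult.assoc[symmetric])
  note [simp] = q L M
  show ?X1 ?X2 ?X3 ?X4 ?X5 ?X6 ?X7 ?X8
    using g by (safe; simp add: algebra_simps eval_nat_numeral)+
qed

end

section \<open>Gauge by square roots of quantum factorials\<close>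

definition sqrt_qfact :: "real \<Rightarrow> real \<Rightarrow> real" where
  "sqrt_qfact q z = sqrt (\<Prod>i\<in>{1..nat \<lfloor>z\<rfloor>}. qnum q (real i))"

lemma sqrt_qfact_pos: "0 < q \<Longrightarrow> q < 1 \<Longrightarrow> 0 < sqrt_qfact q z"
  unfolding sqrt_qfact_def by (auto intro!: prod_pos qnum_pos)

lemma sqrt_qfact_up:
  assumes "z \<in> \<nat>" shows "sqrt (qnum q (z+1)) * sqrt_qfact q z = sqrt_qfact q (z+1)"
proof -
  obtain n where n: "z = real n" using assms by (auto elim: Nats_cases)
  then have "nat \<lfloor>z + 1\<rfloor> = Suc n" "nat \<lfloor>z\<rfloor> = n" by (simp_all add: nat_add_distrib)
  then show ?thesis by (simp add: sqrt_qfact_def real_sqrt_mult n algebra_simps)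
qed

lemma Nats_cases_minus:
  assumes "(z::real) \<in> \<nat>" obtains "z = 0" | "z - 1 \<in> \<nat>" "z \<ge> 1"
proof -
  obtain n where n: "z = real n" using assms by (auto elim: Nats_cases)
  show thesis using that by (cases n) (auto simp: n)
qed

text \<open>Going up, the factorial swallows the square root; going down, the root is completed to a
  whole bracket. Either way no root remains. At \<open>z = 0\<close> both sides vanish, whatever the
  value of \<open>sqrt_qfact\<close> at -1.\<close>

lemma sqrt_qfact_down:
  assumes q: "0 < q" "q < 1" and z: "z \<in> \<nat>" shows "sqrt (qnum q z) * sqrt_qfact q z = qnum q z * sqrt_qfact q (z-1)"
  using z
proof (cases rule: Nats_cases_minus)
  case 2
  with sqrt_qfact_up[OF 2(1), of q] have "sqrt_qfact q z = sqrt (qnum q z) * sqrt_qfact q (z-1)" by simp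
  moreover have "sqrt (qnum q z) * sqrt (qnum q z) = qnum q z" using qnum_nonneg[OF q, of z] 2 by simp
  ultimately show ?thesis by (metis mult.assoc)
qed simp

lemma sqrt_qfact_up2:
  assumes "z \<in> \<nat>" shows "sqrt (qnum q (z+1) * qnum q (z+2)) * sqrt_qfact q z = sqrt_qfact q (z+2)"
    "sqrt (qnum q (z+2) * qnum q (z+1)) * sqrt_qfact q z = sqrt_qfact q (z+2)"
proof -
  have e: "z + 1 + 1 = z + 2" by simp
  have "sqrt (qnum q (z+2)) * (sqrt (qnum q (z+1)) * sqrt_qfact q z) = sqrt_qfact q (z+2)"
    using sqrt_qfact_up[OF assms, of q] sqrt_qfact_up[of "z+1" q] assms unfolding e by simp
  then show "sqrt (qnum q (z+1) * qnum q (z+2)) * sqrt_qfact q z = sqrt_qfact q (z+2)"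
    "sqrt (qnum q (z+2) * qnum q (z+1)) * sqrt_qfact q z = sqrt_qfact q (z+2)"
    by (simp_all only: real_sqrt_mult mult_ac)
qed

lemma sqrt_qfact_down2:
  assumes q: "0 < q" "q < 1" and z: "z \<in> \<nat>"
  shows "sqrt (qnum q z * qnum q (z-1)) * sqrt_qfact q z = qnum q z * qnum q (z-1) * sqrt_qfact q (z-2)"
  using z
proof (cases rule: Nats_cases_minus)
  case 2
  have e: "z - 1 - 1 = z - 2" by simp
  show ?thesis using sqrt_qfact_down[OF q z] sqrt_qfact_down[OF q 2(1)] unfolding e
    by (simp add: real_sqrt_mult) (metis mult.assoc mult.commute)
qed simp

definition LC where "LC q g \<sigma> l m = lcoef q (1/q) g \<sigma> (q powr l) (q powr (-l)) (q powr m) (q powr (-m))"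

text \<open>The factor that depends on \<open>N\<close>. Its denominators undo the passage from
  brackets to Laurent polynomials, which multiplies by \<open>q - 1/q\<close> once for
  \<open>\<sigma> = 0\<close> and twice for \<open>\<sigma> = -1\<close>. \<open>r_minus\<close> is
  expressed by \<open>r_plus\<close>, its factor \<open>- q powr (2 * l)\<close> being part of
  \<open>lcoef\<close>.\<close>

definition rv :: "real \<Rightarrow> real \<Rightarrow> real \<Rightarrow> real \<Rightarrow> real" where
  "rv q N \<sigma> l = (if \<sigma> = 1 then q powr (-N) * r_plus_sym q N l else if \<sigma> = 0 then r_zero_reg q N l / (q - 1/q)
     else q powr (-N) * r_plus_sym q N (l-1) / (q-1/q)^2)"

fun gscale :: "real \<Rightarrow> podles_expr \<Rightarrow> real" where
  "gscale q Gen_A = q powr (-1/2) / (1 + q^2)" | "gscale q _ = 1"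

text \<open>The summand q^(1/2) in the diagonal part of \<open>A\<close> is not multiplied by
  \<open>r_zero\<close>; times the prefactor it gives this constant.\<close>

definition gconst :: "real \<Rightarrow> podles_expr \<Rightarrow> real \<Rightarrow> real" where
  "gconst q g \<sigma> = (if g = Gen_A \<and> \<sigma> = 0 then 1 / (1 + q^2) else 0)"

definition HC where "HC q N g \<sigma> l m = gscale q g * LC q g \<sigma> l m * rv q N \<sigma> l + gconst q g \<sigma>"

lemma kappa_neg: "0 < q \<Longrightarrow> q < 1 \<Longrightarrow> q - 1/q < (0::real)"
  using bracket_neg[of q 1 1] by (smt (verit) less_divide_eq_1_pos)

lemma qnum_frac:
  assumes "0 < q" shows "qnum q x = (q powr x - 1 / q powr x) / (q - 1/q)"
  using assms by (simp add: qnum_def powr_minus inverse_eq_divide)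

text \<open>Translation of the Laurent polynomials back into brackets. For the diagonal of
  \<open>A\<close> the difference of the two products of brackets collapses, so that one factor
  \<open>q - 1/q\<close> is left over instead of two.\<close>

lemma LC_qnum:
  assumes q: "0 < q" "q < 1"
  defines "k \<equiv> q - 1/q"
  shows "LC q Gen_B 1 l m = q powr m"
   "LC q Gen_B 0 l m = k * (q powr m * qnum q (l - m))"
   "LC q Gen_B (-1) l m = - (k^2) * q powr (2*l) * (q powr m * (qnum q (l - m) * qnum q (l - m - 1)))"
   "LC q Gen_Bstar 1 l m = - (q powr (m-1) * q powr (2*l+2))"
   "LC q Gen_Bstar 0 l m = k * (q powr (m-1) * qnum q (l + m))"
   "LC q Gen_Bstar (-1) l m = k^2 * (q powr (m-1) * (qnum q (l + m) * qnum q (l + m - 1)))"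
   "q powr (-1/2) * LC q Gen_A 1 l m = - (1 + q^2) * q powr (m + l + 1/2)"
   "LC q Gen_A 0 l m = k * (qnum q (l - m + 1) * qnum q (l + m) - q powr 2 * qnum q (l - m) * qnum q (l + m + 1))"
   "q powr (-1/2) * LC q Gen_A (-1) l m = - (1 + q^2) * k^2 * q powr (2*l) * q powr (m - l - 1/2) * (qnum q (l - m) * qnum q (l + m))"
proof -
  define L where "L = q powr l"
  define M where "M = q powr m"
  have pos: "L > 0" "M > 0" using q by (auto simp: L_def M_def)
  have k: "k < 0" using kappa_neg[OF q] by (simp add: k_def)
  have l2: "q powr (2*l) = L^2" by (simp add: L_def power2_eq_square powr_add[symmetric])
  have e: "q powr (l - m) = L/M" "q powr (l - m - 1) = L/M/q" "q powr (l+m) = L*M"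
    "q powr (l + m - 1) = L*M/q" "q powr (l+m+1) = L*M*q" "q powr (l-m+1) = L/M*q"
    "q powr (m-1) = M/q" "q powr (2*l) = L^2" "q powr (2*l+2) = L^2*q^2" "q powr 2 = q^2"
    using q l2 by (simp_all add: L_def M_def powr_add powr_diff powr_numeral)
  have Q: "qnum q x = (q powr x - 1 / q powr x)/k" for x using qnum_frac[OF q(1)] by (simp add: k_def)
  have neg: "q powr (-l) = 1/L" "q powr (-m) = 1/M"
    by (simp_all add: L_def M_def powr_minus inverse_eq_divide)
  note LCD = LC_def neg L_def[symmetric] M_def[symmetric]
  show "LC q Gen_B 1 l m = q powr m" by (simp add: LCD)
  show "LC q Gen_B 0 l m = k * (q powr m * qnum q (l - m))"
    using pos k q unfolding Q e LCD by (simp add: field_simps power2_eq_square)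
  show "LC q Gen_B (-1) l m = - (k^2) * q powr (2*l) * (q powr m * (qnum q (l - m) * qnum q (l - m - 1)))"
    using pos k q unfolding Q e LCD by (simp add: field_simps power2_eq_square)
  show "LC q Gen_Bstar 1 l m = - (q powr (m-1) * q powr (2*l+2))"
    using pos k q unfolding Q e LCD by (simp add: field_simps power2_eq_square)
  show "LC q Gen_Bstar 0 l m = k * (q powr (m-1) * qnum q (l + m))"
    using pos k q unfolding Q e LCD by (simp add: field_simps power2_eq_square)
  show "LC q Gen_Bstar (-1) l m = k^2 * (q powr (m-1) * (qnum q (l + m) * qnum q (l + m - 1)))"
    using pos k q unfolding Q e LCD by (simp add: field_simps power2_eq_square)
  have h: "q powr (m + l + 1/2) = q powr (-1/2) * (q*M*L)" "q powr (m-l-1/2) = q powr (-1/2) * M / L"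
  proof -
    have "m + l + 1/2 = (-1/2) + (1 + (m + l))" "m - l - 1/2 = (-1/2) + (m - l)" by simp_all
    then show "q powr (m + l + 1/2) = q powr (-1/2) * (q*M*L)" "q powr (m-l-1/2) = q powr (-1/2) * M / L"
      using q by (simp_all only: powr_add powr_diff L_def M_def powr_one) simp_all
  qed
  show "q powr (-1/2) * LC q Gen_A 1 l m = - (1 + q^2) * q powr (m + l + 1/2)"
    unfolding h LCD by (simp add: algebra_simps)
  show "LC q Gen_A 0 l m = k * (qnum q (l - m + 1) * qnum q (l + m) - q powr 2 * qnum q (l - m) * qnum q (l + m + 1))"
  proof -
    have "k^2 * LC q Gen_A 0 l m = k * k^2 * (qnum q (l - m + 1) * qnum q (l + m) - q powr 2 * qnum q (l - m) * qnum q (l + m + 1))"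
    proof -
      have eq1: "k * k^2 * (qnum q (l - m + 1) * qnum q (l + m) - q powr 2 * qnum q (l - m) * qnum q (l + m + 1)) =
        k * ((L/M*q - 1/(L/M*q)) * (L*M - 1/(L*M)) - q^2 * (L/M - 1/(L/M)) * (L*M*q - 1/(L*M*q)))"
        unfolding Q e using k by (simp add: field_simps power2_eq_square)
      have eq2: "((L/M*q - 1/(L/M*q)) * (L*M - 1/(L*M)) - q^2 * (L/M - 1/(L/M)) * (L*M*q - 1/(L*M*q))) =
        (q - 1/q) * ((1+q^2) * M^2 - (1/L)^2 - q^2 * L^2)"
        using pos q by (simp add: field_simps power2_eq_square)
      show ?thesis unfolding eq1 eq2 LCD by (simp add: k_def power2_eq_square)
    qed
    then have "k^2 * LC q Gen_A 0 l m = k^2 * (k * (qnum q (l - m + 1) * qnum q (l + m) - q powr 2 * qnum q (l - m) * qnum q (l + m + 1)))"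
      by (simp only: mult_ac)
    then show ?thesis using k mult_left_cancel[of "k^2"] by simp
  qed
  show "q powr (-1/2) * LC q Gen_A (-1) l m = - (1 + q^2) * k^2 * q powr (2*l) * q powr (m - l - 1/2) * (qnum q (l - m) * qnum q (l + m))"
    unfolding h Q e LCD using pos k q by (simp add: field_simps power2_eq_square)
qed

lemma V_basisD: "(l, m) \<in> V_basis N \<Longrightarrow> l - \<bar>N\<bar> \<in> \<nat> \<and> l + m \<in> \<nat> \<and> l - m \<in> \<nat>"
  by (simp add: V_basis_def)

lemma V_basis_bounds: assumes "(l, m) \<in> V_basis N" shows "l \<ge> \<bar>N\<bar>" "m \<le> l" "- l \<le> m" "0 \<le> l"
proof -
  have "x \<ge> 0" if "x \<in> \<nat>" for x :: real using that by (auto elim: Nats_cases)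
  from this[of "l - \<bar>N\<bar>"] this[of "l+m"] this[of "l-m"] V_basisD[OF assms]
  have *: "l - \<bar>N\<bar> \<ge> 0" "l + m \<ge> 0" "l - m \<ge> 0" by blast+
  then show "l \<ge> \<bar>N\<bar>" "m \<le> l" "- l \<le> m" "0 \<le> l" by auto
qed

lemma r_minus_eq: "r_minus q N l = - (q powr (2*l)) * (q powr (-N) * r_plus_sym q N (l-1))"
  by (simp add: r_minus_def r_plus_eq)

text \<open>Conjugation by the diagonal rescaling: the factor of the source stands on the left, that
  of the target on the right. When the target is not a label, both sides are zero.\<close>

lemma gauge:
  assumes q: "0 < q" "q < 1" and lm: "(l, m) \<in> V_basis N" and g: "g \<in> gens" and s: "\<sigma> \<in> {-1,0,1}"
  shows "coef q N g \<sigma> l m * (sqrt_qfact q (l+m) * sqrt_qfact q (l-m)) =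
    HC q N g \<sigma> l m * (sqrt_qfact q (l + \<sigma> + m + mshift g) * sqrt_qfact q (l + \<sigma> - m - mshift g))"
proof -
  define k where "k = q - 1/q"
  have k: "k \<noteq> 0" using kappa_neg[OF q] by (simp add: k_def)
  have x: "l + m \<in> \<nat>" and y: "l - m \<in> \<nat>" using lm by (auto simp: V_basis_def)
  have q2: "1 + q^2 \<noteq> 0" by (metis add_pos_nonneg less_irrefl zero_le_power2 zero_less_one)
  have q2': "q powr 2 = q^2" using q by (simp add: powr_numeral)
  note up = sqrt_qfact_up[OF x, of q] sqrt_qfact_up[OF y, of q] sqrt_qfact_up2[OF x, of q] sqrt_qfact_up2[OF y, of q]
   and down = sqrt_qfact_down[OF q x] sqrt_qfact_down[OF q y] sqrt_qfact_down2[OF q x] sqrt_qfact_down2[OF q y]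
  note LCq = LC_qnum[OF q, folded k_def]
  \<comment> \<open>The two functions differ only at the label (0, 0) of \<open>V_0\<close>, where
    the brackets in front of them are zero.\<close>
  have rz0: "r_zero q N l = r_zero_reg q N l \<or> l = 0 \<and> m = 0 \<and> N = 0"
    using V_basis_bounds[OF lm] by (auto simp: r_zero_reg_def)
  have hq: "q powr (-1/2) * q powr (1/2) = 1" using q by (simp add: powr_add[symmetric])
  note defs = HC_def gconst_def rv_def k_def[symmetric] r_plus_eq r_minus_eq
  have r1: "coef q N Gen_B 1 l m * (sqrt_qfact q (l+m) * sqrt_qfact q (l-m)) = HC q N Gen_B 1 l m * (sqrt_qfact q (l + m + 2) * sqrt_qfact q (l-m))"
    by (simp add: defs LCq up(3)[symmetric] mult_ac)
  have r2: "coef q N Gen_B 0 l m * (sqrt_qfact q (l+m) * sqrt_qfact q (l-m)) = HC q N Gen_B 0 l m * (sqrt_qfact q (l + m + 1) * sqrt_qfact q (l-m-1))"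
  proof -
    have "coef q N Gen_B 0 l m * (sqrt_qfact q (l+m) * sqrt_qfact q (l-m)) =
      q powr m * ((sqrt (qnum q (l+m+1)) * sqrt_qfact q (l+m)) * (sqrt (qnum q (l-m)) * sqrt_qfact q (l-m))) * r_zero q N l"
      by (simp add: real_sqrt_mult mult_ac)
    also have "\<dots> = HC q N Gen_B 0 l m * (sqrt_qfact q (l + m + 1) * sqrt_qfact q (l-m-1))"
      unfolding up down using rz0 k by (auto simp: defs LCq mult_ac)
    finally show ?thesis .
  qed
  have r3: "coef q N Gen_B (-1) l m * (sqrt_qfact q (l+m) * sqrt_qfact q (l-m)) = HC q N Gen_B (-1) l m * (sqrt_qfact q (l + m) * sqrt_qfact q (l-m-2))"
  proof -
    have "coef q N Gen_B (-1) l m * (sqrt_qfact q (l+m) * sqrt_qfact q (l-m)) =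
      q powr m * (sqrt_qfact q (l+m) * (sqrt (qnum q (l-m) * qnum q (l-m-1)) * sqrt_qfact q (l-m))) * r_minus q N l"
      by (simp add: mult_ac)
    also have "\<dots> = HC q N Gen_B (-1) l m * (sqrt_qfact q (l + m) * sqrt_qfact q (l-m-2))"
      unfolding down using k by (auto simp: defs LCq mult_ac)
    finally show ?thesis .
  qed
  have r4: "coef q N Gen_Bstar 1 l m * (sqrt_qfact q (l+m) * sqrt_qfact q (l-m)) = HC q N Gen_Bstar 1 l m * (sqrt_qfact q (l + m) * sqrt_qfact q (l-m+2))"
    by (simp add: defs LCq up(6)[symmetric] mult_ac distrib_left)
  have r5: "coef q N Gen_Bstar 0 l m * (sqrt_qfact q (l+m) * sqrt_qfact q (l-m)) = HC q N Gen_Bstar 0 l m * (sqrt_qfact q (l + m - 1) * sqrt_qfact q (l-m+1))"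
  proof -
    have "coef q N Gen_Bstar 0 l m * (sqrt_qfact q (l+m) * sqrt_qfact q (l-m)) =
      q powr (m-1) * ((sqrt (qnum q (l+m)) * sqrt_qfact q (l+m)) * (sqrt (qnum q (l-m+1)) * sqrt_qfact q (l-m))) * r_zero q N l"
      by (simp add: real_sqrt_mult mult_ac)
    also have "\<dots> = HC q N Gen_Bstar 0 l m * (sqrt_qfact q (l + m - 1) * sqrt_qfact q (l-m+1))"
      unfolding up down using rz0 k by (auto simp: defs LCq mult_ac)
    finally show ?thesis .
  qed
  have r6: "coef q N Gen_Bstar (-1) l m * (sqrt_qfact q (l+m) * sqrt_qfact q (l-m)) = HC q N Gen_Bstar (-1) l m * (sqrt_qfact q (l + m - 2) * sqrt_qfact q (l-m))"
  proof -
    have "coef q N Gen_Bstar (-1) l m * (sqrt_qfact q (l+m) * sqrt_qfact q (l-m)) =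
      q powr (m-1) * (sqrt_qfact q (l-m) * (sqrt (qnum q (l+m) * qnum q (l+m-1)) * sqrt_qfact q (l+m))) * r_plus q N (l-1)"
      by (simp add: mult_ac)
    also have "\<dots> = HC q N Gen_Bstar (-1) l m * (sqrt_qfact q (l + m - 2) * sqrt_qfact q (l-m))"
      unfolding down using k by (auto simp: defs LCq mult_ac)
    finally show ?thesis .
  qed
  have r7: "coef q N Gen_A 1 l m * (sqrt_qfact q (l+m) * sqrt_qfact q (l-m)) = HC q N Gen_A 1 l m * (sqrt_qfact q (l + m + 1) * sqrt_qfact q (l-m+1))"
  proof -
    have "coef q N Gen_A 1 l m * (sqrt_qfact q (l+m) * sqrt_qfact q (l-m)) =
      - (q powr (m+l+1/2)) * ((sqrt (qnum q (l+m+1)) * sqrt_qfact q (l+m)) * (sqrt (qnum q (l-m+1)) * sqrt_qfact q (l-m))) * r_plus q N l"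
      by (simp add: real_sqrt_mult mult_ac)
    also have "\<dots> = HC q N Gen_A 1 l m * (sqrt_qfact q (l + m + 1) * sqrt_qfact q (l-m+1))"
    proof -
      have "gscale q Gen_A * LC q Gen_A 1 l m = - (q powr (m+l+1/2))"
        using LCq(7)[of l m] q2 by (simp add: field_simps)
      then show ?thesis unfolding up by (simp add: defs mult_ac del: gscale.simps)
    qed
    finally show ?thesis .
  qed
  have r8: "coef q N Gen_A 0 l m * (sqrt_qfact q (l+m) * sqrt_qfact q (l-m)) = HC q N Gen_A 0 l m * (sqrt_qfact q (l + m) * sqrt_qfact q (l-m))"
  proof -
    have "coef q N Gen_A 0 l m = HC q N Gen_A 0 l m"
    proof -
      have gen: "h / c * (X * r + h') = h / c * (k * X) * (r / k) + 1 / c" if "h * h' = 1" for h h' c X r :: real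
      proof -
        have "h * (X * r + h') = h * (X * r) + 1" using that by (simp only: ring_distribs)
        then have "h / c * (X * r + h') = (h * (X * r) + 1) / c" by simp
        then show ?thesis using k by (simp add: add_divide_distrib)
      qed
      have "coef q N Gen_A 0 l m = q powr (-1/2) / (1 + q^2) *
        ((qnum q (l - m + 1) * qnum q (l + m) - q powr 2 * qnum q (l - m) * qnum q (l + m + 1)) * r_zero_reg q N l + q powr (1/2))"
        using rz0 by (auto simp: q2')
      also have "\<dots> = HC q N Gen_A 0 l m"
        unfolding gen[OF hq] by (simp add: defs LCq)
      finally show ?thesis .
    qed
    then show ?thesis by simp
  qed
  have r9: "coef q N Gen_A (-1) l m * (sqrt_qfact q (l+m) * sqrt_qfact q (l-m)) = HC q N Gen_A (-1) l m * (sqrt_qfact q (l + m - 1) * sqrt_qfact q (l-m-1))"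
  proof -
    have "coef q N Gen_A (-1) l m * (sqrt_qfact q (l+m) * sqrt_qfact q (l-m)) =
      q powr (m-l-1/2) * ((sqrt (qnum q (l+m)) * sqrt_qfact q (l+m)) * (sqrt (qnum q (l-m)) * sqrt_qfact q (l-m))) * r_minus q N l"
      by (simp add: real_sqrt_mult mult_ac)
    also have "\<dots> = HC q N Gen_A (-1) l m * (sqrt_qfact q (l + m - 1) * sqrt_qfact q (l-m-1))"
    proof -
      have "gscale q Gen_A * LC q Gen_A (-1) l m = - (k^2) * q powr (2*l) * q powr (m - l - 1/2) * (qnum q (l - m) * qnum q (l + m))"
        using LCq(9)[of l m] q2 by (simp add: field_simps)
      then show ?thesis unfolding down using k by (simp add: defs mult_ac del: gscale.simps)
    qed
    finally show ?thesis .
  qed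
  have fin: ?thesis if "g = G" "\<sigma> = S" "coef q N G S l m * (sqrt_qfact q (l+m) * sqrt_qfact q (l-m)) = HC q N G S l m * (sqrt_qfact q a * sqrt_qfact q b)"
      "a = l + S + m + mshift G" "b = l + S - m - mshift G" for G S a b
    using that by (simp del: coef.simps)
  consider "g = Gen_B" "\<sigma> = 1" | "g = Gen_B" "\<sigma> = 0" | "g = Gen_B" "\<sigma> = (-1)" | "g = Gen_Bstar" "\<sigma> = 1" | "g = Gen_Bstar" "\<sigma> = 0" | "g = Gen_Bstar" "\<sigma> = (-1)" | "g = Gen_A" "\<sigma> = 1" | "g = Gen_A" "\<sigma> = 0" | "g = Gen_A" "\<sigma> = (-1)"
    using g s by auto
  then show ?thesis
  proof cases
    case 1 show ?thesis by (rule fin[OF 1 r1]) simp_all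
  next
    case 2 show ?thesis by (rule fin[OF 2 r2]) simp_all
  next
    case 3 show ?thesis by (rule fin[OF 3 r3]) simp_all
  next
    case 4 show ?thesis by (rule fin[OF 4 r4]) simp_all
  next
    case 5 show ?thesis by (rule fin[OF 5 r5]) simp_all
  next
    case 6 show ?thesis by (rule fin[OF 6 r6]) simp_all
  next
    case 7 show ?thesis by (rule fin[OF 7 r7]) simp_all
  next
    case 8 show ?thesis by (rule fin[OF 8 r8]) simp_all
  next
    case 9 show ?thesis by (rule fin[OF 9 r9]) simp_all
  qed
qed

lemma r_plus_edge: "r_plus q N (\<bar>N\<bar> - 1) = 0"
  by (auto simp: r_plus_def abs_if)

lemma Nats_diff_1: "(x::real) \<in> \<nat> \<Longrightarrow> x - 1 \<notin> \<nat> \<Longrightarrow> x = 0"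
  by (erule Nats_cases_minus) auto

lemma Nats_diff_2: "(x::real) \<in> \<nat> \<Longrightarrow> x - 2 \<notin> \<nat> \<Longrightarrow> x = 0 \<or> x = 1"
proof -
  have e: "x - 2 = x - 1 - 1" by simp
  assume "x \<in> \<nat>" "x - 2 \<notin> \<nat>" then show ?thesis unfolding e
    by (metis Nats_diff_1 diff_eq_diff_eq diff_0_right eq_iff_diff_eq_0)
qed

text \<open>Steps up in \<open>l\<close> stay inside. Falling below \<open>|N|\<close> is stopped by
  \<open>r_plus_edge\<close>, and exceeding the range of \<open>m\<close> by a zero bracket: a move
  that lowers \<open>l - m\<close> or \<open>l + m\<close> by two carries two consecutive brackets,
  one of which is \<open>[0]\<close> if that number is 0 or 1.\<close>

lemma coef_leave:
  assumes lm: "(l, m) \<in> V_basis N" and g: "g \<in> gens" and s: "\<sigma> \<in> {-1,0,1}"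
    and out: "(l + \<sigma>, m + mshift g) \<notin> V_basis N"
  shows "coef q N g \<sigma> l m = 0"
proof -
  have nat: "l - \<bar>N\<bar> \<in> \<nat>" "l + m \<in> \<nat>" "l - m \<in> \<nat>" using lm by (auto simp: V_basis_def)
  have nat1: "l + 1 - \<bar>N\<bar> \<in> \<nat>" "l + m + 1 \<in> \<nat>" "l + m + 2 \<in> \<nat>" "l - m + 1 \<in> \<nat>"  "l - m + 2 \<in> \<nat>"
  proof -
    have "(l - \<bar>N\<bar>) + 1 \<in> \<nat>" using nat by (intro Nats_add) auto
    then show "l + 1 - \<bar>N\<bar> \<in> \<nat>" by (simp add: algebra_simps)
  qed (use nat in \<open>auto intro!: Nats_add\<close>)
  have low: "l = \<bar>N\<bar>" if "l - 1 - \<bar>N\<bar> \<notin> \<nat>"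
    using Nats_diff_1[OF nat(1)] that by (simp add: algebra_simps)
  have edge: "r_minus q N l = 0" "r_plus q N (l - 1) = 0" if "l - 1 - \<bar>N\<bar> \<notin> \<nat>"
    using low[OF that] r_plus_edge[of q N] by (simp_all add: r_minus_def)
  note nn = Nats_diff_1[OF nat(2)] Nats_diff_1[OF nat(3)] Nats_diff_2[OF nat(2)] Nats_diff_2[OF nat(3)]
  have z: "qnum q (l - m) * qnum q (l - m - 1) = 0" if "l - m - 2 \<notin> \<nat>" using nn(4)[OF that] by auto
  have z': "qnum q (l + m) * qnum q (l + m - 1) = 0" if "l + m - 2 \<notin> \<nat>" using nn(3)[OF that] by auto
  have out': "\<not> (l + \<sigma> - \<bar>N\<bar> \<in> \<nat> \<and> l + \<sigma> + (m + mshift g) \<in> \<nat> \<and> l + \<sigma> - (m + mshift g) \<in> \<nat>)"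
    using out by (simp add: V_basis_def)
  have leave: "a \<notin> \<nat> \<or> b \<notin> \<nat> \<or> c \<notin> \<nat>" if "l + \<sigma> - \<bar>N\<bar> = a" "l + \<sigma> + (m + mshift g) = b" "l + \<sigma> - (m + mshift g) = c" for a b c
    using out' unfolding that by blast
  consider "g = Gen_B" | "g = Gen_Bstar" | "g = Gen_A" using g by auto
  then show ?thesis
  proof cases
    case 1
    have "l - 1 - \<bar>N\<bar> \<notin> \<nat> \<or> l - m - 2 \<notin> \<nat>" if "\<sigma> = -1"
      using leave[of "l - 1 - \<bar>N\<bar>" "l + m" "l - m - 2"] that nat by (simp add: 1)
    moreover have "l - m - 1 \<notin> \<nat>" if "\<sigma> = 0"
      using leave[of "l - \<bar>N\<bar>" "l + m + 1" "l - m - 1"] that nat nat1 by (simp add: 1)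
    moreover have "\<sigma> \<noteq> 1"
      using leave[of "l + 1 - \<bar>N\<bar>" "l + m + 2" "l - m"] nat nat1 by (auto simp: 1)
    ultimately show ?thesis using s nn(2) z edge(1) by (auto simp: 1)
  next
    case 2
    have "l - 1 - \<bar>N\<bar> \<notin> \<nat> \<or> l + m - 2 \<notin> \<nat>" if "\<sigma> = -1"
      using leave[of "l - 1 - \<bar>N\<bar>" "l + m - 2" "l - m"] that nat by (simp add: 2)
    moreover have "l + m - 1 \<notin> \<nat>" if "\<sigma> = 0"
      using leave[of "l - \<bar>N\<bar>" "l + m - 1" "l - m + 1"] that nat nat1 by (simp add: 2)
    moreover have "\<sigma> \<noteq> 1"
      using leave[of "l + 1 - \<bar>N\<bar>" "l + m" "l - m + 2"] nat nat1 by (auto simp: 2)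
    ultimately show ?thesis using s nn(1) z' edge(2) by (auto simp: 2)
  next
    case 3
    have "l - 1 - \<bar>N\<bar> \<notin> \<nat> \<or> l + m - 1 \<notin> \<nat> \<or> l - m - 1 \<notin> \<nat>" if "\<sigma> = -1"
      using leave[of "l - 1 - \<bar>N\<bar>" "l + m - 1" "l - m - 1"] that nat by (simp add: 3)
    moreover have "\<sigma> \<noteq> 1" "\<sigma> \<noteq> 0"
      using leave[of "l + 1 - \<bar>N\<bar>" "l + m + 1" "l - m + 1"] leave[of "l - \<bar>N\<bar>" "l + m" "l - m"]
      nat nat1 by (auto simp: 3)
    ultimately show ?thesis using s nn(1,2) edge(1) by (auto simp: 3)
  qed
qed

text \<open>
  The recurrences \<open>i1\<close> and \<open>i2\<close> express \<open>a\<close>, \<open>a1\<close> through \<open>b\<close>, \<open>b1\<close>, so that a linear relation among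
  the four needs to be checked only on the two coefficients \<open>c1\<close> and \<open>c2\<close>.
\<close>

lemma lin_solve:
  fixes L Z q a a1 b b1 :: real
  assumes q: "0 < q" "q < 1" and L: "L > 0" and Z: "Z > 0"
   and i1: "Z^2 * (- a / L + a1 / (L*q^2)) = L * b - L*q^2 * b1"
   and i2: "(1/Z)^2 * (- b / L + b1 / (L*q^2)) = L * a - L*q^2 * a1"
   and c1: "\<beta>1 * (L^3*q^4 - 1/L) + \<beta>2 * q^2 * (L^3 - 1/L) + \<beta>3 * L * (1-q^4) = 0"
   and c2: "\<beta>1 * (1/L*(1/q)^2 - L^3*q^6) + \<beta>2 * q^2 * (1/L*(1/q)^2 - L^3*q^2) + \<beta>4 * L * (1-q^4) = 0"
  shows "\<beta>1 * (Z * a) + \<beta>2 * (Z * a1) + \<beta>3 * (b / Z) + \<beta>4 * (b1 / Z) = 0"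
proof -
  define A A1 B B1 where "A = Z * a" and "A1 = Z * a1" and "B = b / Z" and "B1 = b1 / Z"
  note AB = this
  have j1: "- A / L + A1 / (L*q^2) = L * B - L*q^2 * B1"
    using arg_cong[OF i1, of "\<lambda>x. x / Z"] Z unfolding AB by (simp add: field_simps power2_eq_square)
  have j2: "L * A - L*q^2 * A1 = - B / L + B1 / (L*q^2)"
  proof -
    have "- b / L + b1 / (L*q^2) = Z^2 * ((1/Z)^2 * (- b / L + b1 / (L*q^2)))" using Z by (simp add: power2_eq_square)
    also have "\<dots> = Z^2 * (L * a - L*q^2 * a1)" by (simp only: i2)
    finally have "(- b / L + b1 / (L*q^2)) / Z = Z * (L * a - L*q^2 * a1)" using Z by (simp add: power2_eq_square)
    moreover have "- B / L + B1 / (L*q^2) = (- b / L + b1 / (L*q^2)) / Z" by (simp add: AB diff_divide_distrib mult.commute)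
    moreover have "L * A - L*q^2 * A1 = Z * (L * a - L*q^2 * a1)" by (simp add: AB algebra_simps)
    ultimately show ?thesis by simp
  qed
  have "q^4 < 1" using q by (simp add: power_less_one_iff)
  then have q4: "1 - q^4 > 0" by simp
  \<comment> \<open>Cramer's rule for \<open>A\<close> and \<open>A1\<close> in the system formed by
    \<open>j1\<close> and \<open>j2\<close>; its determinant is a multiple of
    \<open>1 - q^4\<close>.\<close>
  have a: "A * (L * (1-q^4)) = L^2*q^4 * (- A / L + A1 / (L*q^2)) + (L * A - L*q^2 * A1)"
    using L q by (simp add: field_simps eval_nat_numeral)
  have a1: "A1 * (L * (1-q^4)) = q^2 * (L^2 * (- A / L + A1 / (L*q^2)) + (L * A - L*q^2 * A1))"
    using L q by (simp add: field_simps eval_nat_numeral)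
  have "(L * (1-q^4)) * (\<beta>1 * A + \<beta>2 * A1 + \<beta>3 * B + \<beta>4 * B1)
    = \<beta>1 * (A * (L * (1-q^4))) + \<beta>2 * (A1 * (L * (1-q^4))) + (\<beta>3 * B + \<beta>4 * B1) * (L * (1-q^4))"
    by (simp add: algebra_simps)
  also have "\<dots> = B * (\<beta>1 * (L^3*q^4 - 1/L) + \<beta>2 * q^2 * (L^3 - 1/L) + \<beta>3 * L * (1-q^4))
    + B1 * (\<beta>1 * (1/L*(1/q)^2 - L^3*q^6) + \<beta>2 * q^2 * (1/L*(1/q)^2 - L^3*q^2) + \<beta>4 * L * (1-q^4))"
    unfolding a a1 j1 j2 using L q by (simp add: field_simps eval_nat_numeral)
  also have "\<dots> = 0" unfolding c1 c2 by simp
  finally show ?thesis using q4 L unfolding AB by simp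
qed

lemma qmshift_powr: "0 < q \<Longrightarrow> g \<in> gens \<Longrightarrow> qmshift q (1/q) g = q powr mshift g"
  "0 < q \<Longrightarrow> g \<in> gens \<Longrightarrow> qmshift (1/q) q g = q powr (- mshift g)"
  by (auto simp: powr_minus inverse_eq_divide)

lemma qpow_shift:
  assumes q: "0 < q" and h: "h \<in> gens"
  shows "q powr (l+1) = q powr l * q" "q powr (l-1) = q powr l * (1/q)"
     "q powr (- (l+1)) = q powr (-l) * (1/q)" "q powr (- (l-1)) = q powr (-l) * q"
     "q powr (m + mshift h) = q powr m * qmshift q (1/q) h" "q powr (- (m + mshift h)) = q powr (-m) * qmshift (1/q) q h"
     "q powr (m - mshift h) = q powr m * qmshift (1/q) q h" "q powr (- (m - mshift h)) = q powr (-m) * qmshift q (1/q) h"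
  using q unfolding qmshift_powr[OF q h] by (simp_all add: powr_add powr_diff powr_minus inverse_eq_divide)

lemma r_plus_sym_edge: "r_plus_sym q N (\<bar>N\<bar> - 1) = 0"
  by (auto simp: r_plus_sym_def abs_if)

text \<open>Provides the side conditions of \<open>r_zero_recurrence\<close> and
  \<open>r_plus_r_zero_relation\<close>: \<open>2 * l\<close> is a natural number, so below 1/2 only
  the trivial label occurs, and \<open>l = 1/2\<close> can only be the lowest level.\<close>

lemma V_basis_half:
  assumes lm: "(l, m) \<in> V_basis N" and N: "2 * N \<in> \<int>"
  shows "l = 0 \<and> m = 0 \<and> N = 0 \<or> l \<ge> 1/2" "l = 1/2 \<Longrightarrow> \<bar>N\<bar> = 1/2" "l = \<bar>N\<bar> \<or> l - 1 \<ge> \<bar>N\<bar>"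
proof -
  obtain i where i: "2 * N = of_int i" using N by (auto elim: Ints_cases)
  have b: "l \<ge> \<bar>N\<bar>" "m \<le> l" "- l \<le> m" "0 \<le> l" using V_basis_bounds[OF lm] .
  obtain n where n: "l - \<bar>N\<bar> = real n" using V_basisD[OF lm] by (auto elim: Nats_cases)
  have l2: "2 * l = of_int (\<bar>i\<bar> + 2 * int n)" using i n by (simp add: abs_if split: if_splits)
  show "l = 0 \<and> m = 0 \<and> N = 0 \<or> l \<ge> 1/2"
  proof (cases "\<bar>i\<bar> + 2 * int n \<ge> 1")
    case True
    then have "2 * l \<ge> 1" unfolding l2 by linarith
    then show ?thesis by simp
  next
    case False
    then have "i = 0" "n = 0" by auto
    then show ?thesis using i n b by auto
  qed
  show "l = 1/2 \<Longrightarrow> \<bar>N\<bar> = 1/2"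
  proof -
    assume "l = 1/2"
    then have "of_int (\<bar>i\<bar> + 2 * int n) = (1::real)" using l2 by simp
    then have "\<bar>i\<bar> + 2 * int n = 1" by linarith
    then have "n = 0" by auto
    then show ?thesis using n \<open>l = 1/2\<close> by simp
  qed
  show "l = \<bar>N\<bar> \<or> l - 1 \<ge> \<bar>N\<bar>" using n by (cases n) auto
qed

section \<open>Commutation of the gauged and of the original coefficients\<close>

context
  fixes q l m :: real and g g' :: podles_expr
  assumes q: "0 < q" "q < 1" and g: "g \<in> gens" "g' \<in> gens"
begin

abbreviation "Lw \<sigma> \<equiv> LC q g \<sigma> l m"
abbreviation "Lw' \<sigma> \<equiv> LC q g' \<sigma> l (- m)"
abbreviation "Lz \<sigma> k \<equiv> LC q g \<sigma> k (m - mshift g')"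
abbreviation "Lz' \<sigma> k \<equiv> LC q g' \<sigma> k (- (m + mshift g))"

lemma LC_comm:
  defines "L \<equiv> q powr l" and "L' \<equiv> q powr (- l)"
  shows "Lz' 1 (l+1) * Lw 1 = Lz 1 (l+1) * Lw' 1" (is ?X1)
    "Lz' (-1) (l-1) * Lw (-1) = Lz (-1) (l-1) * Lw' (-1)" (is ?X2)
    "(q - 1/q) * (Lz' (-1) (l+1) * Lw 1 - Lz (-1) (l+1) * Lw' 1)
      = q^2 * L^2 * (q^3*L^2 - (1/q)^3*L'^2) * (Lz' 0 l * Lw 0 - Lz 0 l * Lw' 0)" (is ?X3)
    "(q - 1/q) * (Lz' 1 (l-1) * Lw (-1) - Lz 1 (l-1) * Lw' (-1))
      = - (L^2 * (L^2*(1/q) - q*L'^2)) * (Lz' 0 l * Lw 0 - Lz 0 l * Lw' 0)" (is ?X4)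
    "Lz' 1 l * Lw 0 * (L^3*q^4 - L') + - (Lz 0 (l+1) * Lw' 1) * q^2 * (L^3-L') + - (Lz 1 l * Lw' 0) * L * (1-q^4) = 0" (is ?X5)
    "Lz' 1 l * Lw 0 * (L'*(1/q)^2 - L^3*q^6) + - (Lz 0 (l+1) * Lw' 1) * q^2 * (L'*(1/q)^2 - L^3*q^2)
      + Lz' 0 (l+1) * Lw 1 * L * (1-q^4) = 0" (is ?X6)
    "- (Lz 0 (l-1) * Lw' (-1)) * ((L*(1/q))^3*q^4 - L'*q) + Lz' (-1) l * Lw 0 * q^2 * ((L*(1/q))^3 - L'*q)
      + Lz' 0 (l-1) * Lw (-1) * (L*(1/q)) * (1-q^4) = 0" (is ?X7)
    "- (Lz 0 (l-1) * Lw' (-1)) * ((L'*q)*(1/q)^2 - (L*(1/q))^3*q^6) + Lz' (-1) l * Lw 0 * q^2 * ((L'*q)*(1/q)^2 - (L*(1/q))^3*q^2)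
      + - (Lz (-1) l * Lw' 0) * (L*(1/q)) * (1-q^4) = 0" (is ?X8)
proof -
  have i: "q * (1/q) = 1" "q powr l * q powr (-l) = 1" "q powr m * q powr (-m) = 1"
    using q by (simp_all add: powr_add[symmetric])
  note e = qpow_shift[OF q(1) g(1)] qpow_shift[OF q(1) g(2)] minus_minus
  note c = lcoef_comm[OF i g, folded L_def L'_def]
  note d = LC_def e L_def[symmetric] L'_def[symmetric]
  show ?X1 ?X2 ?X3 ?X4 ?X5 ?X6 ?X7 ?X8
    unfolding d by (rule c)+
qed

text \<open>Replaces \<open>r_plus_r_zero_relation\<close>, which requires \<open>l > 0\<close>: at
  the trivial label the diagonal weights of all generators vanish.\<close>

lemma LC_0_0: "l = 0 \<Longrightarrow> m = 0 \<Longrightarrow> Lz' 0 l * Lw 0 - Lz 0 l * Lw' 0 = 0"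
  using q g unfolding LC_def qpow_shift(5-8)[OF q(1) g(1)] qpow_shift(5-8)[OF q(1) g(2)] minus_minus
  by (auto simp: algebra_simps power2_eq_square)

context
  fixes N :: real
  assumes N: "2 * N \<in> \<int>" and lm: "(l, m) \<in> V_basis N"
begin

abbreviation "Hw \<sigma> \<equiv> HC q N g \<sigma> l m"
abbreviation "Hw' \<sigma> \<equiv> HC q (- N) g' \<sigma> l (- m)"
abbreviation "Hz \<sigma> k \<equiv> HC q N g \<sigma> k (m - mshift g')"
abbreviation "Hz' \<sigma> k \<equiv> HC q (- N) g' \<sigma> k (- (m + mshift g))"
abbreviation "Cw \<sigma> \<equiv> coef q N g \<sigma> l m"
abbreviation "Cw' \<sigma> \<equiv> coef q (- N) g' \<sigma> l (- m)"
abbreviation "Cz \<sigma> k \<equiv> coef q N g \<sigma> k (m - mshift g')"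
abbreviation "Cz' \<sigma> k \<equiv> coef q (- N) g' \<sigma> k (- (m + mshift g))"

text \<open>The constant occurs for \<open>A\<close> alone, which does not move \<open>m\<close>; so
  it commutes with every weight and cancels from the relations below.\<close>

lemma gconst_mshift: "gconst q g 0 * f (mshift g) = gconst q g 0 * (f 0 :: real)"
  "gconst q g' 0 * f (mshift g') = gconst q g' 0 * (f 0 :: real)"
  by (auto simp: gconst_def)

text \<open>A single path reaches each extreme shift. The factors \<open>q powr (-N)\<close> and
  \<open>q powr N\<close> cancel, and the rest of \<open>r_plus\<close> is even in
  \<open>N\<close>.\<close>

lemma HC_comm_pm2:
  "Hz' 1 (l+1) * Hw 1 = Hz 1 (l+1) * Hw' 1"
  "Hz' (-1) (l-1) * Hw (-1) = Hz (-1) (l-1) * Hw' (-1)"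
proof -
  have gen: "(x*a*r) * (y*b * s) = (y*c*t) * (x*d*u)" if "a*b = c*d" "r * s = t * u" for a b c d r s t u x y :: real
  proof -
    have "(x*a*r) * (y*b * s) = x*y*(a*b)* (r * s)" by simp
    also have "\<dots> = (y*c*t) * (x*d*u)" unfolding that by simp
    finally show ?thesis .
  qed
  show "Hz' 1 (l+1) * Hw 1 = Hz 1 (l+1) * Hw' 1"
    using gen[OF LC_comm(1), of "rv q (-N) 1 (l+1)" "rv q N 1 l" "rv q N 1 (l+1)" "rv q (-N) 1 l" "gscale q g'" "gscale q g"]
    by (simp add: HC_def gconst_def rv_def r_plus_sym_minus)
  show "Hz' (-1) (l-1) * Hw (-1) = Hz (-1) (l-1) * Hw' (-1)"
    using gen[OF LC_comm(2), of "rv q (-N) (-1) (l-1)" "rv q N (-1) l" "rv q N (-1) (l-1)" "rv q (-N) (-1) l" "gscale q g'" "gscale q g"]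
    by (simp add: HC_def gconst_def rv_def r_plus_sym_minus)
qed

text \<open>Every term contains the same \<open>r_plus_sym q N l\<close>. Without it, a linear
  relation between the diagonal elements on the levels \<open>l\<close> and \<open>l + 1\<close> for
  both signs of \<open>N\<close> remains, which is the situation of
  \<open>lin_solve\<close>.\<close>

lemma HC_comm_p1:
  "Hz' 1 l * Hw 0 + Hz' 0 (l+1) * Hw 1 = Hz 0 (l+1) * Hw' 1 + Hz 1 l * Hw' 0"
proof -
  define Z where "Z = q powr N"
  define k where "k = q - 1/q"
  have Z: "Z > 0" "q powr (-N) = 1 / Z" "q powr (- (- N)) = Z" using q by (simp_all add: Z_def powr_minus inverse_eq_divide)
  have l: "l > 0 \<or> l = 0 \<and> N = 0" "l > 0 \<or> l = 0 \<and> - N = 0" using V_basis_half[OF lm N] by auto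
  have L: "q powr l > 0" using q by simp
  have Li: "q powr (-l) = 1 / q powr l" using q by (simp add: powr_minus inverse_eq_divide)
  define a a1 b b1 where "a = r_zero_reg q N l" and "a1 = r_zero_reg q N (l+1)" and "b = r_zero_reg q (-N) l" and "b1 = r_zero_reg q (-N) (l+1)"
  note ab = this
  have i1: "Z^2 * (- a / q powr l + a1 / (q powr l*q^2)) = q powr l * b - q powr l*q^2 * b1"
    using r_zero_recurrence[OF q l(1)] by (simp add: ab Z_def)
  have i2: "(1/Z)^2 * (- b / q powr l + b1 / (q powr l*q^2)) = q powr l * a - q powr l*q^2 * a1"
    using r_zero_recurrence[OF q l(2)] by (simp add: ab Z)
  define X0 where "X0 = Lz' 1 l * Lw 0"
  define X1 where "X1 = Lz' 0 (l+1) * Lw 1"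
  define Y0 where "Y0 = Lz 0 (l+1) * Lw' 1"
  define Y1 where "Y1 = Lz 1 l * Lw' 0"
  note XY = X0_def[symmetric] X1_def[symmetric] Y0_def[symmetric] Y1_def[symmetric]
  have main: "X0 * (Z * a) + (- Y0) * (Z * a1) + (- Y1) * (b / Z) + X1 * (b1 / Z) = 0"
    by (rule lin_solve[OF q L Z(1) i1 i2 LC_comm(5)[unfolded XY Li] LC_comm(6)[unfolded XY Li]])
  define s where "s = gscale q g * gscale q g' * r_plus_sym q N l / k"
  have "gscale q g' * Lz' 1 l * rv q (-N) 1 l * (gscale q g * Lw 0 * rv q N 0 l) = s * (X0 * (Z * a))"
    "gscale q g' * Lz' 0 (l+1) * rv q (-N) 0 (l+1) * (gscale q g * Lw 1 * rv q N 1 l) = s * (X1 * (b1 / Z))"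
    "gscale q g * Lz 0 (l+1) * rv q N 0 (l+1) * (gscale q g' * Lw' 1 * rv q (-N) 1 l) = s * (Y0 * (Z * a1))"
    "gscale q g * Lz 1 l * rv q N 1 l * (gscale q g' * Lw' 0 * rv q (-N) 0 l) = s * (Y1 * (b / Z))"
    by (simp_all add: s_def X0_def X1_def Y0_def Y1_def rv_def r_plus_sym_minus Z Z_def[symmetric] k_def[symmetric] ab mult_ac)
  note p = this
  have s0: "s * (X0 * (Z * a)) + s * (X1 * (b1 / Z)) = s * (Y0 * (Z * a1)) + s * (Y1 * (b / Z))"
  proof -
    have "s * (X0 * (Z * a)) + s * (X1 * (b1 / Z)) - (s * (Y0 * (Z * a1)) + s * (Y1 * (b / Z)))
      = s * (X0 * (Z * a) + (- Y0) * (Z * a1) + (- Y1) * (b / Z) + X1 * (b1 / Z))" by (simp add: algebra_simps)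
    then show ?thesis unfolding main by simp
  qed
  have gc: "gconst q h 1 = 0" for h by (simp add: gconst_def)
  have fin: "P * (Q + c) + (R + c') * S = (T + c) * U + V * (W + c')"
    if "P * Q + R * S = T * U + V * W" "c * P = c * U" "c' * S = c' * V" for P Q R S T U V W c c' :: real
    using that by algebra
  show ?thesis unfolding HC_def gc add_0_right
    by (rule fin, unfold p, rule s0)
      (use gconst_mshift(1)[of "\<lambda>k. gscale q g' * LC q g' 1 l (-(m + k)) * rv q (-N) 1 l"]
        gconst_mshift(2)[of "\<lambda>k. gscale q g * LC q g 1 l (m - k) * rv q N 1 l"] in auto)
qed

text \<open>The argument for shift 1 with base level \<open>l - 1\<close>. On the lowest level every
  term contains \<open>r_plus_sym\<close> at \<open>|N| - 1\<close>, which is zero.\<close>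

lemma HC_comm_m1:
  "Hz' (-1) l * Hw 0 + Hz' 0 (l-1) * Hw (-1) = Hz 0 (l-1) * Hw' (-1) + Hz (-1) l * Hw' 0"
proof (cases "l - 1 \<ge> \<bar>N\<bar>")
  case False
  then have "l = \<bar>N\<bar>" using V_basis_half(3)[OF lm N] by auto
  then have k0: "r_plus_sym q N (l-1) = 0" "r_plus_sym q (-N) (l-1) = 0" using r_plus_sym_edge[of q N] by (simp_all add: r_plus_sym_minus)
  show ?thesis by (simp add: HC_def rv_def k0 gconst_def)
next
  case True
  define Z where "Z = q powr N"
  define k where "k = q - 1/q"
  have Z: "Z > 0" "q powr (-N) = 1 / Z" "q powr (- (- N)) = Z" using q by (simp_all add: Z_def powr_minus inverse_eq_divide)
  have l: "l - 1 > 0 \<or> l - 1 = 0 \<and> N = 0" "l - 1 > 0 \<or> l - 1 = 0 \<and> - N = 0" using True by auto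
  define L where "L = q powr l * (1/q)"
  have L: "L > 0" "q powr (l-1) = L" using q by (simp_all add: L_def powr_diff)
  have Li: "q powr (-l) * q = 1 / L" using q by (simp add: powr_minus inverse_eq_divide L_def)
  define a a1 b b1 where "a = r_zero_reg q N (l-1)" and "a1 = r_zero_reg q N l" and "b = r_zero_reg q (-N) (l-1)" and "b1 = r_zero_reg q (-N) l"
  note ab = this
  have i1: "Z^2 * (- a / L + a1 / (L*q^2)) = L * b - L*q^2 * b1"
    using r_zero_recurrence[OF q l(1)] by (simp add: ab Z_def L)
  have i2: "(1/Z)^2 * (- b / L + b1 / (L*q^2)) = L * a - L*q^2 * a1"
    using r_zero_recurrence[OF q l(2)] by (simp add: ab Z L)
  define X0 where "X0 = Lz' (-1) l * Lw 0"
  define X1 where "X1 = Lz' 0 (l-1) * Lw (-1)"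
  define Y0 where "Y0 = Lz 0 (l-1) * Lw' (-1)"
  define Y1 where "Y1 = Lz (-1) l * Lw' 0"
  note XY = X0_def[symmetric] X1_def[symmetric] Y0_def[symmetric] Y1_def[symmetric]
  have main: "(- Y0) * (Z * a) + X0 * (Z * a1) + X1 * (b / Z) + (- Y1) * (b1 / Z) = 0"
    by (rule lin_solve[OF q L(1) Z(1) i1 i2 LC_comm(7)[unfolded XY Li L_def[symmetric]] LC_comm(8)[unfolded XY Li L_def[symmetric]]])
  define s where "s = gscale q g * gscale q g' * r_plus_sym q N (l-1) / k^2 / k"
  have "gscale q g' * Lz' (-1) l * rv q (-N) (-1) l * (gscale q g * Lw 0 * rv q N 0 l) = s * (X0 * (Z * a1))"
    "gscale q g' * Lz' 0 (l-1) * rv q (-N) 0 (l-1) * (gscale q g * Lw (-1) * rv q N (-1) l) = s * (X1 * (b / Z))"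
    "gscale q g * Lz 0 (l-1) * rv q N 0 (l-1) * (gscale q g' * Lw' (-1) * rv q (-N) (-1) l) = s * (Y0 * (Z * a))"
    "gscale q g * Lz (-1) l * rv q N (-1) l * (gscale q g' * Lw' 0 * rv q (-N) 0 l) = s * (Y1 * (b1 / Z))"
    by (simp_all add: s_def X0_def X1_def Y0_def Y1_def rv_def r_plus_sym_minus Z Z_def[symmetric] k_def[symmetric] ab mult_ac)
  note p = this
  have s0: "s * (X0 * (Z * a1)) + s * (X1 * (b / Z)) = s * (Y0 * (Z * a)) + s * (Y1 * (b1 / Z))"
  proof -
    have "s * (X0 * (Z * a1)) + s * (X1 * (b / Z)) - (s * (Y0 * (Z * a)) + s * (Y1 * (b1 / Z)))
      = s * ((- Y0) * (Z * a) + X0 * (Z * a1) + X1 * (b / Z) + (- Y1) * (b1 / Z))" by (simp add: algebra_simps)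
    then show ?thesis unfolding main by simp
  qed
  have gc: "gconst q h (-1) = 0" for h by (simp add: gconst_def)
  have fin: "P * (Q + c) + (R + c') * S = (T + c) * U + V * (W + c')"
    if "P * Q + R * S = T * U + V * W" "c * P = c * U" "c' * S = c' * V" for P Q R S T U V W c c' :: real
    using that by algebra
  show ?thesis unfolding HC_def gc add_0_right
    by (rule fin, unfold p, rule s0)
      (use gconst_mshift(1)[of "\<lambda>k. gscale q g' * LC q g' (-1) l (-(m + k)) * rv q (-N) (-1) l"]
        gconst_mshift(2)[of "\<lambda>k. gscale q g * LC q g (-1) l (m - k) * rv q N (-1) l"] in auto)
qed

text \<open>By \<open>LC_comm\<close> the up-down and the down-up differences are multiples of the
  difference \<open>X0 - Y0\<close> of the paths that stay on the level. The common factor that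
  results is zero by \<open>r_plus_r_zero_relation\<close>.\<close>

lemma HC_comm_0:
  "Hz' (-1) (l+1) * Hw 1 + Hz' 0 l * Hw 0
     + Hz' 1 (l-1) * Hw (-1) = Hz (-1) (l+1) * Hw' 1 + Hz 0 l * Hw' 0
     + Hz 1 (l-1) * Hw' (-1)"
proof -
  define Z where "Z = q powr N"
  define k where "k = q - 1/q"
  define W where "W = (q powr l)^2"
  have k: "k < 0" using kappa_neg[OF q] by (simp add: k_def)
  have Z: "Z > 0" "q powr (-N) = 1 / Z" "q powr (- (- N)) = Z" using q by (simp_all add: Z_def powr_minus inverse_eq_divide)
  have Zn: "Z \<noteq> 0" using Z(1) by simp
  have W: "W > 0" "(q powr (-l))^2 = 1/W" "q powr (2*l) = W"
    using q by (simp_all add: W_def powr_minus field_simps power2_eq_square powr_add[symmetric])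
  define a b kk km where "a = r_zero_reg q N l" and "b = r_zero_reg q (-N) l" and "kk = r_plus_sym q N l" and "km = r_plus_sym q N (l-1)"
  note ab = this
  define X1 where "X1 = Lz' (-1) (l+1) * Lw 1"
  define X0 where "X0 = Lz' 0 l * Lw 0"
  define Xm where "Xm = Lz' 1 (l-1) * Lw (-1)"
  define Y1 where "Y1 = Lz (-1) (l+1) * Lw' 1"
  define Y0 where "Y0 = Lz 0 l * Lw' 0"
  define Ym where "Ym = Lz 1 (l-1) * Lw' (-1)"
  note XY = X0_def[symmetric] X1_def[symmetric] Xm_def[symmetric] Y0_def[symmetric] Y1_def[symmetric] Ym_def[symmetric]
  note up = LC_comm(3)[unfolded XY W_def[symmetric] W(2) k_def[symmetric]]
    and down = LC_comm(4)[unfolded XY W_def[symmetric] W(2) k_def[symmetric]]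
  have main: "(X1 - Y1) * kk^2 + (X0 - Y0) * (a * b) + (Xm - Ym) * km^2 = 0"
  proof (cases "l > 0")
    case True
    have st: "q^2 * W * (q^3*W - 1/(q^3*W)) * kk^2 / k + a * b - W * (W/q - q/W) * km^2 / k = 0"
      unfolding ab W_def k_def
      using r_plus_r_zero_relation[OF q True] V_basis_bounds[OF lm] V_basis_half[OF lm N] W(3) True by (simp add: W_def)
    have "k * ((X1 - Y1) * kk^2 + (X0 - Y0) * (a * b) + (Xm - Ym) * km^2) =
      (k * (X1 - Y1)) * kk^2 + k * (X0 - Y0) * (a * b) + (k * (Xm - Ym)) * km^2" by (simp add: algebra_simps)
    also have "\<dots> = k * (X0 - Y0) * (q^2 * W * (q^3*W - 1/(q^3*W)) * kk^2 / k + a * b - W * (W/q - q/W) * km^2 / k)"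
      unfolding up down using k by (simp add: field_simps)
    finally show ?thesis using k unfolding st by simp
  next
    case False
    then have l: "l = 0" "m = 0" using V_basis_half[OF lm N] by auto
    have "X0 - Y0 = 0" using LC_0_0[OF l] unfolding X0_def Y0_def .
    then show ?thesis using up down k by simp
  qed
  define s where "s = gscale q g * gscale q g' / k^2"
  have "gscale q g' * Lz' (-1) (l+1) * rv q (-N) (-1) (l+1) * (gscale q g * Lw 1 * rv q N 1 l) = s * (X1 * kk^2)"
    "gscale q g' * Lz' 0 l * rv q (-N) 0 l * (gscale q g * Lw 0 * rv q N 0 l) = s * (X0 * (a*b))"
    "gscale q g' * Lz' 1 (l-1) * rv q (-N) 1 (l-1) * (gscale q g * Lw (-1) * rv q N (-1) l) = s * (Xm * km^2)"
    "gscale q g * Lz (-1) (l+1) * rv q N (-1) (l+1) * (gscale q g' * Lw' 1 * rv q (-N) 1 l) = s * (Y1 * kk^2)"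
    "gscale q g * Lz 0 l * rv q N 0 l * (gscale q g' * Lw' 0 * rv q (-N) 0 l) = s * (Y0 * (a*b))"
    "gscale q g * Lz 1 (l-1) * rv q N 1 (l-1) * (gscale q g' * Lw' (-1) * rv q (-N) (-1) l) = s * (Ym * km^2)"
    using Zn by (simp_all add: s_def X0_def X1_def Y0_def Y1_def Xm_def Ym_def rv_def r_plus_sym_minus Z Z_def[symmetric] k_def[symmetric] ab power2_eq_square mult_ac)
  note p = this
  have s0: "s * (X1 * kk^2) + s * (X0 * (a*b)) + s * (Xm * km^2) = s * (Y1 * kk^2) + s * (Y0 * (a*b)) + s * (Ym * km^2)"
  proof -
    have "s * (X1 * kk^2) + s * (X0 * (a*b)) + s * (Xm * km^2) - (s * (Y1 * kk^2) + s * (Y0 * (a*b)) + s * (Ym * km^2))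
      = s * ((X1 - Y1) * kk^2 + (X0 - Y0) * (a * b) + (Xm - Ym) * km^2)" by (simp add: algebra_simps)
    then show ?thesis unfolding main by simp
  qed
  have gc: "gconst q h 1 = 0" "gconst q h (-1) = 0" for h by (simp_all add: gconst_def)
  have fin: "A + (P + c') * (Q + c) + B = A' + (R + c) * (S + c') + B'"
    if "A + P * Q + B = A' + R * S + B'" "c * P = c * S" "c' * Q = c' * R" for P Q R S A B A' B' c c' :: real
    using that by algebra
  show ?thesis unfolding HC_def gc add_0_right
    by (rule fin, unfold p, rule s0)
      (use gconst_mshift(1)[of "\<lambda>k. gscale q g' * LC q g' 0 l (-(m + k)) * rv q (-N) 0 l"]
        gconst_mshift(2)[of "\<lambda>k. gscale q g * LC q g 0 l (m - k) * rv q N 0 l"] in auto)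
qed

text \<open>The gauge factor of the intermediate label cancels. If that label is outside, the first
  coefficient is zero, and so is its gauged version because \<open>sqrt_qfact\<close> is positive
  everywhere.\<close>

lemma coef_path:
  assumes s: "\<sigma> \<in> {-1,0,1}" and t: "\<tau> \<in> {-1,0,1}"
  shows "Cz' \<tau> (l + \<sigma>) * Cw \<sigma> * (sqrt_qfact q (l+m) * sqrt_qfact q (l-m)) = Hz' \<tau> (l + \<sigma>) * Hw \<sigma>
        * (sqrt_qfact q (l + (\<sigma> + \<tau>) + (m + mshift g - mshift g')) * sqrt_qfact q (l + (\<sigma> + \<tau>) - (m + mshift g - mshift g')))" (is ?A)
    and "Cz \<sigma> (l + \<tau>) * Cw' \<tau> * (sqrt_qfact q (l+m) * sqrt_qfact q (l-m)) = Hz \<sigma> (l + \<tau>) * Hw' \<tau>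
        * (sqrt_qfact q (l + (\<sigma> + \<tau>) + (m + mshift g - mshift g')) * sqrt_qfact q (l + (\<sigma> + \<tau>) - (m + mshift g - mshift g')))" (is ?B)
proof -
  have flip: "(a, - b) \<in> V_basis (- N) \<longleftrightarrow> (a, b) \<in> V_basis N" for a b
    by (auto simp: V_basis_def)
  have G0: "sqrt_qfact q x > 0" for x using sqrt_qfact_pos[OF q] .
  note g1 = gauge[OF q lm g(1) s]
  have lm': "(l, -m) \<in> V_basis (-N)" using lm by (simp add: flip)
  note g2 = gauge[OF q lm' g(2) t]
  show ?A
  proof (cases "(l + \<sigma>, m + mshift g) \<in> V_basis N")
    case True
    then have "(l + \<sigma>, -(m + mshift g)) \<in> V_basis (-N)" by (simp only: flip)
    note g3 = gauge[OF q this g(2) t]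
    have "Cz' \<tau> (l + \<sigma>) * (Cw \<sigma> * (sqrt_qfact q (l+m) * sqrt_qfact q (l-m)))
      = (Cz' \<tau> (l + \<sigma>) * (sqrt_qfact q (l + \<sigma> + -(m + mshift g)) * sqrt_qfact q (l + \<sigma> - -(m + mshift g)))) * Hw \<sigma>"
      unfolding g1 by (simp add: algebra_simps)
    then show ?thesis unfolding g3 by (simp add: algebra_simps)
  next
    case False
    then have c: "Cw \<sigma> = 0" by (intro coef_leave[OF lm g(1) s])
    then have "Hw \<sigma> = 0" using g1 G0 by (auto simp: less_le)
    then show ?thesis using c by simp
  qed
  show ?B
  proof (cases "(l + \<tau>, m - mshift g') \<in> V_basis N")
    case True
    note g3 = gauge[OF q True g(1) s]
    have "Cz \<sigma> (l + \<tau>) * (Cw' \<tau> * (sqrt_qfact q (l + - m) * sqrt_qfact q (l - - m)))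
      = (Cz \<sigma> (l + \<tau>) * (sqrt_qfact q (l + \<tau> + (m - mshift g')) * sqrt_qfact q (l + \<tau> - (m - mshift g')))) * Hw' \<tau>"
      unfolding g2 by (simp add: algebra_simps)
    then show ?thesis unfolding g3 by (simp add: algebra_simps)
  next
    case False
    then have "(l + \<tau>, - m + mshift g') \<notin> V_basis (-N)" using flip[of "l + \<tau>" "m - mshift g'"] by simp
    then have c: "Cw' \<tau> = 0" by (intro coef_leave[OF lm' g(2) t])
    then have "Hw' \<tau> = 0" using g2 G0 by (auto simp: less_le)
    then show ?thesis using c by simp
  qed
qed

text \<open>The gauge factors depend on the ends of a path only, so they are common to all paths
  with the same total shift and can be divided out.\<close>

lemma coef_comm:
  shows "Cz' 1 (l+1) * Cw 1 = Cz 1 (l+1) * Cw' 1"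
    "Cz' (-1) (l-1) * Cw (-1) = Cz (-1) (l-1) * Cw' (-1)"
    "Cz' 1 l * Cw 0 + Cz' 0 (l+1) * Cw 1 = Cz 0 (l+1) * Cw' 1 + Cz 1 l * Cw' 0"
    "Cz' (-1) l * Cw 0 + Cz' 0 (l-1) * Cw (-1) = Cz 0 (l-1) * Cw' (-1) + Cz (-1) l * Cw' 0"
    "Cz' (-1) (l+1) * Cw 1 + Cz' 0 l * Cw 0 + Cz' 1 (l-1) * Cw (-1) = Cz (-1) (l+1) * Cw' 1 + Cz 0 l * Cw' 0 + Cz 1 (l-1) * Cw' (-1)"
proof -
  define G where "G = sqrt_qfact q (l+m) * sqrt_qfact q (l-m)"
  define H where "H = (\<lambda>s. sqrt_qfact q (l + s + (m + mshift g - mshift g')) * sqrt_qfact q (l + s - (m + mshift g - mshift g')))"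
  have G: "G \<noteq> 0" using sqrt_qfact_pos[OF q, of "l+m"] sqrt_qfact_pos[OF q, of "l-m"] by (simp add: G_def)
  have p: "Cz' \<tau> (l + \<sigma>) * Cw \<sigma> * G = Hz' \<tau> (l + \<sigma>) * Hw \<sigma> * H (\<sigma> + \<tau>)"
    and p': "Cz \<sigma> (l + \<tau>) * Cw' \<tau> * G = Hz \<sigma> (l + \<tau>) * Hw' \<tau> * H (\<sigma> + \<tau>)"
    if "\<sigma> \<in> {-1,0,1}" "\<tau> \<in> {-1,0,1}" for \<sigma> \<tau>
    unfolding G_def H_def by (rule coef_path[OF that])+
  have a: "Cz' (-1) (l-1) * Cw (-1) * G = Hz' (-1) (l-1) * Hw (-1) * H (-2)"
    "Cz' (-1) l * Cw 0 * G = Hz' (-1) l * Hw 0 * H (-1)"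
    "Cz' (-1) (l+1) * Cw 1 * G = Hz' (-1) (l+1) * Hw 1 * H 0"
    "Cz' 0 (l-1) * Cw (-1) * G = Hz' 0 (l-1) * Hw (-1) * H (-1)"
    "Cz' 0 l * Cw 0 * G = Hz' 0 l * Hw 0 * H 0"
    "Cz' 0 (l+1) * Cw 1 * G = Hz' 0 (l+1) * Hw 1 * H 1"
    "Cz' 1 (l-1) * Cw (-1) * G = Hz' 1 (l-1) * Hw (-1) * H 0"
    "Cz' 1 l * Cw 0 * G = Hz' 1 l * Hw 0 * H 1"
    "Cz' 1 (l+1) * Cw 1 * G = Hz' 1 (l+1) * Hw 1 * H 2"
    using p[of "(-1)" "(-1)"] p[of "0" "(-1)"] p[of "1" "(-1)"] p[of "(-1)" "0"] p[of "0" "0"] p[of "1" "0"] p[of "(-1)" "1"] p[of "0" "1"] p[of "1" "1"] by simp_all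
  have b: "Cz (-1) (l-1) * Cw' (-1) * G = Hz (-1) (l-1) * Hw' (-1) * H (-2)"
    "Cz 0 (l-1) * Cw' (-1) * G = Hz 0 (l-1) * Hw' (-1) * H (-1)"
    "Cz 1 (l-1) * Cw' (-1) * G = Hz 1 (l-1) * Hw' (-1) * H 0"
    "Cz (-1) l * Cw' 0 * G = Hz (-1) l * Hw' 0 * H (-1)"
    "Cz 0 l * Cw' 0 * G = Hz 0 l * Hw' 0 * H 0"
    "Cz 1 l * Cw' 0 * G = Hz 1 l * Hw' 0 * H 1"
    "Cz (-1) (l+1) * Cw' 1 * G = Hz (-1) (l+1) * Hw' 1 * H 0"
    "Cz 0 (l+1) * Cw' 1 * G = Hz 0 (l+1) * Hw' 1 * H 1"
    "Cz 1 (l+1) * Cw' 1 * G = Hz 1 (l+1) * Hw' 1 * H 2"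
    using p'[of "(-1)" "(-1)"] p'[of "0" "(-1)"] p'[of "1" "(-1)"] p'[of "(-1)" "0"] p'[of "0" "0"] p'[of "1" "0"] p'[of "(-1)" "1"] p'[of "0" "1"] p'[of "1" "1"] by simp_all
  have "(Cz' 1 (l+1) * Cw 1) * G = (Cz 1 (l+1) * Cw' 1) * G"
    unfolding ring_distribs a b unfolding ring_distribs(2)[symmetric] HC_comm_pm2(1) ..
  then show "Cz' 1 (l+1) * Cw 1 = Cz 1 (l+1) * Cw' 1" using G by simp
  have "(Cz' (-1) (l-1) * Cw (-1)) * G = (Cz (-1) (l-1) * Cw' (-1)) * G"
    unfolding ring_distribs a b unfolding ring_distribs(2)[symmetric] HC_comm_pm2(2) ..
  then show "Cz' (-1) (l-1) * Cw (-1) = Cz (-1) (l-1) * Cw' (-1)" using G by simp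
  have "(Cz' 1 l * Cw 0 + Cz' 0 (l+1) * Cw 1) * G = (Cz 0 (l+1) * Cw' 1 + Cz 1 l * Cw' 0) * G"
    unfolding ring_distribs a b unfolding ring_distribs(2)[symmetric] HC_comm_p1 ..
  then show "Cz' 1 l * Cw 0 + Cz' 0 (l+1) * Cw 1 = Cz 0 (l+1) * Cw' 1 + Cz 1 l * Cw' 0" using G by simp
  have "(Cz' (-1) l * Cw 0 + Cz' 0 (l-1) * Cw (-1)) * G = (Cz 0 (l-1) * Cw' (-1) + Cz (-1) l * Cw' 0) * G"
    unfolding ring_distribs a b unfolding ring_distribs(2)[symmetric] HC_comm_m1 ..
  then show "Cz' (-1) l * Cw 0 + Cz' 0 (l-1) * Cw (-1) = Cz 0 (l-1) * Cw' (-1) + Cz (-1) l * Cw' 0" using G by simp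
  have "(Cz' (-1) (l+1) * Cw 1 + Cz' 0 l * Cw 0 + Cz' 1 (l-1) * Cw (-1)) * G = (Cz (-1) (l+1) * Cw' 1 + Cz 0 l * Cw' 0 + Cz 1 (l-1) * Cw' (-1)) * G"
    unfolding ring_distribs a b unfolding ring_distribs(2)[symmetric] HC_comm_0 ..
  then show "Cz' (-1) (l+1) * Cw 1 + Cz' 0 l * Cw 0 + Cz' 1 (l-1) * Cw (-1) = Cz (-1) (l+1) * Cw' 1 + Cz 0 l * Cw' 0 + Cz 1 (l-1) * Cw' (-1)" using G by simp
qed

end

end

section \<open>Asymptotics of the matrix coefficients\<close>

text \<open>The bounded part of the bracket \<open>[z]\<close> after its growth q^(-z) is split off,
  as in \<open>qnum_uq\<close>.\<close>

definition uq :: "real \<Rightarrow> real \<Rightarrow> real" where "uq q z = 1 - q powr (2*z)"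

lemma uq_bounds: "0 < q \<Longrightarrow> q < 1 \<Longrightarrow> 0 \<le> z \<Longrightarrow> 0 \<le> uq q z \<and> uq q z \<le> 1"
  using powr_le1[of "2*z" q] by (simp add: uq_def)

lemma uq_mono: "0 < q \<Longrightarrow> q < 1 \<Longrightarrow> y \<le> z \<Longrightarrow> uq q y \<le> uq q z"
  using powr_mono'[of "2*y" "2*z" q] by (simp add: uq_def)

lemma qnum_uq: "0 < q \<Longrightarrow> qnum q z = q powr (-z) * uq q z / (1/q - q)"
proof -
  assume q: "0 < q"
  have "q powr (-z) * q powr (2*z) = q powr z" by (simp add: powr_add[symmetric])
  then have 1: "q powr (-z) * uq q z = - (q powr z - q powr (-z))" by (simp add: uq_def right_diff_distrib)
  have 2: "1/q - q = - (q - inverse q)" by (simp add: inverse_eq_divide)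
  show ?thesis by (simp only: qnum_def 1 2 minus_divide_divide)
qed

lemma sqrt_qnum:
  assumes q: "0 < q" "q < 1"
  shows "sqrt (qnum q a * qnum q b) = q powr (- (a+b)/2) / (1/q - q) * sqrt (uq q a * uq q b)"
proof -
  define h where "h = 1/q - q"
  have h: "h > 0" using kappa_neg[OF q] by (simp add: h_def)
  have "qnum q a * qnum q b = (q powr (- (a+b)/2) / h)^2 * (uq q a * uq q b)"
  proof -
    have "(q powr (- (a+b)/2))^2 = q powr (-a) * q powr (-b)"
      by (simp add: power2_eq_square powr_add[symmetric])
    then show ?thesis unfolding qnum_uq[OF q(1)] h_def[symmetric] power_divide by (simp add: power2_eq_square)
  qed
  then show ?thesis using h by (simp add: real_sqrt_mult h_def[symmetric])
qed

text \<open>On the unit interval \<open>a * b \<le> sqrt (a * b) \<le> 1\<close>, and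
  \<open>1 - a * b\<close> is at most the sum of the two gaps.\<close>

lemma sqrt_gap:
  assumes "0 \<le> a" "a \<le> 1" "0 \<le> b" "b \<le> (1::real)"
  shows "\<bar>sqrt (a * b) - 1\<bar> \<le> (1 - a) + (1 - b)"
proof -
  have ab: "0 \<le> a * b" "a * b \<le> 1" using assms by (auto simp: mult_le_one)
  have "(a*b)^2 \<le> a * b" using ab by (simp add: power2_eq_square mult_left_le)
  then have "a * b \<le> sqrt (a * b)" by (rule real_le_rsqrt)
  moreover have "sqrt (a*b) \<le> 1" using ab by simp
  moreover have "0 \<le> (1 - a) * (1 - b)" using assms by simp
  ultimately show ?thesis by (simp add: algebra_simps)
qed

lemma uq_gap: "0 < q \<Longrightarrow> q < 1 \<Longrightarrow> 0 \<le> y \<Longrightarrow> y \<le> 2 * z \<Longrightarrow> 1 - uq q z \<le> q powr y"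
  by (simp add: uq_def powr_mono')

text \<open>Counting exponents: -l from the prefactor and -l from the root in the numerator, against
  2l from \<open>[2l + 2]\<close> and 2l from the root in the denominator. The level
  \<open>|N| - 1\<close>, where the value is zero, is included because steps down evaluate at
  \<open>l - 1\<close>.\<close>

lemma r_plus_sym_bound:
  assumes q: "0 < q" "q < 1"
  obtains C where "C \<ge> 0" "\<And>l. l \<ge> \<bar>N\<bar> \<or> l = \<bar>N\<bar> - 1 \<Longrightarrow> \<bar>r_plus_sym q N l\<bar> \<le> C * q powr (2*l)"
proof
  \<comment> \<open>A lower bound for the three factors \<open>uq\<close> in the denominators, whose
    arguments are at least 1.\<close>
  define u where "u = uq q 1"
  define h where "h = 1/q - q"
  have h: "h > 0" using kappa_neg[OF q] by (simp add: h_def)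
  have u: "u > 0" using q by (simp add: u_def uq_def powr_numeral power_less_one_iff)
  define C where "C = h * q powr (3/2) / (u * u)"
  show "C \<ge> 0" using h u by (simp add: C_def)
  show "\<bar>r_plus_sym q N l\<bar> \<le> C * q powr (2*l)" if "l \<ge> \<bar>N\<bar> \<or> l = \<bar>N\<bar> - 1" for l
  proof (cases "l = \<bar>N\<bar> - 1")
    case True then show ?thesis using r_plus_sym_edge[of q N] \<open>C \<ge> 0\<close> by simp
  next
    case False
    with that have l: "l \<ge> \<bar>N\<bar>" by simp
    have uu: "uq q (2*l+2) \<ge> u" "uq q (2*l+1) \<ge> u" "uq q (2*l+3) \<ge> u"
      using l q unfolding u_def by (auto intro!: uq_mono)
    define r where "r = sqrt (uq q (l+N+1) * uq q (l-N+1))"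
    define s where "s = sqrt (uq q (2*l+1) * uq q (2*l+3))"
    have ub: "0 \<le> uq q (l+N+1)" "uq q (l+N+1) \<le> 1" "0 \<le> uq q (l-N+1)" "uq q (l-N+1) \<le> 1"
      using uq_bounds[OF q, of "l+N+1"] uq_bounds[OF q, of "l-N+1"] l by auto
    have r: "0 \<le> r" "r \<le> 1" using ub by (simp_all add: r_def mult_le_one)
    have "u * u \<le> uq q (2*l+1) * uq q (2*l+3)" using uu u by (intro mult_mono) auto
    then have s: "s \<ge> u" unfolding s_def using u real_le_rsqrt[of u] by (simp add: power2_eq_square)
    have ex: "q powr (- l - 3/2) * (q powr (- ((l + N + 1) + (l - N + 1)) / 2)) =
      q powr (2 * l) * q powr (3/2) * (q powr (- (2*l+2)) * (q powr (- ((2 * l + 1) + (2 * l + 3)) / 2)))"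
      unfolding powr_add[symmetric] by (rule arg_cong[where f="\<lambda>z. q powr z"]) (simp add: field_simps)
    have gen: "p / (b * v / h) * ((a / h * r) / (c / h * s)) = h * w / (v * s) * r" if "p * a = w * (b * c)" "b > 0" "c > 0" for p a w b c v
    proof -
      have "p / (b * v / h) * ((a / h * r) / (c / h * s)) = (p * a) / (b * c) * (h / (v * s) * r)"
        using h by (simp add: field_simps)
      also have "(p * a) / (b * c) = w" using that by simp
      finally show ?thesis by (simp add: mult_ac)
    qed
    have kpe: "r_plus_sym q N l = h * (q powr (2 * l) * q powr (3/2)) / (uq q (2*l+2) * s) * r"
      unfolding r_plus_sym_def sqrt_qnum[OF q] h_def[symmetric] r_def[symmetric] s_def[symmetric]
      unfolding qnum_uq[OF q(1)] h_def[symmetric]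
      by (rule gen[OF ex]) (use q in simp_all)
    have "\<bar>r_plus_sym q N l\<bar> = h * (q powr (2 * l) * q powr (3/2)) / (uq q (2*l+2) * s) * r"
      unfolding kpe using h uu(1) u s r by (simp add: abs_mult)
    also have "\<dots> \<le> h * (q powr (2 * l) * q powr (3/2)) / (uq q (2*l+2) * s) * 1"
      using h uu(1) u s r by (intro mult_left_mono) auto
    also have "\<dots> \<le> h * (q powr (2 * l) * q powr (3/2)) / (u * u)"
      using h uu(1) u s by (auto intro!: divide_left_mono mult_mono)
    finally show ?thesis by (simp add: C_def mult_ac)
  qed
qed

text \<open>The limits of the diagonal coefficients for \<open>l \<rightarrow> \<infinity>\<close> at fixed \<open>x = l + m\<close>.\<close>

definition gamma :: "real \<Rightarrow> podles_expr \<Rightarrow> real \<Rightarrow> real" where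
  "gamma q g x = (if g = Gen_B then - (q powr x * sqrt (uq q (x+1)))
     else if g = Gen_Bstar then - (q powr (x-1) * sqrt (uq q x)) else (q powr x)^2)"

lemma gamma_bound:
  assumes q: "0 < q" "q < 1" and x: "x \<ge> 0"
  shows "\<bar>gamma q g x\<bar> \<le> (1/q) * q powr x"
proof -
  have p: "0 < q powr x" "q powr x \<le> 1" using q x powr_le1[of x q] by auto
  have q1: "1/q \<ge> 1" using q by simp
  have s: "0 \<le> sqrt (uq q x)" "sqrt (uq q x) \<le> 1" "0 \<le> sqrt (uq q (x+1))" "sqrt (uq q (x+1)) \<le> 1"
    using uq_bounds[OF q, of x] uq_bounds[OF q, of "x+1"] x by auto
  have a: "q powr x * sqrt (uq q (x+1)) \<le> (1/q) * q powr x"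
    using mult_mono[of "q powr x" "(1/q) * q powr x" "sqrt (uq q (x+1))" 1] p s q1 q by (simp add: field_simps)
  have b: "q powr (x-1) * sqrt (uq q x) \<le> (1/q) * q powr x"
    using mult_left_mono[OF s(2), of "q powr (x-1)"] q by (simp add: powr_diff)
  have c: "(q powr x)^2 \<le> (1/q) * q powr x"
    using mult_mono[of "q powr x" "1/q" "q powr x" "q powr x"] p q1 q unfolding power2_eq_square by simp
  show ?thesis using a b c s p by (simp add: gamma_def abs_mult)
qed

text \<open>In the closed form \<open>N\<close> enters through a term of relative order q^(2l) only,
  so the leading part is the same for all summands. Levels below 1/2 are excluded because
  \<open>[2l]\<close> vanishes at 0.\<close>

lemma r_zero_asymp:
  assumes q: "0 < q" "q < 1"
  obtains C \<rho> where "C \<ge> 0" "\<And>l. l \<ge> 1/2 \<Longrightarrow> r_zero q N l = (q - 1/q) * q powr (1/2) * q powr (2*l) * \<rho> l"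
    "\<And>l. l \<ge> 1/2 \<Longrightarrow> \<bar>\<rho> l - 1\<bar> \<le> C * q powr (2*l)"
proof -
  define c where "c = (q^2 + 1) / (q powr N)^2"
  define \<rho> where "\<rho> l = (1 + q^2 * (q powr (2*l))^2 - c * q powr (2*l)) / ((1 - (q powr (2*l))^2) * (1 - q^4 * (q powr (2*l))^2))" for l
  define K where "K = (1 - q^2) * (1 - q^2)"
  have c: "c > 0" using q by (simp add: c_def add_pos_pos)
  have K: "K > 0" using q by (simp add: K_def power_less_one_iff)
  define C where "C = (c + 5) / K"
  have W: "0 < q powr (2*l)" "q powr (2*l) \<le> q" if "l \<ge> 1/2" for l
    using q that powr_mono'[of 1 "2*l" q] by auto
  have D: "K \<le> (1 - (q powr (2*l))^2) * (1 - q^4 * (q powr (2*l))^2)" if l: "l \<ge> 1/2" for l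
  proof -
    have "(q powr (2*l))^2 \<le> q^2" using W[OF l] by (intro power_mono) auto
    moreover have "q^4 * (q powr (2*l))^2 \<le> 1 * (q powr (2*l))^2" using q by (intro mult_right_mono) (auto simp: power_le_one)
    ultimately have "q^4 * (q powr (2*l))^2 \<le> q^2" "(q powr (2*l))^2 \<le> q^2" by linarith+
    then show ?thesis unfolding K_def using q by (intro mult_mono) (auto simp: power_le_one)
  qed
  show thesis
  proof
    show "C \<ge> 0" using c K by (simp add: C_def)
    show "r_zero q N l = (q - 1/q) * q powr (1/2) * q powr (2*l) * \<rho> l" if l: "l \<ge> 1/2" for l
    proof -
      define w where "w = q powr (2*l)"
      have w: "w > 0" "w \<noteq> 0" "1 - w^2 \<noteq> 0" "1 - q^4 * w^2 \<noteq> 0"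
        using W(1)[OF l] D[OF l] K by (auto simp: w_def[symmetric])
      define z where "z = (q powr N)^2"
      have z: "z > 0" "c = (q^2+1) / z" using q by (simp_all add: z_def c_def)
      have e: "w - 1/w = - (1 - w^2) / w" "q^2*w - 1/(q^2*w) = - (1 - q^4 * w^2) / (q^2 * w)"
        using w q by (simp_all add: field_simps eval_nat_numeral)
      have n: "q * w + 1/(q*w) - (q + 1/q) / z = (1 + q^2 * w^2 - c * w) / (q * w)"
        unfolding z(2) using w q z(1) by (simp add: field_simps power2_eq_square)
      have h: "q powr (-1/2) = q powr (1/2) / q"
        using q by (simp add: powr_divide powr_minus field_simps) (simp add: powr_add[symmetric])
      define X A B where "X = 1 + q^2 * w^2 - c * w" and "A = 1 - w^2" and "B = 1 - q^4 * w^2"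
      have AB: "A \<noteq> 0" "B \<noteq> 0" using w by (auto simp: A_def B_def)
      have "r_zero q N l = q powr (-1/2) * (q - 1/q) * (X / (q*w)) / ((- A / w) * (- B / (q^2 * w)))"
        using r_zero_bracket(1)[OF q, of l N] l unfolding w_def[symmetric] z_def[symmetric] e n X_def A_def B_def by simp
      also have "\<dots> = (q - 1/q) * q powr (1/2) * w * (X / (A * B))"
      proof -
        have "s / q * t * (X / (q*w)) / ((- A / w) * (- B / (q^2 * w))) = t * s * w * (X / (A * B))" for s t
          using w q AB by (simp add: field_simps power2_eq_square)
        then show ?thesis unfolding h .
      qed
      finally show ?thesis by (simp add: \<rho>_def w_def X_def A_def B_def)
    qed
    show "\<bar>\<rho> l - 1\<bar> \<le> C * q powr (2*l)" if l: "l \<ge> 1/2" for l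
    proof -
      define w where "w = q powr (2*l)"
      define A where "A = (1 - w^2) * (1 - q^4 * w^2)"
      have A: "A \<ge> K" "A > 0" using D[OF l] K by (auto simp: w_def A_def)
      have w: "0 < w" "w \<le> 1" using W[OF l] q by (auto simp: w_def)
      have q4: "q^2 \<le> 1" "q^4 \<le> 1" "0 \<le> q^2" "0 \<le> q^4" using q by (auto simp: power_le_one)
      have "\<rho> l - 1 = (1 + q^2 * w^2 - c * w - A) / A"
        using A by (simp add: \<rho>_def w_def[symmetric] A_def[symmetric] diff_divide_distrib)
      \<comment> \<open>The constant terms cancel, so a factor \<open>w\<close> comes out.\<close>
      also have "1 + q^2 * w^2 - c * w - A = w * (q^2 * w + w + q^4 * w - q^4 * w^3 - c)"
        by (simp add: A_def algebra_simps eval_nat_numeral)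
      finally have "\<bar>\<rho> l - 1\<bar> = w * \<bar>q^2 * w + w + q^4 * w - q^4 * w^3 - c\<bar> / A"
        using A w by (simp add: abs_mult)
      also have "\<dots> \<le> w * (c + 5) / K"
      proof (intro frac_le mult_left_mono)
        have "q^2 * w \<le> 1" "q^4 * w \<le> 1" "q^4 * w^3 \<le> 1" "0 \<le> q^2 * w" "0 \<le> q^4 * w" "0 \<le> q^4 * w^3"
          using w q4 by (auto intro!: mult_le_one power_le_one)
        then show "\<bar>q^2 * w + w + q^4 * w - q^4 * w^3 - c\<bar> \<le> c + 5" using c w by linarith
      qed (use A K w c in auto)
      finally show ?thesis by (simp add: C_def w_def mult_ac)
    qed
  qed
qed

text \<open>Put x = l + m and y = l - m. The coefficients of \<open>B\<close> and
  \<open>Bstar\<close> are \<open>gamma\<close> times a root within q^y of 1 times a factor 1 +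
  O(q^(2l)). The error q^y is weighted by the q^x in \<open>gamma\<close>, and q^x q^y = q^(2l). For
  \<open>A\<close>, the growth q^(-2l) of the bracket term meets the decay of \<open>r_zero\<close>,
  and the constant q^(1/2) cancels the -1 that this produces.\<close>

lemma coef_diag_estimate:
  assumes q: "0 < q" "q < 1" and N: "2 * N \<in> \<int>" and g: "g \<in> gens"
  obtains C where "C \<ge> 0"
    "\<And>l m. (l, m) \<in> V_basis N \<Longrightarrow> \<bar>coef q N g 0 l m - gamma q g (l+m)\<bar> \<le> C * q powr (2*l)"
proof -
  obtain C \<rho> where C: "C \<ge> 0" and r: "\<And>l. l \<ge> 1/2 \<Longrightarrow> r_zero q N l = (q - 1/q) * q powr (1/2) * q powr (2*l) * \<rho> l"
    and rho: "\<And>l. l \<ge> 1/2 \<Longrightarrow> \<bar>\<rho> l - 1\<bar> \<le> C * q powr (2*l)"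
    using r_zero_asymp[OF q, of N] by blast
  define h where "h = 1/q - q"
  have h: "h > 0" "q - 1/q = - h" using kappa_neg[OF q] by (auto simp: h_def)
  \<comment> \<open>The part \<open>4 / q\<close> covers the one label with \<open>l = 0\<close>,
    which the asymptotics do not reach.\<close>
  define K where "K = (4 + 3 * C) / q"
  have K1: "K \<ge> 4 / q" using C q by (simp add: K_def divide_right_mono)
  have q1: "1/q > 1" using q by simp
  show thesis
  proof
    show "K \<ge> 0" using C q by (simp add: K_def)
    fix l m assume lm: "(l, m) \<in> V_basis N"
    define x y where "x = l + m" and "y = l - m"
    note b = V_basis_bounds[OF lm]
    have xy: "x \<ge> 0" "y \<ge> 0" "x + y = 2 * l" using b by (auto simp: x_def y_def)
    show "\<bar>coef q N g 0 l m - gamma q g (l+m)\<bar> \<le> K * q powr (2*l)"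
    proof (cases "l \<ge> 1/2")
      case False
      with V_basis_half(1)[OF lm N] have z: "l = 0" "m = 0" by auto
      have "\<bar>coef q N g 0 0 0\<bar> \<le> 1"
      proof -
        have "q powr (-1/2) * q powr (1/2) = 1" using q by (simp add: powr_add[symmetric])
        moreover have "\<not> 1 + q powr 2 < 0" by (simp add: not_less add_nonneg_nonneg)
        ultimately show ?thesis using g by (auto simp: r_zero_def divide_le_eq)
      qed
      moreover have "\<bar>gamma q g 0\<bar> \<le> 1/q" using gamma_bound[OF q, of 0 g] q by simp
      ultimately have "\<bar>coef q N g 0 0 0 - gamma q g 0\<bar> \<le> 4/q" using q1 by linarith
      then show ?thesis using K1 q unfolding z by simp
    next
      case True
      define w where "w = q powr (2*l)"
      have w: "0 < w" "w \<le> 1" using q True powr_le1[of "2*l" q] by (auto simp: w_def)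
      have rh: "\<bar>\<rho> l - 1\<bar> \<le> C * w" using rho[OF True] by (simp add: w_def)
      have pxy: "q powr x * q powr y = w" using xy by (simp add: w_def powr_add[symmetric])
      have px: "0 < q powr x" "q powr x \<le> 1" using q xy powr_le1[of x q] by auto
      have gap: "\<bar>s * \<rho> l - 1\<bar> \<le> C * w + q powr y" if "0 \<le> s" "s \<le> 1" "1 - s \<le> q powr y" for s
      proof -
        have "s * \<rho> l - 1 = s * (\<rho> l - 1) - (1 - s)" by (simp add: algebra_simps)
        then have "\<bar>s * \<rho> l - 1\<bar> \<le> \<bar>s * (\<rho> l - 1)\<bar> + \<bar>1 - s\<bar>" using abs_triangle_ineq4 by simp
        also have "\<dots> = s * \<bar>\<rho> l - 1\<bar> + (1 - s)" using that by (simp add: abs_mult)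
        also have "\<dots> \<le> C * w + q powr y"
        proof (rule add_mono)
          have "s * \<bar>\<rho> l - 1\<bar> \<le> 1 * \<bar>\<rho> l - 1\<bar>" using that by (intro mult_right_mono) auto
          then show "s * \<bar>\<rho> l - 1\<bar> \<le> C * w" using rh by simp
        qed (rule that)
        finally show ?thesis .
      qed
      have fin: "p * a * \<bar>s * \<rho> l - 1\<bar> \<le> K * w"
        if "p = q powr x \<or> p = q powr x / q" "0 \<le> a" "a \<le> 1" "0 \<le> s" "s \<le> 1" "1 - s \<le> q powr y" for p a s
      proof -
        have "q powr x * q \<le> q powr x" using px q by (simp add: mult_left_le)
        then have "q powr x \<le> q powr x / q" using q by (simp add: field_simps)
        then have p: "0 \<le> p" "p \<le> q powr x / q" using that(1) px q by auto
        have "p * a * \<bar>s * \<rho> l - 1\<bar> \<le> (q powr x / q) * 1 * (C * w + q powr y)"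
          using p that gap[OF that(4-6)] px q by (intro mult_mono) auto
        also have "\<dots> = (C * (q powr x * w) + w) / q" by (simp add: pxy[symmetric] algebra_simps add_divide_distrib)
        also have "\<dots> \<le> (C * (1 * w) + w) / q"
          using C w px q by (intro divide_right_mono add_right_mono mult_left_mono mult_right_mono) auto
        also have "\<dots> \<le> K * w" using C w q unfolding K_def by (simp add: field_simps)
        finally show ?thesis .
      qed
      have su: "0 \<le> sqrt (uq q z)" "sqrt (uq q z) \<le> 1" if "z \<ge> 0" for z using uq_bounds[OF q that] by auto
      have sg: "1 - sqrt (uq q z) \<le> q powr y" if "z \<ge> y" for z
      proof -
        have zz: "z \<ge> 0" using that xy by simp
        have "uq q z \<le> sqrt (uq q z)" using sqrt_gap[of "uq q z" 1] uq_bounds[OF q zz] by simp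
        then show ?thesis using uq_gap[OF q xy(2), of z] that xy by simp
      qed
      have hl: "q powr (- (l + m + 1 + (l - m)) / 2) = q powr (-l) * q powr (-1/2)"
        "q powr (- (l + m + (l - m + 1)) / 2) = q powr (-l) * q powr (-1/2)"
        unfolding powr_add[symmetric] by (rule arg_cong[where f="\<lambda>z. q powr z"]; simp add: field_simps)+
      have hh: "q powr (-1/2) * q powr (1/2) = 1" using q by (simp add: powr_add[symmetric])
      have ex: "q powr m * q powr (-l) * q powr (2*l) = q powr x" "q powr (m-1) * q powr (-l) * q powr (2*l) = q powr x / q"
        unfolding x_def using q by (simp_all add: powr_add[symmetric] powr_diff field_simps)
      consider "g = Gen_B" | "g = Gen_Bstar" | "g = Gen_A" using g by auto
      then show ?thesis
      proof cases
        case 1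
        have "coef q N g 0 l m = - (q powr m * q powr (-l) * q powr (2*l)) * (q powr (-1/2) * q powr (1/2)) * (sqrt (uq q (x+1)) * sqrt (uq q y)) * \<rho> l"
        proof -
          have "coef q N g 0 l m = q powr m * sqrt (qnum q (l + m + 1) * qnum q (l - m)) * r_zero q N l" by (simp add: 1)
          then show ?thesis
            unfolding sqrt_qnum[OF q] hl r[OF True] h(2) h_def[symmetric] x_def y_def
            unfolding real_sqrt_mult using h(1) by simp
        qed
        then have "coef q N g 0 l m - gamma q g (l+m) = - (q powr x * sqrt (uq q (x+1)) * (sqrt (uq q y) * \<rho> l - 1))"
          unfolding ex hh by (simp add: gamma_def 1 x_def[symmetric] algebra_simps)
        then have "\<bar>coef q N g 0 l m - gamma q g (l+m)\<bar> = q powr x * sqrt (uq q (x+1)) * \<bar>sqrt (uq q y) * \<rho> l - 1\<bar>"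
          using su(1)[of "x+1"] xy by (simp add: abs_mult)
        also have "\<dots> \<le> K * w" using xy by (intro fin su sg) auto
        finally show ?thesis by (simp add: w_def)
      next
        case 2
        have "coef q N g 0 l m = - (q powr (m-1) * q powr (-l) * q powr (2*l)) * (q powr (-1/2) * q powr (1/2)) * (sqrt (uq q x) * sqrt (uq q (y+1))) * \<rho> l"
        proof -
          have "coef q N g 0 l m = q powr (m-1) * sqrt (qnum q (l + m) * qnum q (l - m + 1)) * r_zero q N l" by (simp add: 2)
          then show ?thesis
            unfolding sqrt_qnum[OF q] hl r[OF True] h(2) h_def[symmetric] x_def y_def
            unfolding real_sqrt_mult using h(1) by simp
        qed
        then have "coef q N g 0 l m - gamma q g (l+m) = - (q powr x / q * sqrt (uq q x) * (sqrt (uq q (y+1)) * \<rho> l - 1))"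
          unfolding ex hh using q by (simp add: gamma_def 2 x_def[symmetric] algebra_simps powr_diff)
        then have "\<bar>coef q N g 0 l m - gamma q g (l+m)\<bar> = q powr x / q * sqrt (uq q x) * \<bar>sqrt (uq q (y+1)) * \<rho> l - 1\<bar>"
          using su(1)[of x] xy q by (simp add: abs_mult)
        also have "\<dots> \<le> K * w" using xy by (intro fin su sg) auto
        finally show ?thesis by (simp add: w_def)
      next
        case 3
        define d where "d = 1 + q^2"
        have d: "d \<ge> 1" "d \<le> 2" using q by (auto simp: d_def power_le_one)
        have LCA: "LC q Gen_A 0 l m * w = d * (q powr x)^2 - 1 - q^2 * w^2"
        proof -
          have "q powr (-l) * q powr (-l) * w = 1" "q powr l * q powr l = w" "(q powr m)^2 * w = (q powr x)^2"
            using q by (simp_all add: w_def x_def power2_eq_square powr_add[symmetric] add.commute)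
          then have "(q powr (-l))^2 * w = 1" "(q powr l)^2 * w = w^2" by (simp_all add: power2_eq_square)
          moreover have "LC q Gen_A 0 l m * w = d * ((q powr m)^2 * w) - (q powr (-l))^2 * w - q^2 * ((q powr l)^2 * w)"
            by (simp add: LC_def d_def algebra_simps)
          ultimately show ?thesis using \<open>(q powr m)^2 * w = (q powr x)^2\<close> by simp
        qed
        define Q where "Q = qnum q (l - m + 1) * qnum q (l + m) - q powr 2 * qnum q (l - m) * qnum q (l + m + 1)"
        have LQ: "LC q Gen_A 0 l m = (q - 1/q) * Q" unfolding Q_def by (rule LC_qnum(8)[OF q])
        have "coef q N g 0 l m = q powr (-1/2) / d * (Q * r_zero q N l + q powr (1/2))"
          using q by (simp add: 3 Q_def d_def powr_numeral)
        also have "\<dots> = (q powr (-1/2) * q powr (1/2)) / d * (LC q Gen_A 0 l m * w * \<rho> l + 1)"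
          unfolding r[OF True] LQ w_def by (simp add: algebra_simps add_divide_distrib)
        also have "\<dots> = ((d * (q powr x)^2 - 1 - q^2 * w^2) * \<rho> l + 1) / d" unfolding hh LCA by simp
        finally have c: "coef q N g 0 l m - gamma q g (l+m) = ((d * (q powr x)^2 - 1) * (\<rho> l - 1) - q^2 * w^2 * \<rho> l) / d"
          using d by (simp add: gamma_def 3 x_def[symmetric] field_simps)
        have px2: "0 \<le> (q powr x)^2" "(q powr x)^2 \<le> 1" using px by (auto simp: power_le_one)
        have "d * (q powr x)^2 \<le> 2 * 1" using d px2 by (intro mult_mono) auto
        moreover have "0 \<le> d * (q powr x)^2" using d px2 by auto
        ultimately have t1: "\<bar>(d * (q powr x)^2 - 1) * (\<rho> l - 1)\<bar> \<le> 1 * (C * w)"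
          unfolding abs_mult using rh C w by (intro mult_mono) auto
        have "\<bar>\<rho> l\<bar> \<le> 1 + C * w" using rh by linarith
        also have "\<dots> \<le> 1 + C" using C w by (simp add: mult_left_le)
        finally have rr: "\<bar>\<rho> l\<bar> \<le> 1 + C" .
        have "q^2 * w^2 \<le> 1 * (1 * w)" unfolding power2_eq_square[of w] using q w by (intro mult_mono) (auto simp: power_le_one)
        then have t2: "\<bar>q^2 * w^2 * \<rho> l\<bar> \<le> w * (1 + C)"
          unfolding abs_mult using rr w q by (intro mult_mono) auto
        have "\<bar>(d * (q powr x)^2 - 1) * (\<rho> l - 1) - q^2 * w^2 * \<rho> l\<bar> \<le> (1 + 2 * C) * w"
          using t1 t2 by (simp add: algebra_simps)
        moreover have "\<bar>coef q N g 0 l m - gamma q g (l+m)\<bar> = \<bar>(d * (q powr x)^2 - 1) * (\<rho> l - 1) - q^2 * w^2 * \<rho> l\<bar> / d"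
          unfolding c using d by simp
        moreover have "X / d \<le> X" if "X \<ge> 0" for X using mult_left_mono[OF d(1) that] d by (simp add: divide_le_eq)
        ultimately have "\<bar>coef q N g 0 l m - gamma q g (l+m)\<bar> \<le> (1 + 2 * C) * w" by (smt (verit) abs_ge_zero)
        also have "\<dots> \<le> K * w"
        proof (rule mult_right_mono)
          have "1 + 2 * C \<le> (4 + 3 * C) * 1" using C by simp
          also have "\<dots> \<le> (4 + 3 * C) * (1/q)" using q1 C by (intro mult_left_mono) auto
          finally show "1 + 2 * C \<le> K" by (simp add: K_def)
        qed (use w in auto)
        finally show ?thesis by (simp add: w_def)
      qed
    qed
  qed
qed

text \<open>For \<open>Gen_B\<close> going up and \<open>Gen_Bstar\<close> going down, the roots
  involve \<open>l + m\<close> alone and their growth cancels the factor q^m. What remains is a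
  function of \<open>l\<close>, up to the relative error q^(l+m) of the roots. In the four other
  cases an extra power q^(l+m) is left over, so \<open>\<Lambda>\<close> can be zero.\<close>

lemma coef_shift_estimate:
  assumes q: "0 < q" "q < 1" and N: "2 * N \<in> \<int>" and g: "g \<in> gens" and s: "\<sigma> \<in> {-1, 1}"
  obtains C \<Lambda> where "C \<ge> 0" "\<sigma> \<noteq> mshift g \<Longrightarrow> \<Lambda> = (\<lambda>_. 0)"
    "\<And>l m. (l, m) \<in> V_basis N \<Longrightarrow> \<bar>\<Lambda> l\<bar> \<le> C * q powr l"
    "\<And>l m. (l, m) \<in> V_basis N \<Longrightarrow> \<bar>coef q N g \<sigma> l m - \<Lambda> l\<bar> \<le> C * (q powr l * q powr (l + m))"
proof -
  note witness = that
  obtain K where K: "K \<ge> 0" "\<And>l. l \<ge> \<bar>N\<bar> \<or> l = \<bar>N\<bar> - 1 \<Longrightarrow> \<bar>r_plus_sym q N l\<bar> \<le> K * q powr (2*l)"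
    using r_plus_sym_bound[OF q, of N] by blast
  define h where "h = 1/q - q"
  have h: "h > 0" using kappa_neg[OF q] by (auto simp: h_def)
  define D where "D = q powr (-N) * K / h"
  have D: "D \<ge> 0" using K h by (simp add: D_def)
  \<comment> \<open>Deliberately generous: \<open>1 / q^4\<close> absorbs the constant offsets of
    all exponents below, and the other factors cover the relative error of the roots.\<close>
  define C where "C = D * (1 + 1/q^4) * 2 / q^4"
  have q4: "q^4 > 0" "q^4 \<le> 1" using q by (auto simp: power_le_one)
  have C0: "C \<ge> 0" using D q by (simp add: C_def)
  have kb: "\<bar>q powr (-N) * r_plus_sym q N l / h\<bar> \<le> D * q powr (2*l)"
      "\<bar>q powr (-N) * r_plus_sym q N (l-1) / h\<bar> \<le> D * q powr (2*(l-1))" if "(l, m) \<in> V_basis N" for l m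
  proof -
    have a: "l \<ge> \<bar>N\<bar> \<or> l = \<bar>N\<bar> - 1" "l - 1 \<ge> \<bar>N\<bar> \<or> l - 1 = \<bar>N\<bar> - 1"
      using V_basis_bounds[OF that] V_basis_half(3)[OF that N] by auto
    have e: "\<bar>q powr (-N) * k / h\<bar> = q powr (-N) / h * \<bar>k\<bar>" for k using h by (simp add: abs_mult)
    have f: "D * w = q powr (-N) / h * (K * w)" for w by (simp add: D_def)
    show "\<bar>q powr (-N) * r_plus_sym q N l / h\<bar> \<le> D * q powr (2*l)"
      "\<bar>q powr (-N) * r_plus_sym q N (l-1) / h\<bar> \<le> D * q powr (2*(l-1))"
      unfolding e f using h by (intro mult_left_mono K(2) a; simp)+
  qed
  have le: "D * q powr a * s \<le> C * (q powr l * q powr (l + m))"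
    if "(l, m) \<in> V_basis N" "a \<ge> 2 * l + m - 4" "0 \<le> s" "s \<le> 1" for a s l m
  proof -
    have "D * q powr a * s \<le> D * q powr (2 * l + m - 4) * 1"
      using that D q by (intro mult_mono powr_mono') auto
    also have "\<dots> = D * 1 * 1 / q^4 * (q powr l * q powr (l + m))"
      using q by (simp add: powr_diff powr_numeral powr_add[symmetric])
    also have "\<dots> \<le> C * (q powr l * q powr (l + m))"
      unfolding C_def using D q q4 by (intro mult_right_mono divide_right_mono mult_mono) auto
    finally show ?thesis .
  qed
  have su: "0 \<le> sqrt (uq q a * uq q b)" "sqrt (uq q a * uq q b) \<le> 1" if "a \<ge> 0" "b \<ge> 0" for a b
    using uq_bounds[OF q that(1)] uq_bounds[OF q that(2)] by (auto simp: mult_le_one)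
  have gb: "\<bar>c\<bar> \<le> a * d * s" if "c = - a * x * s" "\<bar>x\<bar> \<le> d" "0 \<le> a" "0 \<le> s" for a c d s x :: real
  proof -
    have "\<bar>c\<bar> = a * \<bar>x\<bar> * s" using that by (simp add: abs_mult)
    also have "\<dots> \<le> a * d * s" using that by (intro mult_right_mono mult_left_mono) auto
    finally show ?thesis .
  qed
  have small: thesis if \<sigma>: "\<sigma> \<noteq> mshift g" and sm: "\<And>l m. (l, m) \<in> V_basis N \<Longrightarrow>
      \<bar>coef q N g \<sigma> l m\<bar> \<le> C * (q powr l * q powr (l + m))"
  proof (rule witness[of C "\<lambda>_. 0"])
    show "C \<ge> 0" by (rule C0)
    show "\<bar>0\<bar> \<le> C * q powr l" for l using C0 by simp
  qed (use \<sigma> sm in auto)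
  have large: thesis if \<sigma>: "\<sigma> = mshift g" and ex: "\<And>l m. (l, m) \<in> V_basis N \<Longrightarrow>
      \<exists>s. coef q N g \<sigma> l m = \<Lambda> l * s \<and> \<bar>s - 1\<bar> \<le> 2 / q^4 * q powr (l + m)"
    and lam: "\<And>l m. (l, m) \<in> V_basis N \<Longrightarrow> \<bar>\<Lambda> l\<bar> \<le> D / q^4 * q powr l" for \<Lambda>
  proof (rule witness[of C \<Lambda>])
    show "C \<ge> 0" by (rule C0)
    show "\<sigma> \<noteq> mshift g \<Longrightarrow> \<Lambda> = (\<lambda>_. 0)" using \<sigma> by simp
    fix l m assume lm: "(l, m) \<in> V_basis N"
    have "D / q^4 \<le> C" unfolding C_def using D q q4 by (intro divide_right_mono) (auto simp: field_simps)
    then show "\<bar>\<Lambda> l\<bar> \<le> C * q powr l" using lam[OF lm] by (smt (verit) mult_right_mono powr_ge_zero)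
    obtain s where s: "coef q N g \<sigma> l m = \<Lambda> l * s" "\<bar>s - 1\<bar> \<le> 2 / q^4 * q powr (l + m)" using ex[OF lm] by blast
    have "\<bar>coef q N g \<sigma> l m - \<Lambda> l\<bar> = \<bar>\<Lambda> l\<bar> * \<bar>s - 1\<bar>" unfolding s abs_mult[symmetric] by (simp add: algebra_simps)
    also have "\<dots> \<le> (D / q^4 * q powr l) * (2 / q^4 * q powr (l + m))"
      using lam[OF lm] s D q by (intro mult_mono) auto
    also have "\<dots> = (D * (1/q^4) * 2 / q^4) * (q powr l * q powr (l + m))" by simp
    also have "\<dots> \<le> C * (q powr l * q powr (l + m))"
      unfolding C_def using D q q4 by (intro mult_right_mono divide_right_mono mult_mono) auto
    finally show "\<bar>coef q N g \<sigma> l m - \<Lambda> l\<bar> \<le> C * (q powr l * q powr (l + m))" .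
  qed
  have pw: "q powr a * q powr b = q powr (a + b)" for a b by (simp add: powr_add)
  consider "g = Gen_B" "\<sigma> = 1" | "g = Gen_B" "\<sigma> = -1" | "g = Gen_Bstar" "\<sigma> = 1" | "g = Gen_Bstar" "\<sigma> = -1"
    | "g = Gen_A" "\<sigma> = 1" | "g = Gen_A" "\<sigma> = -1" using g s by auto
  then show thesis
  proof cases
    case 1
    define \<Lambda> where "\<Lambda> l = q powr (-l - 3/2) * (q powr (-N) * r_plus_sym q N l / h)" for l
    show ?thesis
    proof (rule large[of \<Lambda>])
      fix l m assume lm: "(l, m) \<in> V_basis N"
      note b = V_basis_bounds[OF lm]
      have "coef q N g \<sigma> l m = (q powr m * q powr (- (l + m + 1 + (l + m + 2)) / 2)) * (q powr (-N) * r_plus_sym q N l / h) * sqrt (uq q (l+m+1) * uq q (l+m+2))"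
        by (simp add: 1 sqrt_qnum[OF q] h_def[symmetric] r_plus_eq)
      also have "q powr m * q powr (- (l + m + 1 + (l + m + 2)) / 2) = q powr (-l - 3/2)"
        unfolding pw by (rule arg_cong[where f="\<lambda>z. q powr z"]) (simp add: field_simps)
      finally have c: "coef q N g \<sigma> l m = \<Lambda> l * sqrt (uq q (l+m+1) * uq q (l+m+2))" by (simp add: \<Lambda>_def)
      have "\<bar>sqrt (uq q (l+m+1) * uq q (l+m+2)) - 1\<bar> \<le> q powr (l+m) + q powr (l+m)"
        using sqrt_gap[of "uq q (l+m+1)" "uq q (l+m+2)"] uq_bounds[OF q, of "l+m+1"] uq_bounds[OF q, of "l+m+2"]
          uq_gap[OF q, of "l+m" "l+m+1"] uq_gap[OF q, of "l+m" "l+m+2"] b by simp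
      also have "\<dots> = 2 * 1 * q powr (l+m)" by simp
      also have "\<dots> \<le> 2 * (1 / q^4) * q powr (l+m)" using q q4 by (intro mult_right_mono mult_left_mono) auto
      finally show "\<exists>s. coef q N g \<sigma> l m = \<Lambda> l * s \<and> \<bar>s - 1\<bar> \<le> 2 / q^4 * q powr (l + m)" using c by auto
      have "\<bar>\<Lambda> l\<bar> \<le> q powr (-l - 3/2) * (D * q powr (2*l))"
        using mult_left_mono[OF kb(1)[OF lm], of "q powr (-l - 3/2)"] unfolding \<Lambda>_def by (simp add: abs_mult)
      also have "\<dots> = D * q powr (l - 3/2)" by (simp add: pw)
      also have "\<dots> \<le> D * q powr (l - 4)" using D q by (intro mult_left_mono powr_mono') auto
      also have "\<dots> = D / q^4 * q powr l" using q by (simp add: powr_diff powr_numeral)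
      finally show "\<bar>\<Lambda> l\<bar> \<le> D / q^4 * q powr l" .
    qed (simp add: 1)
  next
    case 4
    define \<Lambda> where "\<Lambda> l = q powr (-l - 1/2) * (q powr (-N) * r_plus_sym q N (l-1) / h)" for l
    show ?thesis
    proof (rule large[of \<Lambda>])
      fix l m assume lm: "(l, m) \<in> V_basis N"
      note b = V_basis_bounds[OF lm]
      have "coef q N g \<sigma> l m = (q powr (m-1) * q powr (- (l + m + (l + m - 1)) / 2)) * (q powr (-N) * r_plus_sym q N (l-1) / h) * sqrt (uq q (l+m) * uq q (l+m-1))"
        by (simp add: 4 sqrt_qnum[OF q] h_def[symmetric] r_plus_eq)
      also have "q powr (m-1) * q powr (- (l + m + (l + m - 1)) / 2) = q powr (-l - 1/2)"
        unfolding pw by (rule arg_cong[where f="\<lambda>z. q powr z"]) (simp add: field_simps)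
      finally have c: "coef q N g \<sigma> l m = \<Lambda> l * sqrt (uq q (l+m) * uq q (l+m-1))" by (simp add: \<Lambda>_def)
      have "\<bar>sqrt (uq q (l+m) * uq q (l+m-1)) - 1\<bar> \<le> 2 * (1 / q^4) * q powr (l+m)"
      \<comment> \<open>At \<open>l + m = 0\<close> the argument \<open>l + m - 1\<close> is
        negative and the bounds for \<open>uq\<close> fail. There the factor \<open>uq q 0\<close>
        makes the root zero, and the error 1 is still within the bound.\<close>
      proof (cases "l + m = 0")
        case True
        then show ?thesis using q q4 by (simp add: uq_def field_simps)
      next
        case False
        have "l + m \<ge> 1" using V_basisD[OF lm] False by (auto elim!: Nats_cases)
        then have "\<bar>sqrt (uq q (l+m) * uq q (l+m-1)) - 1\<bar> \<le> q powr (l+m-1) + q powr (l+m-1)"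
          using sqrt_gap[of "uq q (l+m)" "uq q (l+m-1)"] uq_bounds[OF q, of "l+m"] uq_bounds[OF q, of "l+m-1"]
            uq_gap[OF q, of "l+m-1" "l+m"] uq_gap[OF q, of "l+m-1" "l+m-1"] b by simp
        also have "\<dots> \<le> 2 * q powr (l+m-4)" using q powr_mono'[of "l+m-4" "l+m-1" q] by simp
        also have "\<dots> = 2 * (1 / q^4) * q powr (l+m)" using q by (simp add: powr_diff powr_numeral)
        finally show ?thesis .
      qed
      then show "\<exists>s. coef q N g \<sigma> l m = \<Lambda> l * s \<and> \<bar>s - 1\<bar> \<le> 2 / q^4 * q powr (l + m)" using c by auto
      have "\<bar>\<Lambda> l\<bar> \<le> q powr (-l - 1/2) * (D * q powr (2*(l-1)))"
        using mult_left_mono[OF kb(2)[OF lm], of "q powr (-l - 1/2)"] unfolding \<Lambda>_def by (simp add: abs_mult)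
      also have "\<dots> = D * q powr (l - 5/2)" by (simp add: pw algebra_simps)
      also have "\<dots> \<le> D * q powr (l - 4)" using D q by (intro mult_left_mono powr_mono') auto
      also have "\<dots> = D / q^4 * q powr l" using q by (simp add: powr_diff powr_numeral)
      finally show "\<bar>\<Lambda> l\<bar> \<le> D / q^4 * q powr l" .
    qed (simp add: 4)
  next
    case 2
    show ?thesis
    proof (rule small)
      fix l m assume lm: "(l, m) \<in> V_basis N"
      note b = V_basis_bounds[OF lm]
      show "\<bar>coef q N g \<sigma> l m\<bar> \<le> C * (q powr l * q powr (l + m))"
      proof (cases "l - m = 0")
        case True then show ?thesis using C0 by (simp add: 2)
      next
        case False
        then have "l - m \<ge> 1" using V_basisD[OF lm] by (auto elim!: Nats_cases)
        then have s: "0 \<le> sqrt (uq q (l-m) * uq q (l-m-1))" "sqrt (uq q (l-m) * uq q (l-m-1)) \<le> 1"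
          using su[of "l-m" "l-m-1"] by auto
        have "coef q N g \<sigma> l m = - (q powr m * q powr (- (l - m + (l - m - 1)) / 2) * q powr (2*l)) * (q powr (-N) * r_plus_sym q N (l-1) / h) * sqrt (uq q (l-m) * uq q (l-m-1))"
          by (simp add: 2 sqrt_qnum[OF q] h_def[symmetric] r_minus_eq)
        then have "\<bar>coef q N g \<sigma> l m\<bar> \<le> (q powr m * q powr (- (l - m + (l - m - 1)) / 2) * q powr (2*l)) * (D * q powr (2*(l-1))) * sqrt (uq q (l-m) * uq q (l-m-1))"
          by (rule gb[OF _ kb(2)[OF lm]]) (use s in auto)
        also have "\<dots> = D * (q powr m * q powr (- (l - m + (l - m - 1)) / 2) * q powr (2*l) * q powr (2*(l-1))) * sqrt (uq q (l-m) * uq q (l-m-1))"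
          by simp
        also have "\<dots> \<le> C * (q powr l * q powr (l + m))" unfolding pw
          by (rule le[OF lm _ s, unfolded pw]) (use b in \<open>simp add: field_simps\<close>)
        finally show ?thesis .
      qed
    qed (simp add: 2)
  next
    case 3
    show ?thesis
    proof (rule small)
      fix l m assume lm: "(l, m) \<in> V_basis N"
      note b = V_basis_bounds[OF lm]
      have s: "0 \<le> sqrt (uq q (l-m+2) * uq q (l-m+1))" "sqrt (uq q (l-m+2) * uq q (l-m+1)) \<le> 1" using b by (intro su; simp)+
      have "coef q N g \<sigma> l m = - (q powr (m-1) * q powr (- (l - m + 2 + (l - m + 1)) / 2) * q powr (2*(l+1))) * (q powr (-N) * r_plus_sym q N l / h) * sqrt (uq q (l-m+2) * uq q (l-m+1))"
        by (simp add: 3 sqrt_qnum[OF q] h_def[symmetric] r_minus_eq)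
      then have "\<bar>coef q N g \<sigma> l m\<bar> \<le> (q powr (m-1) * q powr (- (l - m + 2 + (l - m + 1)) / 2) * q powr (2*(l+1))) * (D * q powr (2*l)) * sqrt (uq q (l-m+2) * uq q (l-m+1))"
        by (rule gb[OF _ kb(1)[OF lm]]) (use s in auto)
      also have "\<dots> = D * (q powr (m-1) * q powr (- (l - m + 2 + (l - m + 1)) / 2) * q powr (2*(l+1)) * q powr (2*l)) * sqrt (uq q (l-m+2) * uq q (l-m+1))"
        by simp
      also have "\<dots> \<le> C * (q powr l * q powr (l + m))" unfolding pw
        by (rule le[OF lm _ s, unfolded pw]) (use b in \<open>simp add: field_simps\<close>)
      finally show "\<bar>coef q N g \<sigma> l m\<bar> \<le> C * (q powr l * q powr (l + m))" .
    qed (simp add: 3)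
  next
    case 5
    show ?thesis
    proof (rule small)
      fix l m assume lm: "(l, m) \<in> V_basis N"
      note b = V_basis_bounds[OF lm]
      have s: "0 \<le> sqrt (uq q (l-m+1) * uq q (l+m+1))" "sqrt (uq q (l-m+1) * uq q (l+m+1)) \<le> 1" using b by (intro su; simp)+
      have "coef q N g \<sigma> l m = - (q powr (m+l+1/2) * q powr (- (l - m + 1 + (l + m + 1)) / 2)) * (q powr (-N) * r_plus_sym q N l / h) * sqrt (uq q (l-m+1) * uq q (l+m+1))"
        by (simp add: 5 sqrt_qnum[OF q] h_def[symmetric] r_plus_eq)
      then have "\<bar>coef q N g \<sigma> l m\<bar> \<le> (q powr (m+l+1/2) * q powr (- (l - m + 1 + (l + m + 1)) / 2)) * (D * q powr (2*l)) * sqrt (uq q (l-m+1) * uq q (l+m+1))"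
        by (rule gb[OF _ kb(1)[OF lm]]) (use s in auto)
      also have "\<dots> = D * (q powr (m+l+1/2) * q powr (- (l - m + 1 + (l + m + 1)) / 2) * q powr (2*l)) * sqrt (uq q (l-m+1) * uq q (l+m+1))"
        by simp
      also have "\<dots> \<le> C * (q powr l * q powr (l + m))" unfolding pw
        by (rule le[OF lm _ s, unfolded pw]) (use b in \<open>simp add: field_simps\<close>)
      finally show "\<bar>coef q N g \<sigma> l m\<bar> \<le> C * (q powr l * q powr (l + m))" .
    qed (simp add: 5)
  next
    case 6
    show ?thesis
    proof (rule small)
      fix l m assume lm: "(l, m) \<in> V_basis N"
      note b = V_basis_bounds[OF lm]
      have s: "0 \<le> sqrt (uq q (l-m) * uq q (l+m))" "sqrt (uq q (l-m) * uq q (l+m)) \<le> 1" using b by (intro su; simp)+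
      have "coef q N g \<sigma> l m = - (q powr (m-l-1/2) * q powr (- (l - m + (l + m)) / 2) * q powr (2*l)) * (q powr (-N) * r_plus_sym q N (l-1) / h) * sqrt (uq q (l-m) * uq q (l+m))"
        by (simp add: 6 sqrt_qnum[OF q] h_def[symmetric] r_minus_eq)
      then have "\<bar>coef q N g \<sigma> l m\<bar> \<le> (q powr (m-l-1/2) * q powr (- (l - m + (l + m)) / 2) * q powr (2*l)) * (D * q powr (2*(l-1))) * sqrt (uq q (l-m) * uq q (l+m))"
        by (rule gb[OF _ kb(2)[OF lm]]) (use s in auto)
      also have "\<dots> = D * (q powr (m-l-1/2) * q powr (- (l - m + (l + m)) / 2) * q powr (2*l) * q powr (2*(l-1))) * sqrt (uq q (l-m) * uq q (l+m))"
        by simp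
      also have "\<dots> \<le> C * (q powr l * q powr (l + m))" unfolding pw
        by (rule le[OF lm _ s, unfolded pw]) (use b in \<open>simp add: field_simps\<close>)
      finally show "\<bar>coef q N g \<sigma> l m\<bar> \<le> C * (q powr l * q powr (l + m))" .
    qed (simp add: 6)
  qed
qed

section \<open>Bounded operators and operators of exponential decay\<close>

definition nsq :: "'x set \<Rightarrow> 'x cvec \<Rightarrow> real" where
  "nsq X f = (\<Sum>\<^sub>\<infinity>x\<in>X. (cmod (f x))\<^sup>2)"

lemma nsq_nonneg: "0 \<le> nsq X f"
  unfolding nsq_def by (rule infsum_nonneg) simp

lemma ell2_outside: "f \<in> ell2 X \<Longrightarrow> x \<notin> X \<Longrightarrow> f x = 0"
  by (simp add: ell2_def)

lemma ell2_dominated: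
  assumes "\<And>x. x \<notin> X \<Longrightarrow> f x = 0" and "h summable_on X" and "\<And>x. x \<in> X \<Longrightarrow> (cmod (f x))\<^sup>2 \<le> h x"
  shows "f \<in> ell2 X" "nsq X f \<le> infsum h X"
proof -
  have s: "(\<lambda>x. (cmod (f x))\<^sup>2) summable_on X"
    by (rule summable_on_comparison_test[OF assms(2)]) (use assms(3) in auto)
  then show "f \<in> ell2 X" using assms(1) by (simp add: ell2_def)
  show "nsq X f \<le> infsum h X" unfolding nsq_def using s assms by (intro infsum_mono) auto
qed

lemma bounded_opI:
  assumes "\<And>f. f \<in> ell2 X \<Longrightarrow> T f \<in> ell2 X \<and> nsq X (T f) \<le> C * nsq X f"
    and "linear_op_on (ell2 X) T"
  shows "bounded_op X T"
  unfolding bounded_op_def ell2_norm_def nsq_def[symmetric]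
proof (intro conjI ballI exI)
  fix f assume f: "f \<in> ell2 X"
  show "T f \<in> ell2 X" using assms(1)[OF f] by simp
  have "nsq X (T f) \<le> \<bar>C\<bar> * nsq X f"
    using assms(1)[OF f] mult_right_mono[of C "\<bar>C\<bar>" "nsq X f"] nsq_nonneg[of X f] by linarith
  then show "sqrt (nsq X (T f)) \<le> sqrt \<bar>C\<bar> * sqrt (nsq X f)"
    unfolding real_sqrt_mult[symmetric] by (rule real_sqrt_le_mono)
qed (rule assms(2))

lemma bounded_op_nsq:
  assumes "bounded_op X T"
  obtains C where "C \<ge> 0" "\<And>f. f \<in> ell2 X \<Longrightarrow> nsq X (T f) \<le> C * nsq X f"
proof -
  obtain C where C: "\<And>f. f \<in> ell2 X \<Longrightarrow> sqrt (nsq X (T f)) \<le> C * sqrt (nsq X f)"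
    using assms unfolding bounded_op_def ell2_norm_def nsq_def[symmetric] by blast
  show thesis
  proof
    fix f assume f: "f \<in> ell2 X"
    have "(sqrt (nsq X (T f)))\<^sup>2 \<le> (C * sqrt (nsq X f))\<^sup>2"
      using C[OF f] nsq_nonneg by (intro power_mono) auto
    then show "nsq X (T f) \<le> C\<^sup>2 * nsq X f" by (simp add: power_mult_distrib nsq_nonneg)
  qed simp
qed

lemma bounded_op_ell2: "bounded_op X T \<Longrightarrow> f \<in> ell2 X \<Longrightarrow> T f \<in> ell2 X"
  by (simp add: bounded_op_def)

lemma bounded_op_add_vec: "bounded_op X T \<Longrightarrow> f \<in> ell2 X \<Longrightarrow> g \<in> ell2 X \<Longrightarrow>
    T (\<lambda>x. f x + g x) = (\<lambda>x. T f x + T g x)"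
  by (simp add: bounded_op_def linear_op_on_def)

lemma bounded_op_scale_vec: "bounded_op X T \<Longrightarrow> f \<in> ell2 X \<Longrightarrow> T (\<lambda>x. c * f x) = (\<lambda>x. c * T f x)"
  by (simp add: bounded_op_def linear_op_on_def)

lemma cmod_add_sq: "(cmod (a + b))\<^sup>2 \<le> 2 * (cmod a)\<^sup>2 + 2 * (cmod b)\<^sup>2"
proof -
  have "(cmod (a + b))\<^sup>2 \<le> (cmod a + cmod b)\<^sup>2" by (intro power_mono norm_triangle_ineq) simp
  also have "\<dots> \<le> 2 * (cmod a)\<^sup>2 + 2 * (cmod b)\<^sup>2"
    using zero_le_power2[of "cmod a - cmod b"] by (simp add: power2_sum power2_diff)
  finally show ?thesis .
qed

lemma ell2_add:
  assumes "f \<in> ell2 X" "g \<in> ell2 X"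
  shows "(\<lambda>x. f x + g x) \<in> ell2 X" "nsq X (\<lambda>x. f x + g x) \<le> 2 * nsq X f + 2 * nsq X g"
proof -
  have s: "(\<lambda>x. (cmod (f x))\<^sup>2) summable_on X" "(\<lambda>x. (cmod (g x))\<^sup>2) summable_on X"
    using assms by (auto simp: ell2_def)
  have s2: "(\<lambda>x. 2 * (cmod (f x))\<^sup>2) summable_on X" "(\<lambda>x. 2 * (cmod (g x))\<^sup>2) summable_on X"
    using s by (auto intro: summable_on_cmult_right)
  have s3: "(\<lambda>x. 2 * (cmod (f x))\<^sup>2 + 2 * (cmod (g x))\<^sup>2) summable_on X" by (rule summable_on_add[OF s2])
  have i: "infsum (\<lambda>x. 2 * (cmod (f x))\<^sup>2 + 2 * (cmod (g x))\<^sup>2) X = 2 * nsq X f + 2 * nsq X g"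
    unfolding infsum_add[OF s2] nsq_def by (simp add: infsum_cmult_right')
  have z: "\<And>x. x \<notin> X \<Longrightarrow> f x + g x = 0" using assms by (simp add: ell2_def)
  show "(\<lambda>x. f x + g x) \<in> ell2 X" by (rule ell2_dominated(1)[OF z s3 cmod_add_sq])
  show "nsq X (\<lambda>x. f x + g x) \<le> 2 * nsq X f + 2 * nsq X g"
    unfolding i[symmetric] by (rule ell2_dominated(2)[OF z s3 cmod_add_sq])
qed

lemma ell2_scale:
  assumes "f \<in> ell2 X"
  shows "(\<lambda>x. c * f x) \<in> ell2 X" "nsq X (\<lambda>x. c * f x) = (cmod c)\<^sup>2 * nsq X f"
  using assms unfolding ell2_def nsq_def
  by (auto simp: norm_mult power_mult_distrib infsum_cmult_right' intro: summable_on_cmult_right)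

lemma ell2_zero: "(\<lambda>x. 0) \<in> ell2 X"
  by (simp add: ell2_def)

lemma linear_subspace_ell2: "linear_subspace (ell2 X)"
  using ell2_add(1) ell2_scale(1) ell2_zero unfolding linear_subspace_def by blast

lemma bounded_op_zero: "bounded_op X (\<lambda>f x. 0)"
  by (rule bounded_opI[where C = 0]) (simp_all add: ell2_zero linear_op_on_def nsq_def)

lemma bounded_op_add:
  assumes "bounded_op X S" "bounded_op X T"
  shows "bounded_op X (\<lambda>f x. S f x + T f x)"
proof -
  obtain C where C: "\<And>f. f \<in> ell2 X \<Longrightarrow> nsq X (S f) \<le> C * nsq X f" using assms(1) by (rule bounded_op_nsq) blast
  obtain D where D: "\<And>f. f \<in> ell2 X \<Longrightarrow> nsq X (T f) \<le> D * nsq X f" using assms(2) by (rule bounded_op_nsq) blast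
  show ?thesis
  proof (rule bounded_opI[where C = "2 * C + 2 * D"])
    fix f assume f: "f \<in> ell2 X"
    note m = ell2_add[OF bounded_op_ell2[OF assms(1) f] bounded_op_ell2[OF assms(2) f]]
    show "(\<lambda>x. S f x + T f x) \<in> ell2 X \<and> nsq X (\<lambda>x. S f x + T f x) \<le> (2 * C + 2 * D) * nsq X f"
      using m C[OF f] D[OF f] by (simp add: algebra_simps)
  next
    show "linear_op_on (ell2 X) (\<lambda>f x. S f x + T f x)"
      unfolding linear_op_on_def
      by (auto simp: bounded_op_add_vec[OF assms(1)] bounded_op_add_vec[OF assms(2)]
        bounded_op_scale_vec[OF assms(1)] bounded_op_scale_vec[OF assms(2)] algebra_simps)
  qed
qed

lemma bounded_op_comp:
  assumes "bounded_op X S" "bounded_op X T"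
  shows "bounded_op X (\<lambda>f. S (T f))"
proof -
  obtain C where C: "C \<ge> 0" "\<And>f. f \<in> ell2 X \<Longrightarrow> nsq X (S f) \<le> C * nsq X f" using assms(1) by (rule bounded_op_nsq) blast
  obtain D where D: "\<And>f. f \<in> ell2 X \<Longrightarrow> nsq X (T f) \<le> D * nsq X f" using assms(2) by (rule bounded_op_nsq) blast
  show ?thesis
  proof (rule bounded_opI[where C = "C * D"])
    fix f assume f: "f \<in> ell2 X"
    note t = bounded_op_ell2[OF assms(2) f]
    have "nsq X (S (T f)) \<le> C * (D * nsq X f)"
      using C(2)[OF t] mult_left_mono[OF D[OF f] C(1)] by linarith
    then show "S (T f) \<in> ell2 X \<and> nsq X (S (T f)) \<le> C * D * nsq X f"
      using bounded_op_ell2[OF assms(1) t] by simp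
  next
    show "linear_op_on (ell2 X) (\<lambda>f. S (T f))"
      unfolding linear_op_on_def
      by (auto simp: bounded_op_add_vec[OF assms(1)] bounded_op_add_vec[OF assms(2)] bounded_op_ell2[OF assms(2)]
        bounded_op_scale_vec[OF assms(1)] bounded_op_scale_vec[OF assms(2)])
  qed
qed

lemma bounded_op_scalar: "bounded_op X (\<lambda>f x. c * f x)"
  by (rule bounded_opI[where C = "(cmod c)\<^sup>2"]) (auto simp: ell2_scale linear_op_on_def algebra_simps)

lemma bounded_op_cong:
  assumes "bounded_op X S" "\<And>f. f \<in> ell2 X \<Longrightarrow> T f = S f"
  shows "bounded_op X T"
  using assms linear_subspace_ell2[of X] unfolding bounded_op_def linear_op_on_def linear_subspace_def by simp

lemma bounded_op_sum:
  assumes "finite I" "\<And>i. i \<in> I \<Longrightarrow> bounded_op X (T i)"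
  shows "bounded_op X (\<lambda>f x. \<Sum>i\<in>I. T i f x)"
  using assms by (induction I rule: finite_induct) (simp_all add: bounded_op_zero bounded_op_add)

text \<open>The generators, their opposites and the commutators below are finite sums of such
  weighted shifts. \<open>\<phi>\<close> maps a target label to its source.\<close>

definition wshift :: "'x set \<Rightarrow> ('x \<Rightarrow> complex) \<Rightarrow> ('x \<Rightarrow> 'x) \<Rightarrow> 'x cop" where
  "wshift X w \<phi> f = (\<lambda>y. if y \<in> X then w y * f (\<phi> y) else 0)"

text \<open>As \<open>\<phi>\<close> is injective, each coordinate of \<open>f\<close> is used at
  most once, so the norm is bounded by the largest weight. A weight whose source lies outside
  \<open>X\<close> meets a zero of \<open>f\<close>.\<close>

lemma bounded_op_wshift:
  assumes inj: "inj_on \<phi> X" and w: "\<And>y. y \<in> X \<Longrightarrow> \<phi> y \<in> X \<Longrightarrow> cmod (w y) \<le> C"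
  shows "bounded_op X (wshift X w \<phi>)"
proof (rule bounded_opI[where C = "C\<^sup>2"])
  fix f assume f: "f \<in> ell2 X"
  define Y where "Y = {y \<in> X. \<phi> y \<in> X}"
  define h where "h y = C\<^sup>2 * (if y \<in> Y then (cmod (f (\<phi> y)))\<^sup>2 else 0)" for y
  have injY: "inj_on \<phi> Y" using inj by (rule inj_on_subset) (auto simp: Y_def)
  have sX: "(\<lambda>x. (cmod (f x))\<^sup>2) summable_on X" using f by (simp add: ell2_def)
  have sY: "(\<lambda>x. (cmod (f x))\<^sup>2) summable_on (\<phi> ` Y)"
    by (rule summable_on_subset_banach[OF sX]) (auto simp: Y_def)
  have s1: "(\<lambda>y. (cmod (f (\<phi> y)))\<^sup>2) summable_on Y"
    using sY unfolding summable_on_reindex[OF injY] by (simp add: o_def)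
  have s2: "(\<lambda>y. if y \<in> Y then (cmod (f (\<phi> y)))\<^sup>2 else 0) summable_on X"
    using s1 by (rule summable_on_cong_neutral[THEN iffD1, rotated -1]) (auto simp: Y_def)
  have s3: "h summable_on X" unfolding h_def by (rule summable_on_cmult_right[OF s2])
  have "infsum (\<lambda>y. if y \<in> Y then (cmod (f (\<phi> y)))\<^sup>2 else 0) X = infsum (\<lambda>y. (cmod (f (\<phi> y)))\<^sup>2) Y"
    by (rule infsum_cong_neutral) (auto simp: Y_def)
  also have "\<dots> = infsum (\<lambda>x. (cmod (f x))\<^sup>2) (\<phi> ` Y)"
    unfolding infsum_reindex[OF injY] by (simp add: o_def)
  also have "\<dots> \<le> nsq X f" unfolding nsq_def
    by (rule infsum_mono_neutral[OF sY sX]) (auto simp: Y_def)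
  finally have h: "infsum h X \<le> C\<^sup>2 * nsq X f"
    unfolding h_def infsum_cmult_right' by (rule mult_left_mono) simp
  have dom: "(cmod (wshift X w \<phi> f x))\<^sup>2 \<le> h x" if x: "x \<in> X" for x
  proof (cases "\<phi> x \<in> X")
    case True
    have "(cmod (w x))\<^sup>2 \<le> C\<^sup>2" using w[OF x True] by (intro power_mono) auto
    then show ?thesis using x True by (simp add: wshift_def h_def Y_def norm_mult power_mult_distrib mult_right_mono)
  next
    case False
    then show ?thesis using x ell2_outside[OF f False] by (simp add: wshift_def h_def Y_def)
  qed
  have out: "wshift X w \<phi> f x = 0" if "x \<notin> X" for x using that by (simp add: wshift_def)
  show "wshift X w \<phi> f \<in> ell2 X \<and> nsq X (wshift X w \<phi> f) \<le> C\<^sup>2 * nsq X f"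
    using ell2_dominated[OF out s3 dom] h by auto
next
  show "linear_op_on (ell2 X) (wshift X w \<phi>)"
    by (auto simp: linear_op_on_def wshift_def algebra_simps)
qed

text \<open>Dividing the weights by \<open>q powr lev\<close> at the target leaves a bounded shift;
  the generator of the ideal, applied after it, restores them.\<close>

lemma exp_decay_wshift:
  assumes q: "0 < q" and inj: "inj_on \<phi> X"
    and w: "\<And>y. y \<in> X \<Longrightarrow> \<phi> y \<in> X \<Longrightarrow> cmod (w y) \<le> C * q powr lev y"
  shows "exp_decay q X lev (wshift X w \<phi>)"
proof -
  define v where "v y = w y / complex_of_real (q powr lev y)" for y
  have "bounded_op X (wshift X v \<phi>)"
  proof (rule bounded_op_wshift[OF inj])
    fix y assume "y \<in> X" "\<phi> y \<in> X"
    then show "cmod (v y) \<le> C" using w[of y] q by (simp add: v_def norm_divide divide_le_eq)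
  qed
  from exp_decay.right[OF exp_decay.generator this]
  have "exp_decay q X lev (\<lambda>f x. complex_of_real (q powr lev x) * wshift X v \<phi> f x)" .
  moreover have "(\<lambda>f x. complex_of_real (q powr lev x) * wshift X v \<phi> f x) = wshift X w \<phi>"
    using q by (auto simp: wshift_def v_def fun_eq_iff)
  ultimately show ?thesis by simp
qed

lemma exp_decay_zero: "exp_decay q X lev (\<lambda>f x. 0)"
  using exp_decay.left[OF bounded_op_zero exp_decay.generator] .

lemma exp_decay_sum:
  assumes "finite I" "\<And>i. i \<in> I \<Longrightarrow> exp_decay q X lev (T i)"
  shows "exp_decay q X lev (\<lambda>f x. \<Sum>i\<in>I. T i f x)"
  using assms by (induction I rule: finite_induct) (simp_all add: exp_decay_zero exp_decay.add)

section \<open>Direct sums\<close>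

lemma ell2_Plus:
  "f \<in> ell2 (X <+> Y) \<longleftrightarrow> (\<lambda>x. f (Inl x)) \<in> ell2 X \<and> (\<lambda>y. f (Inr y)) \<in> ell2 Y"
  "f \<in> ell2 (X <+> Y) \<Longrightarrow> nsq (X <+> Y) f = nsq X (\<lambda>x. f (Inl x)) + nsq Y (\<lambda>y. f (Inr y))"
proof -
  let ?g = "\<lambda>x. (cmod (f x))\<^sup>2"
  have P: "X <+> Y = Inl ` X \<union> Inr ` Y" by (simp add: Plus_def)
  have sl: "?g summable_on Inl ` X \<longleftrightarrow> (\<lambda>x. (cmod (f (Inl x)))\<^sup>2) summable_on X"
    by (simp add: summable_on_reindex o_def)
  have sr: "?g summable_on Inr ` Y \<longleftrightarrow> (\<lambda>x. (cmod (f (Inr x)))\<^sup>2) summable_on Y"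
    by (simp add: summable_on_reindex o_def)
  have s: "?g summable_on (X <+> Y) \<longleftrightarrow> ?g summable_on Inl ` X \<and> ?g summable_on Inr ` Y"
  proof
    assume "?g summable_on (X <+> Y)"
    then show "?g summable_on Inl ` X \<and> ?g summable_on Inr ` Y"
      by (auto simp: P intro: summable_on_subset_banach)
  next
    assume "?g summable_on Inl ` X \<and> ?g summable_on Inr ` Y"
    then show "?g summable_on (X <+> Y)" unfolding P by (intro summable_on_Un_disjoint) auto
  qed
  have z: "(\<forall>x. x \<notin> X <+> Y \<longrightarrow> f x = 0) \<longleftrightarrow> (\<forall>x. x \<notin> X \<longrightarrow> f (Inl x) = 0) \<and> (\<forall>y. y \<notin> Y \<longrightarrow> f (Inr y) = 0)"
    by (auto simp: split_sum_all)
  show i: "f \<in> ell2 (X <+> Y) \<longleftrightarrow> (\<lambda>x. f (Inl x)) \<in> ell2 X \<and> (\<lambda>y. f (Inr y)) \<in> ell2 Y"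
    using s sl sr z by (auto simp: ell2_def)
  assume "f \<in> ell2 (X <+> Y)"
  then have "?g summable_on Inl ` X" "?g summable_on Inr ` Y" using s by (auto simp: ell2_def)
  then have "infsum ?g (X <+> Y) = infsum ?g (Inl ` X) + infsum ?g (Inr ` Y)"
    unfolding P by (intro infsum_Un_disjoint) auto
  then show "nsq (X <+> Y) f = nsq X (\<lambda>x. f (Inl x)) + nsq Y (\<lambda>y. f (Inr y))"
    by (simp add: nsq_def infsum_reindex o_def)
qed

lemma dsum_simps [simp]:
  "(\<lambda>x. dsum S T f (Inl x)) = S (\<lambda>x. f (Inl x))" "(\<lambda>y. dsum S T f (Inr y)) = T (\<lambda>y. f (Inr y))"
  "dsum S T f (Inl x) = S (\<lambda>x. f (Inl x)) x" "dsum S T f (Inr y) = T (\<lambda>y. f (Inr y)) y"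
  by (simp_all add: dsum_def)

lemma sum_fun_eqI: "(\<lambda>x. f (Inl x)) = (\<lambda>x. g (Inl x)) \<Longrightarrow> (\<lambda>y. f (Inr y)) = (\<lambda>y. g (Inr y)) \<Longrightarrow> f = g"
  by (auto simp: fun_eq_iff split_sum_all)

lemma bounded_op_dsum:
  assumes "bounded_op X S" "bounded_op Y T"
  shows "bounded_op (X <+> Y) (dsum S T)"
proof -
  obtain C where C: "C \<ge> 0" "\<And>f. f \<in> ell2 X \<Longrightarrow> nsq X (S f) \<le> C * nsq X f" using assms(1) by (rule bounded_op_nsq) blast
  obtain D where D: "D \<ge> 0" "\<And>f. f \<in> ell2 Y \<Longrightarrow> nsq Y (T f) \<le> D * nsq Y f" using assms(2) by (rule bounded_op_nsq) blast
  show ?thesis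
  proof (rule bounded_opI[where C = "C + D"])
    fix f assume f: "f \<in> ell2 (X <+> Y)"
    then have fl: "(\<lambda>x. f (Inl x)) \<in> ell2 X" and fr: "(\<lambda>y. f (Inr y)) \<in> ell2 Y" by (simp_all add: ell2_Plus(1))
    have m: "dsum S T f \<in> ell2 (X <+> Y)"
      using bounded_op_ell2[OF assms(1) fl] bounded_op_ell2[OF assms(2) fr] by (simp add: ell2_Plus(1))
    have "C * nsq X (\<lambda>x. f (Inl x)) + D * nsq Y (\<lambda>y. f (Inr y)) \<le> (C + D) * nsq (X <+> Y) f"
      unfolding ell2_Plus(2)[OF f] using C D nsq_nonneg[of X "\<lambda>x. f (Inl x)"] nsq_nonneg[of Y "\<lambda>y. f (Inr y)"]
      by (simp add: algebra_simps)
    then show "dsum S T f \<in> ell2 (X <+> Y) \<and> nsq (X <+> Y) (dsum S T f) \<le> (C + D) * nsq (X <+> Y) f"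
      using m C(2)[OF fl] D(2)[OF fr] by (simp add: ell2_Plus(2)[OF m])
  next
    show "linear_op_on (ell2 (X <+> Y)) (dsum S T)"
      unfolding linear_op_on_def
      by (auto intro!: sum_fun_eqI simp: ell2_Plus(1) bounded_op_add_vec[OF assms(1)] bounded_op_add_vec[OF assms(2)]
        bounded_op_scale_vec[OF assms(1)] bounded_op_scale_vec[OF assms(2)])
  qed
qed

lemma bounded_op_id: "bounded_op X (\<lambda>f. f)"
  using bounded_op_scalar[of X 1] by simp

lemma bounded_op_vec_zero: "bounded_op X T \<Longrightarrow> T (\<lambda>x. 0) = (\<lambda>x. 0)"
  using bounded_op_scale_vec[OF _ ell2_zero, of X T 0] by simp

text \<open>The generator of the ideal on the sum, preceded by the projection to one summand, is the
  generator of that summand padded with zero. The induction pads the ideal operations in the same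
  way.\<close>

lemma exp_decay_dsum_left:
  fixes Y :: "'y set"
  assumes "exp_decay q X lev S"
  shows "exp_decay q (X <+> Y) (case_sum lev lev') (dsum S (\<lambda>f y. 0))"
  using assms
proof induction
  case generator
  have p: "bounded_op (X <+> Y) (dsum (\<lambda>f. f) (\<lambda>f y. 0))"
    by (rule bounded_op_dsum[OF bounded_op_id bounded_op_zero])
  show ?case
    by (rule exp_decay.cong[OF exp_decay.right[OF exp_decay.generator p]]) (auto intro!: sum_fun_eqI)
next
  case (add S T)
  show ?case by (rule exp_decay.cong[OF exp_decay.add[OF add.IH]]) (auto intro!: sum_fun_eqI)
next
  case (left R S)
  show ?case
    by (rule exp_decay.cong[OF exp_decay.left[OF bounded_op_dsum[OF left.hyps(1) bounded_op_zero] left.IH]])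
      (auto intro!: sum_fun_eqI)
next
  case (right S R)
  show ?case
    by (rule exp_decay.cong[OF exp_decay.right[OF right.IH bounded_op_dsum[OF right.hyps(2) bounded_op_zero]]])
      (auto intro!: sum_fun_eqI)
next
  case (cong S T)
  show ?case
    by (rule exp_decay.cong[OF cong.IH]) (auto intro!: sum_fun_eqI simp: ell2_Plus(1) cong.hyps)
qed

lemma exp_decay_dsum_right:
  fixes Y :: "'y set"
  assumes "exp_decay q X lev S"
  shows "exp_decay q (Y <+> X) (case_sum lev' lev) (dsum (\<lambda>f y. 0) S)"
  using assms
proof induction
  case generator
  have p: "bounded_op (Y <+> X) (dsum (\<lambda>f y. 0) (\<lambda>f. f))"
    by (rule bounded_op_dsum[OF bounded_op_zero bounded_op_id])
  show ?case
    by (rule exp_decay.cong[OF exp_decay.right[OF exp_decay.generator p]]) (auto intro!: sum_fun_eqI)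
next
  case (add S T)
  show ?case by (rule exp_decay.cong[OF exp_decay.add[OF add.IH]]) (auto intro!: sum_fun_eqI)
next
  case (left R S)
  show ?case
    by (rule exp_decay.cong[OF exp_decay.left[OF bounded_op_dsum[OF bounded_op_zero left.hyps(1)] left.IH]])
      (auto intro!: sum_fun_eqI)
next
  case (right S R)
  show ?case
    by (rule exp_decay.cong[OF exp_decay.right[OF right.IH bounded_op_dsum[OF bounded_op_zero right.hyps(2)]]])
      (auto intro!: sum_fun_eqI)
next
  case (cong S T)
  show ?case
    by (rule exp_decay.cong[OF cong.IH]) (auto intro!: sum_fun_eqI simp: ell2_Plus(1) cong.hyps)
qed

lemma exp_decay_dsum:
  assumes "exp_decay q X lev S" "exp_decay q Y lev' T"
  shows "exp_decay q (X <+> Y) (case_sum lev lev') (dsum S T)"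
  by (rule exp_decay.cong[OF exp_decay.add[OF exp_decay_dsum_left[OF assms(1)] exp_decay_dsum_right[OF assms(2)]]])
    (auto intro!: sum_fun_eqI)

section \<open>The coefficients of the commutators with D\<close>

lemma V_basis_minus: "V_basis (- N) = V_basis N"
  by (simp add: V_basis_def)

lemma coef_bounds:
  assumes q: "0 < q" "q < 1" and N: "2 * N \<in> \<int>" and g: "g \<in> gens"
  obtains C where "C \<ge> 0"
    "\<And>\<sigma> l m. \<sigma> \<in> {-1,0,1} \<Longrightarrow> (l, m) \<in> V_basis N \<Longrightarrow> \<bar>coef q N g \<sigma> l m\<bar> \<le> C"
    "\<And>\<sigma> l m. \<sigma> \<in> {-1,1} \<Longrightarrow> (l, m) \<in> V_basis N \<Longrightarrow> \<bar>coef q N g \<sigma> l m\<bar> \<le> C * q powr l"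
proof -
  obtain C0 where C0: "C0 \<ge> 0" "\<And>l m. (l, m) \<in> V_basis N \<Longrightarrow> \<bar>coef q N g 0 l m - gamma q g (l+m)\<bar> \<le> C0 * q powr (2*l)"
    using coef_diag_estimate[OF q N g] by blast
  obtain C1 a1 where C1: "C1 \<ge> 0" "\<And>l m. (l, m) \<in> V_basis N \<Longrightarrow> \<bar>a1 l\<bar> \<le> C1 * q powr l"
    "\<And>l m. (l, m) \<in> V_basis N \<Longrightarrow> \<bar>coef q N g 1 l m - a1 l\<bar> \<le> C1 * (q powr l * q powr (l + m))"
    by (rule coef_shift_estimate[OF q N g, of 1]) (simp, (rule that; assumption))
  obtain C2 a2 where C2: "C2 \<ge> 0" "\<And>l m. (l, m) \<in> V_basis N \<Longrightarrow> \<bar>a2 l\<bar> \<le> C2 * q powr l"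
    "\<And>l m. (l, m) \<in> V_basis N \<Longrightarrow> \<bar>coef q N g (-1) l m - a2 l\<bar> \<le> C2 * (q powr l * q powr (l + m))"
    by (rule coef_shift_estimate[OF q N g, of "-1"]) (simp, (rule that; assumption))
  define C where "C = C0 + 1/q + 2 * C1 + 2 * C2"
  have C: "C \<ge> 0" "C0 + 1/q \<le> C" "2 * C1 \<le> C" "2 * C2 \<le> C" using C0 C1 C2 q by (auto simp: C_def)
  have shift: "\<bar>c\<bar> \<le> C * q powr l"
    if lm: "(l, m) \<in> V_basis N" and D: "\<bar>a\<bar> \<le> D * q powr l" "\<bar>c - a\<bar> \<le> D * (q powr l * q powr (l + m))" "D \<ge> 0" "2 * D \<le> C" for a c D l m
  proof -
    have "q powr (l + m) \<le> 1" using q V_basis_bounds[OF lm] powr_le1[of "l+m" q] by simp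
    then have "D * (q powr l * q powr (l + m)) \<le> D * (q powr l * 1)" using D by (intro mult_left_mono) auto
    then have "\<bar>c\<bar> \<le> 2 * D * q powr l" using D by linarith
    also have "\<dots> \<le> C * q powr l" using D by (intro mult_right_mono) auto
    finally show ?thesis .
  qed
  have s1: "\<bar>coef q N g \<sigma> l m\<bar> \<le> C * q powr l" if "\<sigma> \<in> {-1,1}" "(l, m) \<in> V_basis N" for \<sigma> l m
    using that(1) shift[OF that(2) C1(2,3)[OF that(2)] C1(1) C(3)] shift[OF that(2) C2(2,3)[OF that(2)] C2(1) C(4)] by auto
  show thesis
  proof (rule that[OF C(1) _ s1])
    fix \<sigma> l m :: real assume s: "\<sigma> \<in> {-1,0,1}" and lm: "(l, m) \<in> V_basis N"
    have b: "q powr l \<le> 1" "q powr (2*l) \<le> 1" "q powr (l+m) \<le> 1" "l + m \<ge> 0"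
      using V_basis_bounds[OF lm] q by (auto intro!: powr_le1)
    show "\<bar>coef q N g \<sigma> l m\<bar> \<le> C"
    proof (cases "\<sigma> = 0")
      case True
      have "\<bar>gamma q g (l+m)\<bar> \<le> (1/q) * 1"
        using gamma_bound[OF q b(4), of g] mult_left_mono[OF b(3), of "1/q"] q by simp
      moreover have "C0 * q powr (2*l) \<le> C0 * 1" using b C0 by (intro mult_left_mono) auto
      ultimately show ?thesis using C0(2)[OF lm] C(2) unfolding True by linarith
    next
      case False
      then have "\<bar>coef q N g \<sigma> l m\<bar> \<le> C * q powr l" using s1[OF _ lm] s by auto
      also have "\<dots> \<le> C * 1" using b C by (intro mult_left_mono) auto
      finally show ?thesis by simp
    qed
  qed
qed

text \<open>
  The coefficients of the component \<open>V\<^sub>K \<rightarrow> V\<^bsub>K'\<^esub>\<close> of \<open>[D, \<pi>(g)]\<close>, up to the scalar \<open>d\<^sub>K\<close>.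
\<close>

definition Dcoef :: "real \<Rightarrow> real \<Rightarrow> real \<Rightarrow> podles_expr \<Rightarrow> real \<Rightarrow> real \<Rightarrow> real \<Rightarrow> real" where
  "Dcoef q K K' g \<sigma> a b =
     (if \<bar>K'\<bar> \<le> a + \<sigma> then q powr (- (a + \<sigma>)) * coef q K g \<sigma> a b else 0)
     - (if \<bar>K'\<bar> \<le> a then q powr (- a) * coef q K' g \<sigma> a b else 0)"

text \<open>The weight of \<open>opp1\<close> from \<open>|a, b>\<close> to
  \<open>|a + \<sigma>, b - mshift g>\<close>: \<open>m\<close> is reversed before and after.
  Conjugation leaves no trace because the weights are real.\<close>

definition opcoef where "opcoef q K g \<sigma> a b = coef q (- K) g \<sigma> a (- b)"

text \<open>Turns the truncations \<open>l < |K'|\<close> of \<open>D\<close> into membership of a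
  label in both summands.\<close>

lemma V_basis_other:
  assumes "(l, m) \<in> V_basis K" "\<bar>K\<bar> - \<bar>K'\<bar> \<in> \<int>"
  shows "(l, m) \<in> V_basis K' \<longleftrightarrow> \<bar>K'\<bar> \<le> l"
proof -
  have n: "l - \<bar>K\<bar> \<in> \<nat>" using assms(1) by (simp add: V_basis_def)
  then have "l - \<bar>K\<bar> \<in> \<int>" by (auto elim: Nats_cases)
  then have "(l - \<bar>K\<bar>) + (\<bar>K\<bar> - \<bar>K'\<bar>) \<in> \<int>" using assms(2) by (rule Ints_add)
  then have i: "l - \<bar>K'\<bar> \<in> \<int>" by simp
  have "l - \<bar>K'\<bar> \<in> \<nat> \<longleftrightarrow> \<bar>K'\<bar> \<le> l"
    using i by (auto simp: Nats_altdef2)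
  then show ?thesis using assms(1) by (simp add: V_basis_def)
qed

text \<open>A bare pair of indices, so that the results apply to both components of \<open>D\<close>
  and to the summands of \<open>H'\<close> as well.\<close>

locale podles_pair =
  fixes q K K' :: real
  assumes q: "0 < q" "q < 1" and K: "2 * K \<in> \<int>" "2 * K' \<in> \<int>" and KK: "\<bar>K\<bar> - \<bar>K'\<bar> \<in> \<int>"
begin

lemma Dcoef_leave:
  assumes ab: "(a, b) \<in> V_basis K" and g: "g \<in> gens" and s: "\<sigma> \<in> {-1,0,1}"
    and out: "(a + \<sigma>, b + mshift g) \<notin> V_basis K'"
  shows "Dcoef q K K' g \<sigma> a b = 0"
proof -
  have "coef q K g \<sigma> a b = 0" if "\<bar>K'\<bar> \<le> a + \<sigma>"
    using coef_leave[OF ab g s] V_basis_other[of "a + \<sigma>" "b + mshift g" K K'] KK that out by blast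
  moreover have "coef q K' g \<sigma> a b = 0" if "\<bar>K'\<bar> \<le> a"
    using coef_leave[OF _ g s out] V_basis_other[OF ab KK] that by blast
  ultimately show ?thesis by (simp add: Dcoef_def)
qed

text \<open>For \<open>\<sigma> = 0\<close> the function \<open>gamma\<close>, common to
  \<open>K\<close> and \<open>K'\<close>, drops out, and an error of order q^(2a) meets the factor
  q^(-a) of \<open>D\<close>. For the other shifts the coefficients are of order q^a, so that factor
  makes them bounded; their leading part \<open>\<eta>\<close> does not see
  \<open>b\<close>.\<close>

lemma Dcoef_bounds:
  assumes g: "g \<in> gens"
  obtains C \<eta> where "C \<ge> 0"
    "\<And>\<sigma> a b. \<sigma> \<in> {-1,0,1} \<Longrightarrow> (a, b) \<in> V_basis K \<Longrightarrow> \<bar>Dcoef q K K' g \<sigma> a b\<bar> \<le> C"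
    "\<And>a b. (a, b) \<in> V_basis K \<Longrightarrow> \<bar>Dcoef q K K' g 0 a b\<bar> \<le> C * q powr a"
    "\<And>\<sigma> a b. \<sigma> \<in> {-1,1} \<Longrightarrow> (a, b) \<in> V_basis K \<Longrightarrow> \<bar>Dcoef q K K' g \<sigma> a b - \<eta> \<sigma> a\<bar> \<le> C * q powr (a + b)"
    "\<And>\<sigma> a. \<sigma> \<in> {-1,1} \<Longrightarrow> \<sigma> \<noteq> mshift g \<Longrightarrow> \<eta> \<sigma> a = 0"
proof -
  have ex: "\<exists>C \<Lambda>. C \<ge> 0 \<and> (\<sigma> \<noteq> mshift g \<longrightarrow> \<Lambda> = (\<lambda>_. 0)) \<and> (\<forall>l m. (l, m) \<in> V_basis N \<longrightarrow> \<bar>\<Lambda> l\<bar> \<le> C * q powr l \<and>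
     \<bar>coef q N g \<sigma> l m - \<Lambda> l\<bar> \<le> C * (q powr l * q powr (l + m)))" if "2 * N \<in> \<int>" "\<sigma> \<in> {-1,1}" for N \<sigma> :: real
    by (rule coef_shift_estimate[OF q that(1) g that(2)]) blast
  define S where "S = {-1, 1::real}"
  have "\<exists>C1 \<Lambda>1. \<forall>\<sigma>\<in>S. C1 \<sigma> \<ge> 0 \<and> (\<sigma> \<noteq> mshift g \<longrightarrow> \<Lambda>1 \<sigma> = (\<lambda>_. 0)) \<and> (\<forall>l m. (l, m) \<in> V_basis N \<longrightarrow> \<bar>\<Lambda>1 \<sigma> l\<bar> \<le> C1 \<sigma> * q powr l \<and>
     \<bar>coef q N g \<sigma> l m - \<Lambda>1 \<sigma> l\<bar> \<le> C1 \<sigma> * (q powr l * q powr (l + m)))" if "2 * N \<in> \<int>" for N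
  proof -
    note N = that
    have m1: "1 \<in> {-1,1::real}" and m2: "-1 \<in> {-1,1::real}" by simp_all
    obtain C1 L1 where 1: "C1 \<ge> 0 \<and> (1 \<noteq> mshift g \<longrightarrow> L1 = (\<lambda>_. 0)) \<and> (\<forall>l m. (l, m) \<in> V_basis N \<longrightarrow> \<bar>L1 l\<bar> \<le> C1 * q powr l \<and>
     \<bar>coef q N g 1 l m - L1 l\<bar> \<le> C1 * (q powr l * q powr (l + m)))" using ex[OF N m1] by (elim exE) (rule that)
    obtain C2 L2 where 2: "C2 \<ge> 0 \<and> (-1 \<noteq> mshift g \<longrightarrow> L2 = (\<lambda>_. 0)) \<and> (\<forall>l m. (l, m) \<in> V_basis N \<longrightarrow> \<bar>L2 l\<bar> \<le> C2 * q powr l \<and>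
     \<bar>coef q N g (-1) l m - L2 l\<bar> \<le> C2 * (q powr l * q powr (l + m)))" using ex[OF N m2] by (elim exE) (rule that)
    show ?thesis
      by (rule exI[of _ "\<lambda>\<sigma>. if \<sigma> = 1 then C1 else C2"], rule exI[of _ "\<lambda>\<sigma>. if \<sigma> = 1 then L1 else L2"])
        (use 1 2 in \<open>simp add: S_def\<close>)
  qed
  note ch = this
  obtain C1 \<Lambda>1 where L: "\<forall>\<sigma>\<in>S. C1 \<sigma> \<ge> 0 \<and> (\<sigma> \<noteq> mshift g \<longrightarrow> \<Lambda>1 \<sigma> = (\<lambda>_. 0)) \<and> (\<forall>l m. (l, m) \<in> V_basis K \<longrightarrow> \<bar>\<Lambda>1 \<sigma> l\<bar> \<le> C1 \<sigma> * q powr l \<and>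
     \<bar>coef q K g \<sigma> l m - \<Lambda>1 \<sigma> l\<bar> \<le> C1 \<sigma> * (q powr l * q powr (l + m)))"
    using ch[OF K(1)] by (elim exE) (rule that)
  have L1: "\<And>\<sigma>. \<sigma> \<in> S \<Longrightarrow> C1 \<sigma> \<ge> 0" "\<And>\<sigma>. \<sigma> \<in> S \<Longrightarrow> \<sigma> \<noteq> mshift g \<Longrightarrow> \<Lambda>1 \<sigma> = (\<lambda>_. 0)"
    "\<And>\<sigma> l m. \<sigma> \<in> S \<Longrightarrow> (l, m) \<in> V_basis K \<Longrightarrow> \<bar>coef q K g \<sigma> l m - \<Lambda>1 \<sigma> l\<bar> \<le> C1 \<sigma> * (q powr l * q powr (l + m))"
    using L by simp_all
  obtain C2 \<Lambda>2 where L': "\<forall>\<sigma>\<in>S. C2 \<sigma> \<ge> 0 \<and> (\<sigma> \<noteq> mshift g \<longrightarrow> \<Lambda>2 \<sigma> = (\<lambda>_. 0)) \<and> (\<forall>l m. (l, m) \<in> V_basis K' \<longrightarrow> \<bar>\<Lambda>2 \<sigma> l\<bar> \<le> C2 \<sigma> * q powr l \<and>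
     \<bar>coef q K' g \<sigma> l m - \<Lambda>2 \<sigma> l\<bar> \<le> C2 \<sigma> * (q powr l * q powr (l + m)))"
    using ch[OF K(2)] by (elim exE) (rule that)
  have L2: "\<And>\<sigma>. \<sigma> \<in> S \<Longrightarrow> C2 \<sigma> \<ge> 0" "\<And>\<sigma>. \<sigma> \<in> S \<Longrightarrow> \<sigma> \<noteq> mshift g \<Longrightarrow> \<Lambda>2 \<sigma> = (\<lambda>_. 0)"
    "\<And>\<sigma> l m. \<sigma> \<in> S \<Longrightarrow> (l, m) \<in> V_basis K' \<Longrightarrow> \<bar>coef q K' g \<sigma> l m - \<Lambda>2 \<sigma> l\<bar> \<le> C2 \<sigma> * (q powr l * q powr (l + m))"
    using L' by simp_all
  obtain D1 where D1: "D1 \<ge> 0" "\<And>l m. (l, m) \<in> V_basis K \<Longrightarrow> \<bar>coef q K g 0 l m - gamma q g (l+m)\<bar> \<le> D1 * q powr (2*l)"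
    using coef_diag_estimate[OF q K(1) g] by blast
  obtain D2 where D2: "D2 \<ge> 0" "\<And>l m. (l, m) \<in> V_basis K' \<Longrightarrow> \<bar>coef q K' g 0 l m - gamma q g (l+m)\<bar> \<le> D2 * q powr (2*l)"
    using coef_diag_estimate[OF q K(2) g] by blast
  obtain B1 where B1: "B1 \<ge> 0" "\<And>\<sigma> l m. \<sigma> \<in> {-1,1} \<Longrightarrow> (l, m) \<in> V_basis K \<Longrightarrow> \<bar>coef q K g \<sigma> l m\<bar> \<le> B1 * q powr l"
    by (rule coef_bounds[OF q K(1) g]) (rule that; assumption)
  obtain B2 where B2: "B2 \<ge> 0" "\<And>\<sigma> l m. \<sigma> \<in> {-1,1} \<Longrightarrow> (l, m) \<in> V_basis K' \<Longrightarrow> \<bar>coef q K' g \<sigma> l m\<bar> \<le> B2 * q powr l"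
    by (rule coef_bounds[OF q K(2) g]) (rule that; assumption)
  define C where "C = (C1 1 + C1 (-1) + B1) / q + (C2 1 + C2 (-1) + B2) + (D1 + D2)"
  \<comment> \<open>The truncations of \<open>Dcoef\<close> are kept in \<open>\<eta>\<close>, so
    the estimate holds on the lowest levels too.\<close>
  define \<eta> where "\<eta> \<sigma> a = (if \<bar>K'\<bar> \<le> a + \<sigma> then q powr (- (a + \<sigma>)) * \<Lambda>1 \<sigma> a else 0)
     - (if \<bar>K'\<bar> \<le> a then q powr (- a) * \<Lambda>2 \<sigma> a else 0)" for \<sigma> a
  have pos: "C1 1 \<ge> 0" "C1 (-1) \<ge> 0" "C2 1 \<ge> 0" "C2 (-1) \<ge> 0" using L1(1) L2(1) by (auto simp: S_def)
  then have posq: "0 \<le> C1 1 / q" "0 \<le> C1 (-1) / q" "0 \<le> B1 / q" using B1(1) q by auto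
  have C: "C \<ge> 0" "B1 / q + B2 \<le> C" "D1 + D2 \<le> C" "\<And>\<sigma>. \<sigma> \<in> S \<Longrightarrow> C1 \<sigma> / q + C2 \<sigma> \<le> C"
    using pos posq B1(1) B2(1) D1(1) D2(1) by (auto simp: C_def S_def add_divide_distrib)
  have inv: "q powr (-a) * (E * (q powr a * w)) = E * w" for a E w using q by (simp add: powr_minus)
  \<comment> \<open>One estimate for all truncated differences: a step changes
    \<open>q powr (-a)\<close> by at most the factor 1/q.\<close>
  have shift: "\<bar>(if c then q powr (- (a + \<sigma>)) * x else 0) - (if d then q powr (- a) * y else 0)\<bar> \<le> C * w"
    if "\<sigma> \<in> S" "c \<Longrightarrow> \<bar>x\<bar> \<le> E1 * (q powr a * w)" "d \<Longrightarrow> \<bar>y\<bar> \<le> E2 * (q powr a * w)" "E1 \<ge> 0" "E2 \<ge> 0" "E1 / q + E2 \<le> C" "w \<ge> 0"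
    for c d \<sigma> a x y E1 E2 w
  proof -
    have "q powr (- (a + \<sigma>)) \<le> q powr (-a) / q"
    proof -
      have "q powr (- (a + \<sigma>)) \<le> q powr (-a - 1)" using that(1) q by (intro powr_mono') (auto simp: S_def)
      then show ?thesis using q by (simp add: powr_diff)
    qed
    then have "\<bar>q powr (- (a + \<sigma>)) * x\<bar> \<le> E1 / q * w" if c
      using mult_mono[of "q powr (- (a + \<sigma>))" "q powr (-a) / q" "\<bar>x\<bar>" "E1 * (q powr a * w)"] \<open>c \<Longrightarrow> \<bar>x\<bar> \<le> E1 * (q powr a * w)\<close>[OF that]
        inv[of a E1 w] q by (simp add: abs_mult)
    moreover have "E1 / q * w \<ge> 0" "E2 * w \<ge> 0" using that q by auto
    moreover have "\<bar>q powr (-a) * y\<bar> \<le> E2 * w" if d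
      using mult_left_mono[OF \<open>d \<Longrightarrow> \<bar>y\<bar> \<le> E2 * (q powr a * w)\<close>[OF that], of "q powr (-a)"] inv[of a E2 w] by (simp add: abs_mult)
    ultimately have "\<bar>(if c then q powr (- (a + \<sigma>)) * x else 0) - (if d then q powr (- a) * y else 0)\<bar> \<le> E1 / q * w + E2 * w"
      using abs_triangle_ineq4[of "if c then q powr (- (a + \<sigma>)) * x else 0" "if d then q powr (- a) * y else 0"] by (auto split: if_splits)
    also have "\<dots> = (E1 / q + E2) * w" by (simp add: algebra_simps)
    also have "\<dots> \<le> C * w" using that by (intro mult_right_mono) auto
    finally show ?thesis .
  qed
  have e0: "\<bar>Dcoef q K K' g 0 a b\<bar> \<le> C * q powr a" if ab: "(a, b) \<in> V_basis K" for a b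
  proof (cases "\<bar>K'\<bar> \<le> a")
    case False
    then show ?thesis using C(1) by (simp add: Dcoef_def)
  next
    case True
    then have ab': "(a, b) \<in> V_basis K'" using V_basis_other[OF ab KK] by simp
    have "Dcoef q K K' g 0 a b = q powr (-a) * (coef q K g 0 a b - coef q K' g 0 a b)"
      using True by (simp add: Dcoef_def algebra_simps)
    moreover have "\<bar>coef q K g 0 a b - coef q K' g 0 a b\<bar> \<le> (D1 + D2) * q powr (2*a)"
      using D1(2)[OF ab] D2(2)[OF ab'] unfolding ring_distribs by linarith
    ultimately have "\<bar>Dcoef q K K' g 0 a b\<bar> \<le> q powr (-a) * ((D1 + D2) * q powr (2*a))"
      by (simp add: abs_mult mult_left_mono)
    also have "\<dots> = (D1 + D2) * q powr a" by (simp add: powr_add[symmetric])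
    also have "\<dots> \<le> C * q powr a" using C(3) by (intro mult_right_mono) auto
    finally show ?thesis .
  qed
  show thesis
  proof (rule that[OF C(1) _ e0])
    fix \<sigma> a b :: real assume s: "\<sigma> \<in> {-1,0,1}" and ab: "(a, b) \<in> V_basis K"
    show "\<bar>Dcoef q K K' g \<sigma> a b\<bar> \<le> C"
    proof (cases "\<sigma> = 0")
      case True
      have "q powr a \<le> 1" using V_basis_bounds[OF ab] q by (intro powr_le1) auto
      then have "C * q powr a \<le> C" using C(1) by (simp add: mult_left_le)
      then show ?thesis using e0[OF ab] True by simp
    next
      case False
      then have S: "\<sigma> \<in> S" "\<sigma> \<in> {-1,1}" using s by (auto simp: S_def)
      have p1: "\<bar>coef q K g \<sigma> a b\<bar> \<le> B1 * (q powr a * 1)" using B1(2)[OF S(2) ab] by simp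
      have p2: "\<bar>coef q K' g \<sigma> a b\<bar> \<le> B2 * (q powr a * 1)" if "\<bar>K'\<bar> \<le> a"
        using B2(2)[OF S(2), of a b] that V_basis_other[OF ab KK] by simp
      have "\<bar>Dcoef q K K' g \<sigma> a b\<bar> \<le> C * 1"
        unfolding Dcoef_def by (rule shift[OF S(1) p1 p2 B1(1) B2(1) C(2) zero_le_one])
      then show ?thesis by simp
    qed
  next
    fix \<sigma> a b :: real assume s: "\<sigma> \<in> {-1,1}" and ab: "(a, b) \<in> V_basis K"
    then have S: "\<sigma> \<in> S" by (simp add: S_def)
    have "Dcoef q K K' g \<sigma> a b - \<eta> \<sigma> a = (if \<bar>K'\<bar> \<le> a + \<sigma> then q powr (- (a + \<sigma>)) * (coef q K g \<sigma> a b - \<Lambda>1 \<sigma> a) else 0)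
     - (if \<bar>K'\<bar> \<le> a then q powr (- a) * (coef q K' g \<sigma> a b - \<Lambda>2 \<sigma> a) else 0)"
      by (simp add: Dcoef_def \<eta>_def algebra_simps)
    also have "\<bar>\<dots>\<bar> \<le> C * q powr (a + b)"
    proof (rule shift[OF S L1(3)[OF S ab] _ L1(1)[OF S] L2(1)[OF S] C(4)[OF S] powr_ge_zero])
      assume "\<bar>K'\<bar> \<le> a"
      then show "\<bar>coef q K' g \<sigma> a b - \<Lambda>2 \<sigma> a\<bar> \<le> C2 \<sigma> * (q powr a * q powr (a + b))"
        using L2(3)[OF S, of a b] V_basis_other[OF ab KK] by simp
    qed
    finally show "\<bar>Dcoef q K K' g \<sigma> a b - \<eta> \<sigma> a\<bar> \<le> C * q powr (a + b)" .
  next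
    fix \<sigma> a :: real assume "\<sigma> \<in> {-1,1}" "\<sigma> \<noteq> mshift g"
    then show "\<eta> \<sigma> a = 0" using L1(2)[of \<sigma>] L2(2)[of \<sigma>] by (simp add: \<eta>_def S_def)
  qed
qed

end

lemma opcoef_leave:
  assumes "(a, b) \<in> V_basis K" "g \<in> gens" "\<sigma> \<in> {-1,0,1}" "(a + \<sigma>, b - mshift g) \<notin> V_basis K"
  shows "opcoef q K g \<sigma> a b = 0"
  unfolding opcoef_def
  by (rule coef_leave) (use assms in \<open>auto simp: V_basis_def algebra_simps\<close>)

context podles_pair
begin

text \<open>If \<open>g'\<close> changes the level, its weights are of order q^a and those of
  \<open>Dcoef\<close> are bounded. If neither generator does, \<open>Dcoef\<close> is of order q^a.
  If only \<open>g\<close> does and \<open>\<sigma> \<noteq> mshift g\<close>, then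
  \<open>Dcoef\<close> is of order q^(a+b) and the opposite weights of order q^(a-b). If
  \<open>\<sigma> = mshift g\<close>, the step preserves \<open>a - b\<close>: the opposite weights
  before and after it differ by O(q^(2a)), while the two values of \<open>Dcoef\<close> differ by
  O(q^(a+b)) and are multiplied by an opposite weight of order q^(a-b).\<close>

lemma commutator_weight_decay:
  assumes g: "g \<in> gens" and g': "g' \<in> gens"
  obtains C where "C \<ge> 0"
    "\<And>\<sigma> \<tau> a b. \<sigma> \<in> {-1,0,1} \<Longrightarrow> \<tau> \<in> {-1,0,1} \<Longrightarrow> (a, b) \<in> V_basis K \<Longrightarrow>
      \<bar>opcoef q K' g' \<tau> (a + \<sigma>) (b + mshift g) * Dcoef q K K' g \<sigma> a b
       - Dcoef q K K' g \<sigma> (a + \<tau>) (b - mshift g') * opcoef q K g' \<tau> a b\<bar> \<le> C * q powr a"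
proof -
  have Km: "2 * (- K) \<in> \<int>" "2 * (- K') \<in> \<int>" using K by simp_all
  have fl: "(a, - b) \<in> V_basis (- N) \<longleftrightarrow> (a, b) \<in> V_basis N" for a b N by (auto simp: V_basis_def)
  obtain B1 where B1: "B1 \<ge> 0" "\<And>\<sigma> l m. \<sigma> \<in> {-1,0,1} \<Longrightarrow> (l, m) \<in> V_basis (-K) \<Longrightarrow> \<bar>coef q (-K) g' \<sigma> l m\<bar> \<le> B1"
    "\<And>\<sigma> l m. \<sigma> \<in> {-1,1} \<Longrightarrow> (l, m) \<in> V_basis (-K) \<Longrightarrow> \<bar>coef q (-K) g' \<sigma> l m\<bar> \<le> B1 * q powr l"
    by (rule coef_bounds[OF q Km(1) g']) (rule that; assumption)
  obtain B2 where B2: "B2 \<ge> 0" "\<And>\<sigma> l m. \<sigma> \<in> {-1,0,1} \<Longrightarrow> (l, m) \<in> V_basis (-K') \<Longrightarrow> \<bar>coef q (-K') g' \<sigma> l m\<bar> \<le> B2"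
    "\<And>\<sigma> l m. \<sigma> \<in> {-1,1} \<Longrightarrow> (l, m) \<in> V_basis (-K') \<Longrightarrow> \<bar>coef q (-K') g' \<sigma> l m\<bar> \<le> B2 * q powr l"
    by (rule coef_bounds[OF q Km(2) g']) (rule that; assumption)
  obtain D1 where D1: "D1 \<ge> 0" "\<And>l m. (l, m) \<in> V_basis (-K) \<Longrightarrow> \<bar>coef q (-K) g' 0 l m - gamma q g' (l+m)\<bar> \<le> D1 * q powr (2*l)"
    using coef_diag_estimate[OF q Km(1) g'] by blast
  obtain D2 where D2: "D2 \<ge> 0" "\<And>l m. (l, m) \<in> V_basis (-K') \<Longrightarrow> \<bar>coef q (-K') g' 0 l m - gamma q g' (l+m)\<bar> \<le> D2 * q powr (2*l)"
    using coef_diag_estimate[OF q Km(2) g'] by blast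
  obtain E \<eta> where E: "E \<ge> 0"
    "\<And>\<sigma> a b. \<sigma> \<in> {-1,0,1} \<Longrightarrow> (a, b) \<in> V_basis K \<Longrightarrow> \<bar>Dcoef q K K' g \<sigma> a b\<bar> \<le> E"
    "\<And>a b. (a, b) \<in> V_basis K \<Longrightarrow> \<bar>Dcoef q K K' g 0 a b\<bar> \<le> E * q powr a"
    "\<And>\<sigma> a b. \<sigma> \<in> {-1,1} \<Longrightarrow> (a, b) \<in> V_basis K \<Longrightarrow> \<bar>Dcoef q K K' g \<sigma> a b - \<eta> \<sigma> a\<bar> \<le> E * q powr (a + b)"
    "\<And>\<sigma> a. \<sigma> \<in> {-1,1} \<Longrightarrow> \<sigma> \<noteq> mshift g \<Longrightarrow> \<eta> \<sigma> a = 0"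
    by (rule Dcoef_bounds[OF g]) (rule that; assumption)
  \<comment> \<open>The division by \<open>q^2\<close> pays for evaluating the bounds at labels that
    an earlier step has moved.\<close>
  define F where "F = (B1 + B2 + D1 + D2 + 1/q) / q^2"
  have q2: "0 < q^2" "q^2 \<le> 1" "1/q > 0" "1/q \<ge> 1" using q by (auto simp: power_le_one)
  have sm: "x \<le> F" if "0 \<le> x" "x \<le> B1 + B2 + D1 + D2 + 1/q" for x
  proof -
    have "x * q^2 \<le> x" using that q2 by (simp add: mult_left_le)
    then have "x * q^2 \<le> B1 + B2 + D1 + D2 + 1/q" using that by simp
    then show ?thesis using q2 by (simp add: F_def le_divide_eq)
  qed
  have F: "F \<ge> 0" "B1 \<le> F" "B2 \<le> F" "D1 \<le> F" "D2 \<le> F" "1/q \<le> F" "B2 / q \<le> F" "D2 / q^2 \<le> F" "1/q/q^2 \<le> F"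
  proof -
    have "B2 / q = B2 * q / q^2" using q by (simp add: power2_eq_square)
    moreover have "B2 * q \<le> B2" using q B2 by (simp add: mult_left_le)
    ultimately have "B2 / q \<le> B2 / q^2" using q2 by (simp add: divide_right_mono)
    moreover have "B2 / q^2 \<le> F" unfolding F_def by (rule divide_right_mono) (use B1 B2 D1 D2 q2 in auto)
    moreover have "D2 / q^2 \<le> F" unfolding F_def by (rule divide_right_mono) (use B1 B2 D1 D2 q2 in auto)
    moreover have "1/q/q^2 \<le> F" unfolding F_def by (rule divide_right_mono) (use B1 B2 D1 D2 q2 in auto)
    ultimately show "B2 / q \<le> F" "D2 / q^2 \<le> F" "1/q/q^2 \<le> F" by auto
  qed (use sm B1 B2 D1 D2 q2 in \<open>auto intro!: sm\<close>)
  have dec: "q powr s \<le> q powr t" if "t \<le> s" for s t using that q by (intro powr_mono') auto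
  define G where "G = F * E / q"
  define C where "C = 12 * G"
  have FE: "F * E \<ge> 0" "G \<ge> F * E" "E / q * F = G" "G \<ge> E * F" "0 \<le> G"
  proof -
    show 1: "F * E \<ge> 0" using F E by simp
    have "F * E * q \<le> F * E" using 1 q by (simp add: mult_left_le)
    then show 2: "G \<ge> F * E" using q by (simp add: le_divide_eq G_def)
    then show "G \<ge> E * F" "0 \<le> G" using 1 by (simp_all add: mult.commute)
    show "E / q * F = G" by (simp add: G_def)
  qed
  have C0: "C \<ge> 0" using FE unfolding C_def by linarith
  show thesis
  proof (rule that[OF C0])
    fix \<sigma> \<tau> a b :: real assume s: "\<sigma> \<in> {-1,0,1::real}" and t: "\<tau> \<in> {-1,0,1::real}" and ab: "(a, b) \<in> V_basis K"
    define x y where "x = a + b" and "y = a - b"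
    note bd = V_basis_bounds[OF ab]
    have xy: "x \<ge> 0" "y \<ge> 0" "x + y = 2 * a" using bd by (auto simp: x_def y_def)
    define A B e1 e2 where "A = opcoef q K' g' \<tau> (a + \<sigma>) (b + mshift g)" and "B = opcoef q K g' \<tau> a b"
      and "e1 = Dcoef q K K' g \<sigma> a b" and "e2 = Dcoef q K K' g \<sigma> (a + \<tau>) (b - mshift g')"
    have ms: "mshift g \<in> {-1,0,1}" "mshift g' \<in> {-1,0,1}" using g g' by auto
    \<comment> \<open>At a missing intermediate label no bound on the second weight is available;
      there the first weight is zero.\<close>
    have e10: "e1 = 0" if "(a + \<sigma>, b + mshift g) \<notin> V_basis K'"
      using Dcoef_leave[OF ab g s that] by (simp add: e1_def)
    have B0: "B = 0" if "(a + \<tau>, b - mshift g') \<notin> V_basis K"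
      using opcoef_leave[OF ab g' t that] by (simp add: B_def)
    have e1b: "\<bar>e1\<bar> \<le> E" unfolding e1_def by (rule E(2)[OF s ab])
    have e2b: "\<bar>e2\<bar> \<le> E" if "(a + \<tau>, b - mshift g') \<in> V_basis K" unfolding e2_def by (rule E(2)[OF s that])
    have Bb: "\<bar>B\<bar> \<le> F" using B1(2)[OF t, of a "-b"] ab F(2) by (simp add: B_def opcoef_def fl)
    have Ab: "\<bar>A\<bar> \<le> F" if "(a + \<sigma>, b + mshift g) \<in> V_basis K'"
      using B2(2)[OF t, of "a + \<sigma>" "-(b + mshift g)"] that F(3) unfolding A_def opcoef_def fl by linarith
    have pm: "\<bar>u * v\<bar> \<le> U * V * q powr a" if "\<bar>u\<bar> \<le> U" "\<bar>v\<bar> \<le> V * q powr a" "0 \<le> U" for u v U V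
      using mult_mono[OF that(1,2)] that by (simp add: abs_mult mult_ac)
    have tri: "\<bar>A * e1 - e2 * B\<bar> \<le> C * q powr a" if "\<bar>A * e1\<bar> \<le> 6 * G * q powr a" "\<bar>e2 * B\<bar> \<le> 6 * G * q powr a"
    proof -
      have "\<bar>A * e1 - e2 * B\<bar> \<le> 12 * G * q powr a" using that by linarith
      also have "\<dots> \<le> C * q powr a" unfolding C_def using FE(5) by (intro mult_right_mono) auto
      finally show ?thesis .
    qed
    have up: "F * E * q powr a \<le> 6 * G * q powr a" using FE(2,5) by (intro mult_right_mono, linarith, simp)
    have mp: "q powr (x + y) = q powr x * q powr y" by (simp add: powr_add)
    have q2a: "q powr (2 * a) \<le> q powr a" "q powr (2*a) \<le> q powr y" using bd by (auto intro!: dec simp: y_def)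
    have "\<bar>A * e1 - e2 * B\<bar> \<le> C * q powr a"
    proof (cases "\<tau> = 0")
      case False
      then have t': "\<tau> \<in> {-1,1}" using t by auto
      show ?thesis
      proof (rule tri)
        show "\<bar>A * e1\<bar> \<le> 6 * G * q powr a"
        proof (cases "(a + \<sigma>, b + mshift g) \<in> V_basis K'")
          case True
          have "\<bar>A\<bar> \<le> B2 * q powr (a + \<sigma>)"
            using B2(3)[OF t', of "a + \<sigma>" "-(b + mshift g)"] True unfolding A_def opcoef_def fl by simp
          also have "\<dots> \<le> B2 * q powr (a - 1)" using s B2 by (intro mult_left_mono dec) auto
          also have "\<dots> = B2 / q * q powr a" using q by (simp add: powr_diff)
          also have "\<dots> \<le> F * q powr a" using F(7) by (intro mult_right_mono) auto
          finally have "\<bar>e1 * A\<bar> \<le> E * F * q powr a" using pm[OF e1b _ E(1)] by blast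
          then show ?thesis using up by (simp add: mult_ac)
        next
          case False
          then show ?thesis using e10 FE(5) by simp
        qed
        show "\<bar>e2 * B\<bar> \<le> 6 * G * q powr a"
        proof (cases "(a + \<tau>, b - mshift g') \<in> V_basis K")
          case True
          have "\<bar>B\<bar> \<le> B1 * q powr a"
            using B1(3)[OF t', of a "-b"] ab unfolding B_def opcoef_def fl by simp
          also have "\<dots> \<le> F * q powr a" using F(2) by (intro mult_right_mono) auto
          finally have "\<bar>e2 * B\<bar> \<le> E * F * q powr a" using pm[OF e2b[OF True] _ E(1)] by blast
          then show ?thesis using up by (simp add: mult_ac)
        next
          case False
          then show ?thesis using B0 FE(5) by simp
        qed
      qed
    next
      case t0: True
      show ?thesis
      proof (cases "\<sigma> = 0")
        case True
        show ?thesis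
        proof (rule tri)
          show "\<bar>A * e1\<bar> \<le> 6 * G * q powr a"
          proof (cases "(a + \<sigma>, b + mshift g) \<in> V_basis K'")
            case T: True
            have "\<bar>e1\<bar> \<le> E * q powr a" using E(3)[OF ab] True by (simp add: e1_def)
            from pm[OF Ab[OF T] this F(1)] show ?thesis using up by linarith
          next
            case False
            then show ?thesis using e10 FE(5) by simp
          qed
          show "\<bar>e2 * B\<bar> \<le> 6 * G * q powr a"
          proof (cases "(a + \<tau>, b - mshift g') \<in> V_basis K")
            case T: True
            have "\<bar>e2\<bar> \<le> E * q powr a" using E(3)[OF T] True t0 by (simp add: e2_def)
            from pm[OF Bb this F(1)] show ?thesis using up by (simp add: mult.commute)
          next
            case False
            then show ?thesis using B0 FE(5) by simp
          qed
        qed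
      next
        case False
        then have s': "\<sigma> \<in> {-1,1}" using s by auto
        have By: "\<bar>B - gamma q g' y\<bar> \<le> F * q powr (2*a)"
        proof -
          have "\<bar>B - gamma q g' y\<bar> \<le> D1 * q powr (2*a)"
            using D1(2)[of a "-b"] ab unfolding B_def opcoef_def fl y_def by (simp add: t0)
          also have "\<dots> \<le> F * q powr (2*a)" using F(4) by (intro mult_right_mono) auto
          finally show ?thesis .
        qed
        have Ay: "\<bar>A - gamma q g' (y + \<sigma> - mshift g)\<bar> \<le> F * q powr (2*a)" if T: "(a + \<sigma>, b + mshift g) \<in> V_basis K'"
        proof -
          have yy: "a + \<sigma> + - (b + mshift g) = y + \<sigma> - mshift g" by (simp add: y_def)
          have "(a + \<sigma>, - (b + mshift g)) \<in> V_basis (- K')" using T by (simp only: fl)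
          from D2(2)[OF this] have "\<bar>A - gamma q g' (y + \<sigma> - mshift g)\<bar> \<le> D2 * q powr (2*(a+\<sigma>))"
            unfolding A_def opcoef_def t0 yy .
          also have "\<dots> \<le> D2 * q powr (2*a-2)" using s D2 by (intro mult_left_mono dec) auto
          also have "\<dots> = D2 / q^2 * q powr (2*a)" using q by (simp add: powr_diff powr_numeral)
          also have "\<dots> \<le> F * q powr (2*a)" using F(8) by (intro mult_right_mono) auto
          finally show ?thesis .
        qed
        have gy: "\<bar>gamma q g' y\<bar> \<le> F * q powr y"
        proof -
          have "\<bar>gamma q g' y\<bar> \<le> (1/q) * q powr y" by (rule gamma_bound[OF q xy(2)])
          also have "\<dots> \<le> F * q powr y" using F(6) by (intro mult_right_mono) auto
          finally show ?thesis .
        qed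
        have By2: "\<bar>B\<bar> \<le> 2 * F * q powr y"
        proof -
          have "F * q powr (2*a) \<le> F * q powr y" using q2a F by (intro mult_left_mono) auto
          then show ?thesis using By gy by linarith
        qed
        have prod: "\<bar>u * v\<bar> \<le> 2 * U * V * q powr a" if "\<bar>u\<bar> \<le> U * q powr x" "\<bar>v\<bar> \<le> 2 * V * q powr y" "0 \<le> U" "0 \<le> V" for u v U V
        proof -
          have "\<bar>u * v\<bar> \<le> (U * q powr x) * (2 * V * q powr y)" unfolding abs_mult using that by (intro mult_mono) auto
          also have "\<dots> = 2 * U * V * q powr (2*a)" unfolding xy(3)[symmetric] mp by simp
          also have "\<dots> \<le> 2 * U * V * q powr a" using that q2a by (intro mult_left_mono) auto
          finally show ?thesis .
        qed
        have xs: "E * q powr (a + (b - mshift g')) \<le> E / q * q powr x"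
        proof -
          have "E * q powr (a + (b - mshift g')) \<le> E * q powr (x - 1)" using ms E by (intro mult_left_mono dec) (auto simp: x_def)
          then show ?thesis using q by (simp add: powr_diff)
        qed
        have e1e: "\<bar>e1 - \<eta> \<sigma> a\<bar> \<le> E * q powr x" unfolding e1_def x_def by (rule E(4)[OF s' ab])
        have e2e: "\<bar>e2 - \<eta> \<sigma> a\<bar> \<le> E / q * q powr x" if T: "(a + \<tau>, b - mshift g') \<in> V_basis K"
          using E(4)[OF s' T] xs by (simp add: e2_def t0)
        have Eq: "E \<le> E / q" "0 \<le> E / q"
        proof -
          have "E * q \<le> E" using E q by (simp add: mult_left_le)
          then show "E \<le> E / q" using q by (simp add: le_divide_eq)
        qed (use E q in auto)
        have Ex: "E * q powr x \<le> E / q * q powr x" using Eq by (intro mult_right_mono) auto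
        show ?thesis
        proof (cases "\<sigma> = mshift g")
          case False
          then have eta: "\<eta> \<sigma> a = 0" using E(5)[OF s'] by simp
          show ?thesis
          proof (rule tri)
            show "\<bar>A * e1\<bar> \<le> 6 * G * q powr a"
            proof (cases "(a + \<sigma>, b + mshift g) \<in> V_basis K'")
              case T: True
              have y0: "y + \<sigma> - mshift g \<ge> 0" using V_basis_bounds[OF T] by (simp add: y_def)
              have "\<bar>gamma q g' (y + \<sigma> - mshift g)\<bar> \<le> (1/q) * q powr (y + \<sigma> - mshift g)" by (rule gamma_bound[OF q y0])
              also have "\<dots> \<le> (1/q) * q powr (y - 2)" using s ms q by (intro mult_left_mono dec) auto
              also have "\<dots> = 1/q/q^2 * q powr y" using q by (simp add: powr_diff powr_numeral)
              also have "\<dots> \<le> F * q powr y" using F(9) by (intro mult_right_mono) auto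
              finally have "\<bar>gamma q g' (y + \<sigma> - mshift g)\<bar> \<le> F * q powr y" .
              moreover have "F * q powr (2*a) \<le> F * q powr y" using q2a F by (intro mult_left_mono) auto
              ultimately have "\<bar>A\<bar> \<le> 2 * F * q powr y" using Ay[OF T] by linarith
              moreover have "\<bar>e1\<bar> \<le> E / q * q powr x" using e1e Ex eta by simp
              ultimately have "\<bar>e1 * A\<bar> \<le> 2 * (E / q) * F * q powr a" using prod Eq F by blast
              also have "2 * (E / q) * F * q powr a = 2 * G * q powr a" unfolding FE(3)[symmetric] by simp
              also have "\<dots> \<le> 6 * G * q powr a" using FE(5) by (intro mult_right_mono) auto
              finally show ?thesis by (simp add: mult.commute)
            next
              case False
              then show ?thesis using e10 FE(5) by simp
            qed
            show "\<bar>e2 * B\<bar> \<le> 6 * G * q powr a"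
            proof (cases "(a + \<tau>, b - mshift g') \<in> V_basis K")
              case T: True
              have "\<bar>e2\<bar> \<le> E / q * q powr x" using e2e[OF T] eta by simp
              from prod[OF this By2 Eq(2) F(1)] have "\<bar>e2 * B\<bar> \<le> 2 * (E / q) * F * q powr a" .
              also have "2 * (E / q) * F * q powr a = 2 * G * q powr a" unfolding FE(3)[symmetric] by simp
              also have "\<dots> \<le> 6 * G * q powr a" using FE(5) by (intro mult_right_mono) auto
              finally show ?thesis .
            next
              case False
              then show ?thesis using B0 FE(5) by simp
            qed
          qed
        next
          case sk: True
          have t1: "\<bar>(A - B) * e1\<bar> \<le> 2 * G * q powr a"
          proof (cases "(a + \<sigma>, b + mshift g) \<in> V_basis K'")
            case T: True
            have "\<bar>A - B\<bar> \<le> 2 * F * q powr (2*a)" using Ay[OF T] By by (simp add: sk)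
            also have "\<dots> \<le> 2 * F * q powr a" using F q2a by (intro mult_left_mono) auto
            finally have "\<bar>e1 * (A - B)\<bar> \<le> E * (2 * F) * q powr a" using pm[OF e1b _ E(1)] by blast
            also have "\<dots> \<le> 2 * G * q powr a" using FE(4) by (intro mult_right_mono) auto
            finally show ?thesis by (simp add: mult.commute)
          next
            case False
            then show ?thesis using e10 FE(5) by simp
          qed
          have t2: "\<bar>(e1 - e2) * B\<bar> \<le> 4 * G * q powr a"
          proof (cases "(a + \<tau>, b - mshift g') \<in> V_basis K")
            case T: True
            have "\<bar>e1 - e2\<bar> \<le> 2 * (E / q) * q powr x" using e1e e2e[OF T] Ex by linarith
            have "0 \<le> 2 * (E / q)" using Eq by simp
            from prod[OF \<open>\<bar>e1 - e2\<bar> \<le> 2 * (E / q) * q powr x\<close> By2 this F(1)]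
            have "\<bar>(e1 - e2) * B\<bar> \<le> 2 * (2 * (E / q)) * F * q powr a" .
            also have "2 * (2 * (E / q)) * F * q powr a = 4 * G * q powr a" unfolding FE(3)[symmetric] by simp
            finally show ?thesis .
          next
            case False
            then show ?thesis using B0 FE(5) by simp
          qed
          have "A * e1 - e2 * B = (A - B) * e1 + (e1 - e2) * B" by (simp add: algebra_simps)
          then have "\<bar>A * e1 - e2 * B\<bar> \<le> 6 * G * q powr a" using t1 t2 by linarith
          also have "\<dots> \<le> C * q powr a" unfolding C_def using FE(5) by (intro mult_right_mono) auto
          finally show ?thesis .
        qed
      qed
    qed
    then show "\<bar>opcoef q K' g' \<tau> (a + \<sigma>) (b + mshift g) * Dcoef q K K' g \<sigma> a b
       - Dcoef q K K' g \<sigma> (a + \<tau>) (b - mshift g') * opcoef q K g' \<tau> a b\<bar> \<le> C * q powr a"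
      unfolding A_def B_def e1_def e2_def .
  qed
qed

end

section \<open>The representations as three-term operators\<close>

text \<open>\<open>c \<sigma> a b\<close> is the weight of the step that leaves
  \<open>(a, b)\<close>. Only the target is cut off by \<open>V\<close>; the source may belong to
  another label set, as it does for the blocks of the commutator with \<open>D\<close>.\<close>

definition tri :: "(real \<times> real) set \<Rightarrow> real \<Rightarrow> (real \<Rightarrow> real \<Rightarrow> real \<Rightarrow> real) \<Rightarrow> (real \<times> real) cop" where
  "tri V k c f = (\<lambda>(l, m). if (l, m) \<in> V
     then \<Sum>\<sigma>\<in>{-1,0,1}. complex_of_real (c \<sigma> (l - \<sigma>) (m - k)) * f (l - \<sigma>, m - k) else 0)"

lemma tri_wshift:
  "tri V k c f = (\<lambda>y. \<Sum>\<sigma>\<in>{-1,0,1}. wshift V (\<lambda>(l, m). complex_of_real (c \<sigma> (l - \<sigma>) (m - k))) (\<lambda>(l, m). (l - \<sigma>, m - k)) f y)"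
  by (auto simp: tri_def wshift_def fun_eq_iff)

lemma bounded_op_tri:
  assumes "\<And>\<sigma> a b. \<sigma> \<in> {-1,0,1} \<Longrightarrow> (a, b) \<in> V \<Longrightarrow> \<bar>c \<sigma> a b\<bar> \<le> C"
  shows "bounded_op V (tri V k c)"
proof -
  have "bounded_op V (\<lambda>f y. \<Sum>\<sigma>\<in>{-1,0,1}. wshift V (\<lambda>(l, m). complex_of_real (c \<sigma> (l - \<sigma>) (m - k))) (\<lambda>(l, m). (l - \<sigma>, m - k)) f y)"
  proof (rule bounded_op_sum)
    fix \<sigma> :: real assume s: "\<sigma> \<in> {-1,0,1}"
    show "bounded_op V (wshift V (\<lambda>(l, m). complex_of_real (c \<sigma> (l - \<sigma>) (m - k))) (\<lambda>(l, m). (l - \<sigma>, m - k)))"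
      by (rule bounded_op_wshift[where C = C]) (auto simp: inj_on_def intro!: assms[OF s])
  qed simp
  then show ?thesis unfolding tri_wshift[abs_def] .
qed

lemma tri_scale: "tri V k c (\<lambda>p. z * f p) = (\<lambda>y. z * tri V k c f y)"
  by (auto simp: tri_def fun_eq_iff algebra_simps)

lemma tri_outside: "y \<notin> V \<Longrightarrow> tri V k c f y = 0"
  by (cases y) (simp add: tri_def)

text \<open>Support without summability: the identities between coefficients are pointwise and hold
  for all such functions.\<close>

definition off :: "'x set \<Rightarrow> 'x cvec \<Rightarrow> bool" where
  "off V f \<longleftrightarrow> (\<forall>x. x \<notin> V \<longrightarrow> f x = 0)"

lemma off_ell2: "f \<in> ell2 V \<Longrightarrow> off V f"
  by (simp add: off_def ell2_def)

lemma off_tri: "off V (tri V k c f)"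
  by (simp add: off_def tri_outside)

text \<open>A path that leaves the set of labels has coefficient zero, so that truncations can be ignored.\<close>

definition leaves :: "(real \<times> real) set \<Rightarrow> (real \<times> real) set \<Rightarrow> real \<Rightarrow> (real \<Rightarrow> real \<Rightarrow> real \<Rightarrow> real) \<Rightarrow> bool" where
  "leaves V V' k c \<longleftrightarrow> (\<forall>\<sigma>\<in>{-1,0,1}. \<forall>a b. (a, b) \<in> V \<longrightarrow> (a + \<sigma>, b + k) \<notin> V' \<longrightarrow> c \<sigma> a b = 0)"

lemma tri_tri:
  assumes f: "off V f"
    and leave: "leaves V V' k c"
    and lm: "(l, m) \<in> V''"
  shows "tri V'' k' c' (tri V' k c f) (l, m) =
    (\<Sum>\<tau>\<in>{-1,0,1}. \<Sum>\<sigma>\<in>{-1,0,1}. complex_of_real (c' \<tau> (l - \<tau>) (m - k') * c \<sigma> (l - \<tau> - \<sigma>) (m - k' - k))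
        * f (l - \<tau> - \<sigma>, m - k' - k))"
proof -
  have "tri V' k c f (a, b) = (\<Sum>\<sigma>\<in>{-1,0,1}. complex_of_real (c \<sigma> (a - \<sigma>) (b - k)) * f (a - \<sigma>, b - k))" for a b
  proof (cases "(a, b) \<in> V'")
    case False
    have "complex_of_real (c \<sigma> (a - \<sigma>) (b - k)) * f (a - \<sigma>, b - k) = 0" if "\<sigma> \<in> {-1,0,1}" for \<sigma>
      using leave f that False unfolding leaves_def off_def by (cases "(a - \<sigma>, b - k) \<in> V") force+
    then have "(\<Sum>\<sigma>\<in>{-1,0,1}. complex_of_real (c \<sigma> (a - \<sigma>) (b - k)) * f (a - \<sigma>, b - k)) = 0"
      by (rule sum.neutral[OF ballI])
    then show ?thesis using False by (simp only: tri_def split) simp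
  qed (simp add: tri_def)
  note i = this
  have "tri V'' k' c' (tri V' k c f) (l, m) = (\<Sum>\<tau>\<in>{-1,0,1}. complex_of_real (c' \<tau> (l - \<tau>) (m - k')) * tri V' k c f (l - \<tau>, m - k'))"
    using lm by (simp add: tri_def[of V''])
  then show ?thesis unfolding i sum_distrib_left by (simp only: of_real_mult mult.assoc)
qed

text \<open>Regroups the nine paths by total shift of \<open>l\<close>: \<open>p\<close> and
  \<open>q\<close> for 2 and -2, \<open>x\<close> for 1, \<open>y\<close> for -1, \<open>z\<close>
  for 0.\<close>

lemma rearrange:
  fixes x1 :: complex
  assumes "p = u" "q = v" "x1 + x2 = x3 + x4" "y1 + y2 = y3 + y4" "z1 + z2 + z3 = z4 + z5 + z6"
  shows "q + y1 + z1 + y2 + z2 + x2 + z3 + x1 + p = v + y4 + z4 + y3 + z5 + x3 + z6 + x4 + u"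
proof -
  have "q + y1 + z1 + y2 + z2 + x2 + z3 + x1 + p = q + p + (x1 + x2) + (y1 + y2) + (z1 + z2 + z3)" by simp
  also have "\<dots> = v + y4 + z4 + y3 + z5 + x3 + z6 + x4 + u" unfolding assms by simp
  finally show ?thesis .
qed

text \<open>The hypotheses are sorted like \<open>coef_comm\<close>. Paths into a given label with
  the same total shift start at the same label, so the coordinates of \<open>f\<close> are compared
  one at a time.\<close>

lemma tri_commute:
  assumes f: "off V f"
    and leave: "leaves V V k c"
    and leave': "leaves V V k' c'"
    and h2: "\<And>a b. (a, b) \<in> V \<Longrightarrow> c' 1 (a+1) (b+k) * c 1 a b = c 1 (a+1) (b+k') * c' 1 a b"
    and hm2: "\<And>a b. (a, b) \<in> V \<Longrightarrow> c' (-1) (a-1) (b+k) * c (-1) a b = c (-1) (a-1) (b+k') * c' (-1) a b"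
    and h1: "\<And>a b. (a, b) \<in> V \<Longrightarrow> c' 1 a (b+k) * c 0 a b + c' 0 (a+1) (b+k) * c 1 a b
       = c 0 (a+1) (b+k') * c' 1 a b + c 1 a (b+k') * c' 0 a b"
    and hm1: "\<And>a b. (a, b) \<in> V \<Longrightarrow> c' (-1) a (b+k) * c 0 a b + c' 0 (a-1) (b+k) * c (-1) a b
       = c 0 (a-1) (b+k') * c' (-1) a b + c (-1) a (b+k') * c' 0 a b"
    and h0: "\<And>a b. (a, b) \<in> V \<Longrightarrow> c' (-1) (a+1) (b+k) * c 1 a b + c' 0 a (b+k) * c 0 a b + c' 1 (a-1) (b+k) * c (-1) a b
       = c (-1) (a+1) (b+k') * c' 1 a b + c 0 a (b+k') * c' 0 a b + c 1 (a-1) (b+k') * c' (-1) a b"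
  shows "tri V k' c' (tri V k c f) = tri V k c (tri V k' c' f)"
proof
  fix y :: "real \<times> real"
  obtain l m where y: "y = (l, m)" by (cases y)
  show "tri V k' c' (tri V k c f) y = tri V k c (tri V k' c' f) y"
  proof (cases "(l, m) \<in> V")
    case False
    then show ?thesis by (simp add: y tri_outside)
  next
    case True
    define b where "b = m - k' - k"
    have b: "m - k' = b + k" "m - k = b + k'" "m - k' - k = b" "m - k - k' = b" "b + k - k = b" "b + k' - k' = b" by (simp_all add: b_def)
    have ident: "complex_of_real u * f (a, b) = complex_of_real v * f (a, b)" if "(a, b) \<in> V \<Longrightarrow> u = v" for a u v
      using that f by (cases "(a, b) \<in> V") (auto simp: off_def)
    have i: "complex_of_real (c' 1 (l-2+1) (b+k) * c 1 (l-2) b) * f (l-2, b) = complex_of_real (c 1 (l-2+1) (b+k') * c' 1 (l-2) b) * f (l-2, b)"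
      "complex_of_real (c' (-1) (l+2-1) (b+k) * c (-1) (l+2) b) * f (l+2, b) = complex_of_real (c (-1) (l+2-1) (b+k') * c' (-1) (l+2) b) * f (l+2, b)"
      "complex_of_real (c' 1 (l-1) (b+k) * c 0 (l-1) b + c' 0 (l-1+1) (b+k) * c 1 (l-1) b) * f (l-1, b)
       = complex_of_real (c 0 (l-1+1) (b+k') * c' 1 (l-1) b + c 1 (l-1) (b+k') * c' 0 (l-1) b) * f (l-1, b)"
      "complex_of_real (c' (-1) (l+1) (b+k) * c 0 (l+1) b + c' 0 (l+1-1) (b+k) * c (-1) (l+1) b) * f (l+1, b)
       = complex_of_real (c 0 (l+1-1) (b+k') * c' (-1) (l+1) b + c (-1) (l+1) (b+k') * c' 0 (l+1) b) * f (l+1, b)"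
      "complex_of_real (c' (-1) (l+1) (b+k) * c 1 l b + c' 0 l (b+k) * c 0 l b + c' 1 (l-1) (b+k) * c (-1) l b) * f (l, b)
       = complex_of_real (c (-1) (l+1) (b+k') * c' 1 l b + c 0 l (b+k') * c' 0 l b + c 1 (l-1) (b+k') * c' (-1) l b) * f (l, b)"
      by (rule ident, erule h2 hm2 h1 hm1 h0)+
    have e: "l - 2 + 1 = l - 1" "l - 1 - 1 = l - 2" "l - 1 + 1 = l" "l + 1 + 1 = l + 2" "l + 2 - 1 = l + 1" "l + 1 - 1 = l" by simp_all
    have sum3: "(\<Sum>\<tau>\<in>{-1,0,1}. h \<tau>) = h (-1) + h 0 + h 1" for h :: "real \<Rightarrow> complex" by simp
    have e': "l - -1 = l + 1" "l - 0 = l" "l + 1 - -1 = l + 2" "l + 1 - 0 = l + 1" "l - 1 - 0 = l - 1" "l - 1 - -1 = l" by simp_all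
    have "tri V k' c' (tri V k c f) (l, m) = complex_of_real (c' (-1) (l + 1) (b+k) * c (-1) (l + 2) b) * f (l + 2, b) + complex_of_real (c' (-1) (l + 1) (b+k) * c 0 (l + 1) b) * f (l + 1, b) + complex_of_real (c' (-1) (l + 1) (b+k) * c 1 (l) b) * f (l, b) + complex_of_real (c' 0 (l) (b+k) * c (-1) (l + 1) b) * f (l + 1, b) + complex_of_real (c' 0 (l) (b+k) * c 0 (l) b) * f (l, b) + complex_of_real (c' 0 (l) (b+k) * c 1 (l - 1) b) * f (l - 1, b) + complex_of_real (c' 1 (l - 1) (b+k) * c (-1) (l) b) * f (l, b) + complex_of_real (c' 1 (l - 1) (b+k) * c 0 (l - 1) b) * f (l - 1, b) + complex_of_real (c' 1 (l - 1) (b+k) * c 1 (l - 2) b) * f (l - 2, b)"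
      unfolding tri_tri[OF f leave True] b sum3 e e' by (simp only: add.assoc)
    also have "\<dots> = complex_of_real (c (-1) (l + 1) (b+k') * c' (-1) (l + 2) b) * f (l + 2, b) + complex_of_real (c (-1) (l + 1) (b+k') * c' 0 (l + 1) b) * f (l + 1, b) + complex_of_real (c (-1) (l + 1) (b+k') * c' 1 (l) b) * f (l, b) + complex_of_real (c 0 (l) (b+k') * c' (-1) (l + 1) b) * f (l + 1, b) + complex_of_real (c 0 (l) (b+k') * c' 0 (l) b) * f (l, b) + complex_of_real (c 0 (l) (b+k') * c' 1 (l - 1) b) * f (l - 1, b) + complex_of_real (c 1 (l - 1) (b+k') * c' (-1) (l) b) * f (l, b) + complex_of_real (c 1 (l - 1) (b+k') * c' 0 (l - 1) b) * f (l - 1, b) + complex_of_real (c 1 (l - 1) (b+k') * c' 1 (l - 2) b) * f (l - 2, b)"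
      using i unfolding e of_real_add ring_distribs by (rule rearrange)
    also have "\<dots> = tri V k c (tri V k' c' f) (l, m)"
      unfolding tri_tri[OF f leave' True] b sum3 e e' by (simp only: add.assoc)
    finally show ?thesis unfolding y .
  qed
qed

definition gket :: "real \<Rightarrow> real \<Rightarrow> podles_expr \<Rightarrow> real \<times> real \<Rightarrow> (real \<times> real) cvec" where
  "gket q N g = (if g = Gen_B then piB_ket q N else if g = Gen_Bstar then piBstar_ket q N else piA_ket q N)"

lemma sum3: "(\<Sum>\<tau>\<in>{-1,0,1::real}. h \<tau>) = h (-1) + h 0 + (h 1 :: complex)"
  by simp

lemma gket_coef:
  assumes "g \<in> gens"
  shows "gket q N g (a, b) y = (\<Sum>\<sigma>\<in>{-1,0,1}. complex_of_real (coef q N g \<sigma> a b) * ket (a + \<sigma>, b + mshift g) y)"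
proof -
  have r: "u + v + w = w + v + u" for u v w :: complex by simp
  have c: "(-1 = (1::real)) = False" "(-1 = (0::real)) = False" "(0 = (1::real)) = False" "((1::real) = 1) = True" "((0::real) = 0) = True"
    by simp_all
  have gk: "gket q N Gen_B = piB_ket q N" "gket q N Gen_Bstar = piBstar_ket q N" "gket q N Gen_A = piA_ket q N"
    by (simp_all add: gket_def)
  have g1: "gket q N Gen_B (a, b) y = (\<Sum>\<sigma>\<in>{-1,0,1}. complex_of_real (coef q N Gen_B \<sigma> a b) * ket (a + \<sigma>, b + mshift Gen_B) y)"
    unfolding gk piB_ket.simps sum3 coef.simps mshift.simps c if_True if_False add_uminus_conv_diff add_0_right by (rule r)
  have g2: "gket q N Gen_Bstar (a, b) y = (\<Sum>\<sigma>\<in>{-1,0,1}. complex_of_real (coef q N Gen_Bstar \<sigma> a b) * ket (a + \<sigma>, b + mshift Gen_Bstar) y)"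
    unfolding gk piBstar_ket.simps sum3 coef.simps mshift.simps c if_True if_False add_uminus_conv_diff add_0_right by (rule r)
  have g3: "gket q N Gen_A (a, b) y = (\<Sum>\<sigma>\<in>{-1,0,1}. complex_of_real (coef q N Gen_A \<sigma> a b) * ket (a + \<sigma>, b + mshift Gen_A) y)"
    unfolding gk piA_ket.simps sum3 coef.simps mshift.simps c if_True if_False add_uminus_conv_diff add_0_right by (rule r)
  consider "g = Gen_B" | "g = Gen_Bstar" | "g = Gen_A" using assms by auto
  then show ?thesis
  proof cases
    case 1 show ?thesis unfolding 1 by (rule g1)
  next
    case 2 show ?thesis unfolding 2 by (rule g2)
  next
    case 3 show ?thesis unfolding 3 by (rule g3)
  qed
qed

lemma mat_op_finite:
  assumes "finite S" "\<And>x. x \<in> X \<Longrightarrow> x \<notin> S \<Longrightarrow> f x * c x y = 0" "\<And>x. x \<in> S \<Longrightarrow> x \<notin> X \<Longrightarrow> f x * c x y = 0"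
  shows "mat_op X c f y = (if y \<in> X then \<Sum>x\<in>S. f x * c x y else 0)"
proof -
  have "infsum (\<lambda>x. f x * c x y) X = infsum (\<lambda>x. f x * c x y) S"
    by (rule infsum_cong_neutral) (use assms in auto)
  then show ?thesis using assms(1) by (simp add: mat_op_def)
qed

text \<open>From images of basis vectors to coordinates: only three sources can reach a label, so
  the infinite sum in \<open>mat_op\<close> has at most three terms.\<close>

lemma expr_op_gen:
  assumes g: "g \<in> gens" and f: "off (V_basis N) f"
  shows "expr_op q N g f = tri (V_basis N) (mshift g) (coef q N g) f"
proof
  fix y :: "real \<times> real"
  obtain l m where y: "y = (l, m)" by (cases y)
  define p where "p \<sigma> = (l - \<sigma>, m - mshift g)" for \<sigma>
  have e: "expr_op q N g = mat_op (V_basis N) (gket q N g)" using g by (auto simp: gket_def)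
  have k: "gket q N g (p \<sigma>) y = complex_of_real (coef q N g \<sigma> (l - \<sigma>) (m - mshift g))" if "\<sigma> \<in> {-1,0,1}" for \<sigma>
  proof -
    have "gket q N g (l - \<sigma>, m - mshift g) (l, m) = (\<Sum>\<tau>\<in>{-1,0,1}. if \<tau> = \<sigma> then complex_of_real (coef q N g \<tau> (l - \<sigma>) (m - mshift g)) else 0)"
      unfolding gket_coef[OF g] ket_def by (rule sum.cong) auto
    then show ?thesis using that unfolding p_def y by (subst (asm) sum.delta) simp_all
  qed
  have z: "gket q N g x y = 0" if "x \<notin> p ` {-1,0,1}" for x
  proof -
    obtain a b where x: "x = (a, b)" by (cases x)
    have ne: "(l, m) \<noteq> (a + \<sigma>, b + mshift g)" if "\<sigma> \<in> {-1,0,1}" for \<sigma>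
    proof
      assume "(l, m) = (a + \<sigma>, b + mshift g)"
      then have "x = p \<sigma>" by (simp add: x p_def)
      then show False using \<open>x \<notin> p ` {-1,0,1}\<close> that by blast
    qed
    show ?thesis unfolding x gket_coef[OF g] y ket_def
      by (rule sum.neutral, rule ballI) (simp only: ne if_False mult_zero_right)
  qed
  have inj: "inj_on p {-1,0,1}" by (auto simp: inj_on_def p_def)
  have "mat_op (V_basis N) (gket q N g) f y = (if y \<in> V_basis N then \<Sum>x\<in>p ` {-1,0,1}. f x * gket q N g x y else 0)"
  proof (rule mat_op_finite)
    fix x
    show "x \<notin> p ` {-1,0,1} \<Longrightarrow> f x * gket q N g x y = 0" by (simp only: z mult_zero_right not_False_eq_True)
    show "f x * gket q N g x y = 0" if "x \<notin> V_basis N"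
    proof -
      have "f x = 0" using f that unfolding off_def by blast
      then show ?thesis by simp
    qed
  qed simp
  also have "(\<Sum>x\<in>p ` {-1,0,1}. f x * gket q N g x y) = (\<Sum>\<sigma>\<in>{-1,0,1}. f (p \<sigma>) * gket q N g (p \<sigma>) y)"
    unfolding sum.reindex[OF inj] by (simp only: o_def)
  also have "\<dots> = (\<Sum>\<sigma>\<in>{-1,0,1}. complex_of_real (coef q N g \<sigma> (l - \<sigma>) (m - mshift g)) * f (l - \<sigma>, m - mshift g))"
    by (rule sum.cong) (simp_all only: k p_def[symmetric] mult.commute)
  finally show "expr_op q N g f y = tri (V_basis N) (mshift g) (coef q N g) f y"
    unfolding e y tri_def split .
qed

section \<open>The opposite representation\<close>

definition flip :: "(real \<times> real) cvec \<Rightarrow> (real \<times> real) cvec" where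
  "flip f = (\<lambda>(l, m). cnj (f (l, - m)))"

lemma flip_flip [simp]: "flip (flip f) = f"
  by (auto simp: flip_def)

lemma flip_add: "flip (\<lambda>x. f x + g x) = (\<lambda>x. flip f x + flip g x)"
  by (auto simp: flip_def)

lemma flip_scale: "flip (\<lambda>x. c * f x) = (\<lambda>x. cnj c * flip f x)"
  by (auto simp: flip_def)

lemma V_basis_neg: "(l, - m) \<in> V_basis N \<longleftrightarrow> (l, m) \<in> V_basis N"
  by (auto simp: V_basis_def)

lemma off_flip: "off (V_basis N) f \<Longrightarrow> off (V_basis N) (flip f)"
  by (auto simp: off_def flip_def V_basis_neg)

text \<open>The block \<open>J \<pi>\<^bsub>-N\<^esub>(s) J\<inverse>\<close> of the opposite representation.\<close>

definition opp1 :: "real \<Rightarrow> real \<Rightarrow> podles_expr \<Rightarrow> (real \<times> real) cop" where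
  "opp1 q N s f = flip (expr_op q (- N) s (flip f))"

lemma opp1_simps:
  "opp1 q N (Scal c) f = (\<lambda>x. cnj c * f x)"
  "opp1 q N (Add s t) f = (\<lambda>x. opp1 q N s f x + opp1 q N t f x)"
  "opp1 q N (Mult s t) f = opp1 q N s (opp1 q N t f)"
  by (simp_all add: opp1_def flip_scale flip_add)

lemma opp1_gen:
  assumes g: "g \<in> gens" and f: "off (V_basis N) f"
  shows "opp1 q N g f = tri (V_basis N) (- mshift g) (opcoef q N g) f"
proof
  fix y :: "real \<times> real"
  obtain l m where y: "y = (l, m)" by (cases y)
  have ff: "off (V_basis (- N)) (flip f)"
    using off_flip[OF f] by (simp add: V_basis_minus)
  define w where "w = m + mshift g"
  have e: "- m - mshift g = - w" "m - - mshift g = w" by (simp_all add: w_def)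
  have o: "opp1 q N g f = flip (tri (V_basis (- N)) (mshift g) (coef q (- N) g) (flip f))"
    unfolding opp1_def expr_op_gen[OF g ff] ..
  show "opp1 q N g f y = tri (V_basis N) (- mshift g) (opcoef q N g) f y"
    unfolding o y flip_def tri_def split opcoef_def V_basis_neg V_basis_minus e minus_minus
    by simp
qed

lemma expr_induct:
  assumes "\<And>g. g \<in> gens \<Longrightarrow> P g" "\<And>c. P (Scal c)" "\<And>s t. P s \<Longrightarrow> P t \<Longrightarrow> P (Add s t)"
    "\<And>s t. P s \<Longrightarrow> P t \<Longrightarrow> P (Mult s t)"
  shows "P s"
  by (induction s) (use assms in auto)

lemma bounded_op_expr:
  assumes q: "0 < q" "q < 1" and N: "2 * N \<in> \<int>"
  shows "bounded_op (V_basis N) (expr_op q N s)"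
proof (induction s rule: expr_induct)
  case (1 g)
  obtain C where C: "\<And>\<sigma> l m. \<sigma> \<in> {-1,0,1} \<Longrightarrow> (l, m) \<in> V_basis N \<Longrightarrow> \<bar>coef q N g \<sigma> l m\<bar> \<le> C"
    by (rule coef_bounds[OF q N 1]) (rule that; assumption)
  have "bounded_op (V_basis N) (tri (V_basis N) (mshift g) (coef q N g))" by (rule bounded_op_tri[OF C])
  then show ?case by (rule bounded_op_cong) (rule expr_op_gen[OF 1 off_ell2])
next
  case (2 c)
  show ?case by (simp add: bounded_op_scalar)
next
  case (3 s t)
  then show ?case by (simp add: bounded_op_add)
next
  case (4 s t)
  then show ?case by (simp add: bounded_op_comp)
qed

lemma bounded_op_opp1:
  assumes q: "0 < q" "q < 1" and N: "2 * N \<in> \<int>"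
  shows "bounded_op (V_basis N) (opp1 q N s)"
proof (induction s rule: expr_induct)
  case (1 g)
  have N': "2 * (- N) \<in> \<int>" using N by simp
  obtain C where C: "\<And>\<sigma> l m. \<sigma> \<in> {-1,0,1} \<Longrightarrow> (l, m) \<in> V_basis (- N) \<Longrightarrow> \<bar>coef q (- N) g \<sigma> l m\<bar> \<le> C"
    by (rule coef_bounds[OF q N' 1]) (rule that; assumption)
  have "bounded_op (V_basis N) (tri (V_basis N) (- mshift g) (opcoef q N g))"
    by (rule bounded_op_tri[where C = C]) (simp only: opcoef_def, rule C, simp_all add: V_basis_neg V_basis_minus)
  then show ?case by (rule bounded_op_cong) (rule opp1_gen[OF 1 off_ell2])
next
  case (2 c)
  have "opp1 q N (Scal c) = (\<lambda>f x. cnj c * f x)" by (simp add: opp1_simps fun_eq_iff)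
  then show ?case by (simp add: bounded_op_scalar)
next
  case (3 s t)
  have "opp1 q N (Add s t) = (\<lambda>f x. opp1 q N s f x + opp1 q N t f x)" by (simp add: opp1_simps fun_eq_iff)
  then show ?case using 3 by (simp add: bounded_op_add)
next
  case (4 s t)
  have "opp1 q N (Mult s t) = (\<lambda>f. opp1 q N s (opp1 q N t f))" by (simp add: opp1_simps fun_eq_iff)
  then show ?case using 4 by (simp add: bounded_op_comp)
qed

lemma opp1_expr_commute_gen:
  assumes q: "0 < q" "q < 1" and N: "2 * N \<in> \<int>" and g: "g \<in> gens" "g' \<in> gens" and f: "f \<in> ell2 (V_basis N)"
  shows "opp1 q N g' (expr_op q N g f) = expr_op q N g (opp1 q N g' f)"
proof -
  note f0 = off_ell2[OF f]
  have l1: "leaves (V_basis N) (V_basis N) (mshift g) (coef q N g)"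
    unfolding leaves_def by (intro ballI allI impI) (rule coef_leave[OF _ g(1)]; assumption)
  have l2: "leaves (V_basis N) (V_basis N) (- mshift g') (opcoef q N g')"
    unfolding leaves_def add_uminus_conv_diff by (intro ballI allI impI) (rule opcoef_leave[OF _ g(2)]; assumption)
  have "tri (V_basis N) (- mshift g') (opcoef q N g') (tri (V_basis N) (mshift g) (coef q N g) f)
    = tri (V_basis N) (mshift g) (coef q N g) (tri (V_basis N) (- mshift g') (opcoef q N g') f)"
    apply (rule tri_commute[OF f0 l1 l2]; unfold opcoef_def add_uminus_conv_diff)
        apply (rule coef_comm(1)[OF q g N], assumption)
       apply (rule coef_comm(2)[OF q g N], assumption)
      apply (rule coef_comm(3)[OF q g N], assumption)
     apply (rule coef_comm(4)[OF q g N], assumption)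
    apply (rule coef_comm(5)[OF q g N], assumption)
    done
  then show ?thesis
    by (simp only: expr_op_gen[OF g(1) f0] opp1_gen[OF g(2) f0] expr_op_gen[OF g(1) off_tri] opp1_gen[OF g(2) off_tri])
qed

text \<open>Commutation passes to sums and products in either argument; \<open>gen\<close> treats
  the opposite element against a fixed generator first.\<close>

lemma opp1_expr_commute:
  assumes q: "0 < q" "q < 1" and N: "2 * N \<in> \<int>" and f: "f \<in> ell2 (V_basis N)"
  shows "opp1 q N s (expr_op q N t f) = expr_op q N t (opp1 q N s f)"
proof -
  note be = bounded_op_expr[OF q N] and bo = bounded_op_opp1[OF q N]
  have gen: "opp1 q N s (expr_op q N g f) = expr_op q N g (opp1 q N s f)" if g: "g \<in> gens" and f: "f \<in> ell2 (V_basis N)" for g s f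
    using f
  proof (induction s arbitrary: f rule: expr_induct)
    case (1 g')
    then show ?case using opp1_expr_commute_gen[OF q N g] by simp
  next
    case (2 c)
    then show ?case by (simp add: opp1_simps bounded_op_scale_vec[OF be])
  next
    case (3 s t)
    then show ?case by (simp add: opp1_simps bounded_op_add_vec[OF be] bounded_op_ell2[OF bo])
  next
    case (4 s t)
    then show ?case by (simp add: opp1_simps bounded_op_ell2[OF bo])
  qed
  show ?thesis using f
  proof (induction t arbitrary: f rule: expr_induct)
    case (1 g)
    then show ?case using gen by simp
  next
    case (2 c)
    then show ?case by (simp add: bounded_op_scale_vec[OF bo])
  next
    case (3 t u)
    then show ?case by (simp add: bounded_op_add_vec[OF bo] bounded_op_ell2[OF be])
  next
    case (4 t u)
    then show ?case by (simp add: bounded_op_ell2[OF be])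
  qed
qed

section \<open>The algebraic span of the basis vectors\<close>

lemma fin_span_ell2:
  assumes "f \<in> fin_span X" shows "f \<in> ell2 X"
proof -
  have fin: "finite {x. f x \<noteq> 0}" using assms by (simp add: fin_span_def)
  have "finite {x \<in> X. (cmod (f x))\<^sup>2 \<noteq> 0}" by (rule finite_subset[OF _ fin]) auto
  then have "(\<lambda>x. (cmod (f x))\<^sup>2) summable_on X" by (rule finite_nonzero_values_imp_summable_on)
  then show ?thesis using assms by (simp add: fin_span_def ell2_def)
qed

lemma fin_span_add:
  assumes "f \<in> fin_span X" "g \<in> fin_span X" shows "(\<lambda>x. f x + g x) \<in> fin_span X"
proof -
  have fin: "finite ({x. f x \<noteq> 0} \<union> {x. g x \<noteq> 0})" using assms by (simp add: fin_span_def)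
  have "finite {x. f x + g x \<noteq> 0}" by (rule finite_subset[OF _ fin]) auto
  then show ?thesis using assms by (simp add: fin_span_def)
qed

lemma fin_span_scale:
  assumes "f \<in> fin_span X" shows "(\<lambda>x. c * f x) \<in> fin_span X"
proof -
  have fin: "finite {x. f x \<noteq> 0}" using assms by (simp add: fin_span_def)
  have "finite {x. c * f x \<noteq> 0}" by (rule finite_subset[OF _ fin]) auto
  then show ?thesis using assms by (simp add: fin_span_def)
qed

lemma fin_span_wshift:
  assumes "inj_on \<phi> X" "f \<in> fin_span X" shows "wshift X w \<phi> f \<in> fin_span X"
proof -
  have "finite (\<phi> -` {x. f x \<noteq> 0} \<inter> X)" using assms by (intro finite_vimage_IntI) (auto simp: fin_span_def)
  then have "finite {y. wshift X w \<phi> f y \<noteq> 0}" by (rule finite_subset[rotated]) (auto simp: wshift_def)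
  then show ?thesis by (simp add: fin_span_def wshift_def)
qed

lemma fin_span_tri: "f \<in> fin_span V \<Longrightarrow> tri V k c f \<in> fin_span V"
proof -
  assume f: "f \<in> fin_span V"
  have "wshift V w (\<lambda>(l, m). (l - \<sigma>, m - k)) f \<in> fin_span V" for w \<sigma>
    by (rule fin_span_wshift[OF _ f]) (auto simp: inj_on_def)
  then show ?thesis unfolding tri_wshift sum3 by (intro fin_span_add)
qed

lemma fin_span_expr: "f \<in> fin_span (V_basis N) \<Longrightarrow> expr_op q N s f \<in> fin_span (V_basis N)"
proof (induction s arbitrary: f rule: expr_induct)
  case (1 g)
  then have "off (V_basis N) f" by (simp add: fin_span_def off_def)
  then show ?case using expr_op_gen[OF 1(1)] fin_span_tri[OF 1(2)] by simp
qed (simp_all add: fin_span_add fin_span_scale)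

section \<open>The commutators with D as operators\<close>

definition repH :: "real \<Rightarrow> real \<Rightarrow> real \<Rightarrow> podles_expr \<Rightarrow> label cop" where
  "repH q K K' s = dsum (expr_op q K s) (expr_op q K' s)"

definition oppH :: "real \<Rightarrow> real \<Rightarrow> real \<Rightarrow> podles_expr \<Rightarrow> label cop" where
  "oppH q K K' s = dsum (opp1 q K s) (opp1 q K' s)"

text \<open>\<open>D\<close> in coordinates, the truncation being membership in both summands.
  \<open>d\<close> belongs to the component \<open>V_K \<rightarrow> V_K'\<close> and
  \<open>d'\<close> to the way back.\<close>

definition Dmat :: "real \<Rightarrow> real \<Rightarrow> real \<Rightarrow> complex \<Rightarrow> complex \<Rightarrow> label cop" where
  "Dmat q K K' d d' f = case_sum
     (\<lambda>p. if p \<in> V_basis K \<and> p \<in> V_basis K' then d' * complex_of_real (q powr (- fst p)) * f (Inr p) else 0)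
     (\<lambda>p. if p \<in> V_basis K \<and> p \<in> V_basis K' then d * complex_of_real (q powr (- fst p)) * f (Inl p) else 0)"

definition Dcomm_gen :: "real \<Rightarrow> real \<Rightarrow> real \<Rightarrow> complex \<Rightarrow> complex \<Rightarrow> podles_expr \<Rightarrow> label cop" where
  "Dcomm_gen q K K' d d' g f = case_sum
     (\<lambda>p. d' * tri (V_basis K) (mshift g) (Dcoef q K' K g) (\<lambda>p. f (Inr p)) p)
     (\<lambda>p. d * tri (V_basis K') (mshift g) (Dcoef q K K' g) (\<lambda>p. f (Inl p)) p)"

text \<open>The bounded extension of \<open>[D, \<pi>(s)]\<close>, given on generators by the
  weights \<open>Dcoef\<close> and continued by the Leibniz rule. Boundedness and decay thus follow
  by induction, and the unbounded \<open>D\<close> itself is confined to the span.\<close>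

fun deltaH :: "real \<Rightarrow> real \<Rightarrow> real \<Rightarrow> complex \<Rightarrow> complex \<Rightarrow> podles_expr \<Rightarrow> label cop" where
  "deltaH q K K' d d' Gen_B = Dcomm_gen q K K' d d' Gen_B"
| "deltaH q K K' d d' Gen_Bstar = Dcomm_gen q K K' d d' Gen_Bstar"
| "deltaH q K K' d d' Gen_A = Dcomm_gen q K K' d d' Gen_A"
| "deltaH q K K' d d' (Scal c) = (\<lambda>f x. 0)"
| "deltaH q K K' d d' (Add s t) = (\<lambda>f x. deltaH q K K' d d' s f x + deltaH q K K' d d' t f x)"
| "deltaH q K K' d d' (Mult s t) = (\<lambda>f x. deltaH q K K' d d' s (repH q K K' t f) x
     + repH q K K' s (deltaH q K K' d d' t f) x)"

lemma deltaH_gen: "g \<in> gens \<Longrightarrow> deltaH q K K' d d' g = Dcomm_gen q K K' d d' g"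
  by auto

fun swap_shift :: "real \<Rightarrow> real \<Rightarrow> label \<Rightarrow> label" where
  "swap_shift a b (Inl (l, m)) = Inr (l - a, m - b)"
| "swap_shift a b (Inr (l, m)) = Inl (l - a, m - b)"

lemma Plus_mem_iff [simp]: "Inl x \<in> X <+> Y \<longleftrightarrow> x \<in> X" "Inr y \<in> X <+> Y \<longleftrightarrow> y \<in> Y"
  by auto

lemma inj_swap_shift: "inj_on (swap_shift a b) X"
proof (rule inj_onI)
  fix x y assume "swap_shift a b x = swap_shift a b y"
  then show "x = y" by (cases x; cases y) (auto elim: prod.exhaust)
qed

fun swap_weight :: "complex \<Rightarrow> complex \<Rightarrow> (real \<Rightarrow> real \<Rightarrow> real) \<Rightarrow> (real \<Rightarrow> real \<Rightarrow> real) \<Rightarrow> real \<Rightarrow> real \<Rightarrow> label \<Rightarrow> complex" where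
  "swap_weight d d' u v a b (Inl (l, m)) = d' * complex_of_real (u (l - a) (m - b))"
| "swap_weight d d' u v a b (Inr (l, m)) = d * complex_of_real (v (l - a) (m - b))"

text \<open>The weights are estimated at the source, whereas the ideal measures the level of the
  target. The source is at most two levels lower, which costs the factor
  \<open>1 / q^2\<close>.\<close>

lemma exp_decay_swap_shift:
  assumes q: "0 < q" "q < 1" and C: "C \<ge> 0" and a: "a \<le> 2"
    and u: "\<And>l m. (l, m) \<in> V_basis K' \<Longrightarrow> \<bar>u l m\<bar> \<le> C * q powr l"
    and v: "\<And>l m. (l, m) \<in> V_basis K \<Longrightarrow> \<bar>v l m\<bar> \<le> C * q powr l"
  shows "exp_decay q (V_basis K <+> V_basis K') level (wshift (V_basis K <+> V_basis K') (swap_weight d d' u v a b) (swap_shift a b))"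
proof (rule exp_decay_wshift[OF q(1) inj_swap_shift])
  fix y assume y: "swap_shift a b y \<in> V_basis K <+> V_basis K'"
  have e: "cmod z * \<bar>w\<bar> \<le> ((cmod d + cmod d') * C / q^2) * q powr l" if "\<bar>w\<bar> \<le> C * q powr (l - a)" "z = d \<or> z = d'" for w l z
  proof -
    have "q powr (l - a) \<le> q powr (l - 2)" using q a by (intro powr_mono') auto
    then have "\<bar>w\<bar> \<le> C * q powr (l - 2)" using that(1) C by (meson mult_left_mono order_trans)
    moreover have "cmod z \<le> cmod d + cmod d'" using that(2) by auto
    ultimately have "cmod z * \<bar>w\<bar> \<le> (cmod d + cmod d') * (C * q powr (l - 2))" by (intro mult_mono) auto
    then show ?thesis using q by (simp add: powr_diff powr_numeral)
  qed
  show "cmod (swap_weight d d' u v a b y) \<le> ((cmod d + cmod d') * C / q^2) * q powr level y"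
  proof (cases y)
    case (Inl p)
    obtain l m where p: "p = (l, m)" by (cases p)
    have "\<bar>u (l - a) (m - b)\<bar> \<le> C * q powr (l - a)" using y by (intro u) (auto simp: Inl p)
    from e[OF this, of d'] show ?thesis by (simp add: Inl p norm_mult level_def)
  next
    case (Inr p)
    obtain l m where p: "p = (l, m)" by (cases p)
    have "\<bar>v (l - a) (m - b)\<bar> \<le> C * q powr (l - a)" using y by (intro v) (auto simp: Inr p)
    from e[OF this, of d] show ?thesis by (simp add: Inr p norm_mult level_def)
  qed
qed

lemma bounded_op_swap_shift:
  assumes C: "C \<ge> 0"
    and u: "\<And>l m. (l, m) \<in> V_basis K' \<Longrightarrow> \<bar>u l m\<bar> \<le> C"
    and v: "\<And>l m. (l, m) \<in> V_basis K \<Longrightarrow> \<bar>v l m\<bar> \<le> C"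
  shows "bounded_op (V_basis K <+> V_basis K') (wshift (V_basis K <+> V_basis K') (swap_weight d d' u v a b) (swap_shift a b))"
proof (rule bounded_op_wshift[OF inj_swap_shift])
  fix y assume y: "swap_shift a b y \<in> V_basis K <+> V_basis K'"
  have e: "cmod z * \<bar>w\<bar> \<le> (cmod d + cmod d') * C" if "\<bar>w\<bar> \<le> C" "z = d \<or> z = d'" for w z
    using that C by (intro mult_mono) auto
  show "cmod (swap_weight d d' u v a b y) \<le> (cmod d + cmod d') * C"
  proof (cases y)
    case (Inl p)
    obtain l m where p: "p = (l, m)" by (cases p)
    have "\<bar>u (l - a) (m - b)\<bar> \<le> C" using y by (intro u) (auto simp: Inl p)
    from e[OF this, of d'] show ?thesis by (simp add: Inl p norm_mult)
  next
    case (Inr p)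
    obtain l m where p: "p = (l, m)" by (cases p)
    have "\<bar>v (l - a) (m - b)\<bar> \<le> C" using y by (intro v) (auto simp: Inr p)
    from e[OF this, of d] show ?thesis by (simp add: Inr p norm_mult)
  qed
qed

lemma bounded_op_repH:
  "0 < q \<Longrightarrow> q < 1 \<Longrightarrow> 2 * K \<in> \<int> \<Longrightarrow> 2 * K' \<in> \<int> \<Longrightarrow> bounded_op (V_basis K <+> V_basis K') (repH q K K' s)"
  unfolding repH_def by (intro bounded_op_dsum bounded_op_expr)

lemma bounded_op_oppH:
  "0 < q \<Longrightarrow> q < 1 \<Longrightarrow> 2 * K \<in> \<int> \<Longrightarrow> 2 * K' \<in> \<int> \<Longrightarrow> bounded_op (V_basis K <+> V_basis K') (oppH q K K' s)"
  unfolding oppH_def by (intro bounded_op_dsum bounded_op_opp1)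

lemma oppH_repH_commute:
  assumes "0 < q" "q < 1" "2 * K \<in> \<int>" "2 * K' \<in> \<int>" "f \<in> ell2 (V_basis K <+> V_basis K')"
  shows "oppH q K K' s (repH q K K' t f) = repH q K K' t (oppH q K K' s f)"
  using assms by (auto intro!: sum_fun_eqI simp: oppH_def repH_def ell2_Plus(1) opp1_expr_commute)

lemma Dcomm_gen_swap_shift:
  "Dcomm_gen q K K' d d' g f = (\<lambda>y. \<Sum>\<sigma>\<in>{-1,0,1}. wshift (V_basis K <+> V_basis K')
     (swap_weight d d' (Dcoef q K' K g \<sigma>) (Dcoef q K K' g \<sigma>) \<sigma> (mshift g)) (swap_shift \<sigma> (mshift g)) f y)" (is "?l = ?r")
proof
  fix y
  show "?l y = ?r y"
  proof (cases y)
    case (Inl p)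
    obtain l m where p: "p = (l, m)" by (cases p)
    show ?thesis unfolding Inl p Dcomm_gen_def tri_def wshift_def by (simp add: sum_distrib_left ring_distribs)
  next
    case (Inr p)
    obtain l m where p: "p = (l, m)" by (cases p)
    show ?thesis unfolding Inr p Dcomm_gen_def tri_def wshift_def by (simp add: sum_distrib_left ring_distribs)
  qed
qed

definition commw :: "real \<Rightarrow> real \<Rightarrow> real \<Rightarrow> podles_expr \<Rightarrow> podles_expr \<Rightarrow> real \<Rightarrow> real \<Rightarrow> real \<Rightarrow> real \<Rightarrow> real" where
  "commw q K K' g g' \<sigma> \<tau> a b = opcoef q K' g' \<tau> (a + \<sigma>) (b + mshift g) * Dcoef q K K' g \<sigma> a b
       - Dcoef q K K' g \<sigma> (a + \<tau>) (b - mshift g') * opcoef q K g' \<tau> a b"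

lemma podles_pair_swap: "podles_pair q K K' \<Longrightarrow> podles_pair q K' K"
  unfolding podles_pair_def using Ints_minus[of "\<bar>K\<bar> - \<bar>K'\<bar>"] by simp

lemma off_Plus: "off (X <+> Y) f \<longleftrightarrow> off X (\<lambda>x. f (Inl x)) \<and> off Y (\<lambda>y. f (Inr y))"
  by (auto simp: off_def split_sum_all)

context podles_pair
begin

text \<open>\<open>Dcoef\<close> tests only \<open>|K'| \<le> a + \<sigma>\<close>, whereas
  \<open>D\<close> acts after \<open>\<pi>\<close> only on labels of \<open>V_K\<close>. Where the
  target is not one of them, the coefficient is zero by \<open>coef_leave\<close>.\<close>

lemma D_block:
  assumes g: "g \<in> gens" and f: "off (V_basis K) f"
  shows "(if p \<in> V_basis K \<and> p \<in> V_basis K' then d * complex_of_real (q powr (- fst p)) * tri (V_basis K) (mshift g) (coef q K g) f p else 0)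
     - tri (V_basis K') (mshift g) (coef q K' g)
         (\<lambda>p. if p \<in> V_basis K \<and> p \<in> V_basis K' then d * complex_of_real (q powr (- fst p)) * f p else 0) p
     = d * tri (V_basis K') (mshift g) (Dcoef q K K' g) f p"
proof -
  obtain l m where p: "p = (l, m)" by (cases p)
  show ?thesis
  proof (cases "(l, m) \<in> V_basis K'")
    case False
    then show ?thesis by (simp add: p tri_outside)
  next
    case True
    define T where "T \<sigma> = (if (l, m) \<in> V_basis K then d * complex_of_real (q powr (- l)) * (complex_of_real (coef q K g \<sigma> (l - \<sigma>) (m - mshift g)) * f (l - \<sigma>, m - mshift g)) else 0)
      - complex_of_real (coef q K' g \<sigma> (l - \<sigma>) (m - mshift g)) *
        (if (l - \<sigma>, m - mshift g) \<in> V_basis K \<and> (l - \<sigma>, m - mshift g) \<in> V_basis K' then d * complex_of_real (q powr (- (l - \<sigma>))) * f (l - \<sigma>, m - mshift g) else 0)" for \<sigma>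
    have t: "T \<sigma> = d * (complex_of_real (Dcoef q K K' g \<sigma> (l - \<sigma>) (m - mshift g)) * f (l - \<sigma>, m - mshift g))" if s: "\<sigma> \<in> {-1,0,1}" for \<sigma>
    proof (cases "(l - \<sigma>, m - mshift g) \<in> V_basis K")
      case False
      then have "f (l - \<sigma>, m - mshift g) = 0" using f by (simp add: off_def)
      then show ?thesis by (simp add: T_def)
    next
      case x: True
      have l: "\<bar>K'\<bar> \<le> l - \<sigma> + \<sigma>" using V_basis_bounds[OF True] by simp
      have c: "coef q K g \<sigma> (l - \<sigma>) (m - mshift g) = 0" if "(l, m) \<notin> V_basis K"
        using coef_leave[OF x g s] that by simp
      have o: "(l - \<sigma>, m - mshift g) \<in> V_basis K' \<longleftrightarrow> \<bar>K'\<bar> \<le> l - \<sigma>" by (rule V_basis_other[OF x KK])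
      show ?thesis
        unfolding T_def Dcoef_def o using x l c by (simp add: algebra_simps)
    qed
    have "(if p \<in> V_basis K \<and> p \<in> V_basis K' then d * complex_of_real (q powr (- fst p)) * tri (V_basis K) (mshift g) (coef q K g) f p else 0)
     - tri (V_basis K') (mshift g) (coef q K' g)
         (\<lambda>p. if p \<in> V_basis K \<and> p \<in> V_basis K' then d * complex_of_real (q powr (- fst p)) * f p else 0) p = (\<Sum>\<sigma>\<in>{-1,0,1}. T \<sigma>)"
    proof (cases "(l, m) \<in> V_basis K")
      case True
      then show ?thesis using \<open>(l, m) \<in> V_basis K'\<close>
        unfolding p tri_def split fst_conv T_def by (simp only: if_True simp_thms sum_subtractf sum_distrib_left)
    next
      case False
      then show ?thesis using \<open>(l, m) \<in> V_basis K'\<close>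
        unfolding p tri_def split fst_conv T_def by (simp only: if_True if_False simp_thms sum_subtractf sum.neutral_const)
    qed
    also have "\<dots> = (\<Sum>\<sigma>\<in>{-1,0,1}. d * (complex_of_real (Dcoef q K K' g \<sigma> (l - \<sigma>) (m - mshift g)) * f (l - \<sigma>, m - mshift g)))"
      by (rule sum.cong[OF HOL.refl t])
    also have "\<dots> = d * tri (V_basis K') (mshift g) (Dcoef q K K' g) f p"
      using True unfolding p tri_def split by (simp only: if_True sum_distrib_left)
    finally show ?thesis .
  qed
qed

text \<open>Both products run over nine paths. Indexing them by the common source label puts their
  weights under one sum, where the difference is \<open>commw\<close>.\<close>

lemma commutator_block:
  assumes g: "g \<in> gens" and g': "g' \<in> gens" and f: "off (V_basis K) f" and lm: "(l, m) \<in> V_basis K'"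
  shows "opp1 q K' g' (\<lambda>p. d * tri (V_basis K') (mshift g) (Dcoef q K K' g) f p) (l, m)
     - d * tri (V_basis K') (mshift g) (Dcoef q K K' g) (opp1 q K g' f) (l, m)
   = (\<Sum>\<tau>\<in>{-1,0,1}. \<Sum>\<sigma>\<in>{-1,0,1}. d * complex_of_real (commw q K K' g g' \<sigma> \<tau> (l - (\<tau> + \<sigma>)) (m - (mshift g - mshift g')))
       * f (l - (\<tau> + \<sigma>), m - (mshift g - mshift g')))"
proof -
  have l1: "leaves (V_basis K) (V_basis K') (mshift g) (Dcoef q K K' g)"
    unfolding leaves_def by (intro ballI allI impI) (rule Dcoef_leave[OF _ g]; assumption)
  have l2: "leaves (V_basis K) (V_basis K) (- mshift g') (opcoef q K g')"
    unfolding leaves_def add_uminus_conv_diff by (intro ballI allI impI) (rule opcoef_leave[OF _ g']; assumption)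
  have o1: "off (V_basis K') (\<lambda>p. d * tri (V_basis K') (mshift g) (Dcoef q K K' g) f p)" by (simp add: off_def tri_outside)
  define b where "b = m - (mshift g - mshift g')"
  have b: "m - - mshift g' = b + mshift g" "m - - mshift g' - mshift g = b" "m - mshift g = b - mshift g'" "m - mshift g - - mshift g' = b"
    "b + mshift g - mshift g = b" "b - mshift g' - - mshift g' = b"
    by (simp_all add: b_def)
  have a: "l - \<tau> = l - (\<tau> + \<sigma>) + \<sigma>" "l - \<tau> - \<sigma> = l - (\<tau> + \<sigma>)" "l - \<sigma> = l - (\<tau> + \<sigma>) + \<tau>" "l - \<sigma> - \<tau> = l - (\<tau> + \<sigma>)" for \<tau> \<sigma>
    by simp_all
  have r: "u * (x * y) * z - u * (v * w) * z = u * (x * y - v * w) * (z::complex)" for u x y z v w by (simp add: algebra_simps)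
  define F where "F \<tau> \<sigma> = f (l - (\<tau> + \<sigma>), b)" for \<tau> \<sigma>
  have "opp1 q K' g' (\<lambda>p. d * tri (V_basis K') (mshift g) (Dcoef q K K' g) f p) (l, m)
    = d * (\<Sum>\<tau>\<in>{-1,0,1}. \<Sum>\<sigma>\<in>{-1,0,1}. complex_of_real (opcoef q K' g' \<tau> (l - \<tau>) (b + mshift g) * Dcoef q K K' g \<sigma> (l - \<tau> - \<sigma>) b)
        * f (l - \<tau> - \<sigma>, b))"
    unfolding opp1_gen[OF g' o1] tri_scale tri_tri[OF f l1 lm] b ..
  also have "\<dots> = (\<Sum>\<tau>\<in>{-1,0,1}. \<Sum>\<sigma>\<in>{-1,0,1}. d * (complex_of_real (opcoef q K' g' \<tau> (l - (\<tau> + \<sigma>) + \<sigma>) (b + mshift g) * Dcoef q K K' g \<sigma> (l - (\<tau> + \<sigma>)) b)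
        * F \<tau> \<sigma>))"
    unfolding sum_distrib_left a(2) F_def by (intro sum.cong HOL.refl) (simp only: a(1)[symmetric])
  finally have e1: "opp1 q K' g' (\<lambda>p. d * tri (V_basis K') (mshift g) (Dcoef q K K' g) f p) (l, m) = \<dots>" .
  have "d * tri (V_basis K') (mshift g) (Dcoef q K K' g) (opp1 q K g' f) (l, m)
    = d * (\<Sum>\<sigma>\<in>{-1,0,1}. \<Sum>\<tau>\<in>{-1,0,1}. complex_of_real (Dcoef q K K' g \<sigma> (l - \<sigma>) (b - mshift g') * opcoef q K g' \<tau> (l - \<sigma> - \<tau>) b)
        * f (l - \<sigma> - \<tau>, b))"
    unfolding opp1_gen[OF g' f] tri_tri[OF f l2 lm] b ..
  also have "\<dots> = (\<Sum>\<sigma>\<in>{-1,0,1}. \<Sum>\<tau>\<in>{-1,0,1}. d * (complex_of_real (Dcoef q K K' g \<sigma> (l - (\<tau> + \<sigma>) + \<tau>) (b - mshift g') * opcoef q K g' \<tau> (l - (\<tau> + \<sigma>)) b)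
        * F \<tau> \<sigma>))"
    unfolding sum_distrib_left a(4) F_def by (intro sum.cong HOL.refl) (simp only: a(3)[symmetric])
  also have "\<dots> = (\<Sum>\<tau>\<in>{-1,0,1}. \<Sum>\<sigma>\<in>{-1,0,1}. d * (complex_of_real (Dcoef q K K' g \<sigma> (l - (\<tau> + \<sigma>) + \<tau>) (b - mshift g') * opcoef q K g' \<tau> (l - (\<tau> + \<sigma>)) b)
        * F \<tau> \<sigma>))"
    by (rule sum.swap)
  finally have e2: "d * tri (V_basis K') (mshift g) (Dcoef q K K' g) (opp1 q K g' f) (l, m) = \<dots>" .
  show ?thesis
    unfolding e1 e2 sum_subtractf[symmetric] b_def[symmetric] F_def[symmetric] commw_def
    by (intro sum.cong HOL.refl) (simp add: algebra_simps)
qed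

lemma commw_bound:
  assumes g: "g \<in> gens" and g': "g' \<in> gens"
  obtains C where "C \<ge> 0" "\<And>\<sigma> \<tau> a b. \<sigma> \<in> {-1,0,1} \<Longrightarrow> \<tau> \<in> {-1,0,1} \<Longrightarrow> (a, b) \<in> V_basis K \<Longrightarrow> \<bar>commw q K K' g g' \<sigma> \<tau> a b\<bar> \<le> C * q powr a"
  by (rule commutator_weight_decay[OF g g', folded commw_def]) (rule that; assumption)

end

lemma Dmat_add: "Dmat q K K' d d' (\<lambda>x. f x + g x) = (\<lambda>x. Dmat q K K' d d' f x + Dmat q K K' d d' g x)"
  by (auto simp: Dmat_def fun_eq_iff algebra_simps split: sum.split)

lemma Dmat_scale: "Dmat q K K' d d' (\<lambda>x. c * f x) = (\<lambda>x. c * Dmat q K K' d d' f x)"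
  by (auto simp: Dmat_def fun_eq_iff algebra_simps split: sum.split)

lemma fin_span_Plus: "f \<in> fin_span (X <+> Y) \<longleftrightarrow> (\<lambda>x. f (Inl x)) \<in> fin_span X \<and> (\<lambda>y. f (Inr y)) \<in> fin_span Y"
proof -
  have "{x. f x \<noteq> 0} = Inl ` {x. f (Inl x) \<noteq> 0} \<union> Inr ` {y. f (Inr y) \<noteq> 0}"
    by (auto simp: image_iff) (metis sum.exhaust)
  then have "finite {x. f x \<noteq> 0} \<longleftrightarrow> finite {x. f (Inl x) \<noteq> 0} \<and> finite {y. f (Inr y) \<noteq> 0}"
    by (simp add: finite_image_iff)
  then show ?thesis by (auto simp: fin_span_def split_sum_all)
qed

locale podles_D = podles_pair +
  fixes d d' :: complex
begin

abbreviation "H \<equiv> V_basis K <+> V_basis K'"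

sublocale swapped: podles_pair q K' K
  by (rule podles_pair_swap) unfold_locales

lemma bounded_op_deltaH: "bounded_op H (deltaH q K K' d d' s)"
proof (induction s rule: expr_induct)
  case (1 g)
  obtain C where C: "C \<ge> 0" "\<And>\<sigma> a b. \<sigma> \<in> {-1,0,1} \<Longrightarrow> (a, b) \<in> V_basis K \<Longrightarrow> \<bar>Dcoef q K K' g \<sigma> a b\<bar> \<le> C"
    by (rule Dcoef_bounds[OF 1]) (rule that; assumption)
  obtain C' where C': "C' \<ge> 0" "\<And>\<sigma> a b. \<sigma> \<in> {-1,0,1} \<Longrightarrow> (a, b) \<in> V_basis K' \<Longrightarrow> \<bar>Dcoef q K' K g \<sigma> a b\<bar> \<le> C'"
    by (rule swapped.Dcoef_bounds[OF 1]) (rule that; assumption)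
  show ?case unfolding deltaH_gen[OF 1] Dcomm_gen_swap_shift[abs_def]
  proof (rule bounded_op_sum)
    fix \<sigma> :: real assume s: "\<sigma> \<in> {-1,0,1}"
    show "bounded_op H (wshift H (swap_weight d d' (Dcoef q K' K g \<sigma>) (Dcoef q K K' g \<sigma>) \<sigma> (mshift g)) (swap_shift \<sigma> (mshift g)))"
    proof (rule bounded_op_swap_shift[of "C + C'"])
      show "\<bar>Dcoef q K' K g \<sigma> l m\<bar> \<le> C + C'" if "(l, m) \<in> V_basis K'" for l m using C'(2)[OF s that] C(1) by simp
      show "\<bar>Dcoef q K K' g \<sigma> l m\<bar> \<le> C + C'" if "(l, m) \<in> V_basis K" for l m using C(2)[OF s that] C'(1) by simp
    qed (use C(1) C'(1) in simp)
  qed simp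
next
  case (2 c)
  show ?case by (simp add: bounded_op_zero)
next
  case (3 s t)
  then show ?case by (simp add: bounded_op_add)
next
  case (4 s t)
  note R = bounded_op_repH[OF q K]
  show ?case by (simp add: bounded_op_add bounded_op_comp[OF 4(1) R] bounded_op_comp[OF R 4(2)])
qed

lemma fin_span_repH: "f \<in> fin_span H \<Longrightarrow> repH q K K' s f \<in> fin_span H"
  by (simp add: repH_def fin_span_Plus fin_span_expr)

lemma fin_span_Dmat: "f \<in> fin_span H \<Longrightarrow> Dmat q K K' d d' f \<in> fin_span H"
proof -
  assume "f \<in> fin_span H"
  then have f: "(\<lambda>x. f (Inl x)) \<in> fin_span (V_basis K)" "(\<lambda>x. f (Inr x)) \<in> fin_span (V_basis K')" by (simp_all add: fin_span_Plus)
  have g: "(\<lambda>p. if p \<in> V_basis K \<and> p \<in> V_basis K' then c p * h p else 0) \<in> fin_span X"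
    if "finite {x. h x \<noteq> 0}" "X = V_basis K \<or> X = V_basis K'" for h c X
  proof -
    have "finite {p. (if p \<in> V_basis K \<and> p \<in> V_basis K' then c p * h p else 0) \<noteq> 0}"
      by (rule finite_subset[OF _ that(1)]) auto
    then show ?thesis using that(2) by (auto simp: fin_span_def)
  qed
  show ?thesis
    unfolding fin_span_Plus Dmat_def sum.case
    using f by (intro conjI g) (auto simp: fin_span_def)
qed

text \<open>\<open>D\<close> and the representation map the span into itself, so on it all products
  are defined and the Leibniz rule built into \<open>deltaH\<close> is that of the actual
  commutator.\<close>

lemma Dmat_commutator:
  assumes "f \<in> fin_span H"
  shows "deltaH q K K' d d' s f = (\<lambda>x. Dmat q K K' d d' (repH q K K' s f) x - repH q K K' s (Dmat q K K' d d' f) x)"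
  using assms
proof (induction s arbitrary: f rule: expr_induct)
  case (1 g)
  then have fl: "off (V_basis K) (\<lambda>x. f (Inl x))" and fr: "off (V_basis K') (\<lambda>x. f (Inr x))"
    by (auto simp: fin_span_def off_def)
  have ol: "off (V_basis K) (\<lambda>p. if p \<in> V_basis K \<and> p \<in> V_basis K' then c p * h p else 0)"
    and or: "off (V_basis K') (\<lambda>p. if p \<in> V_basis K \<and> p \<in> V_basis K' then c p * h p else 0)" for c h :: "real \<times> real \<Rightarrow> complex"
    by (simp_all add: off_def)
  have sw: "(p \<in> V_basis K \<and> p \<in> V_basis K') = (p \<in> V_basis K' \<and> p \<in> V_basis K)" for p by blast
  show ?case
  proof (rule sum_fun_eqI)
    show "(\<lambda>x. deltaH q K K' d d' g f (Inl x)) = (\<lambda>x. Dmat q K K' d d' (repH q K K' g f) (Inl x) - repH q K K' g (Dmat q K K' d d' f) (Inl x))"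
      unfolding deltaH_gen[OF 1(1)] Dcomm_gen_def sum.case swapped.D_block[OF 1(1) fr, symmetric]
      unfolding Dmat_def repH_def dsum_simps sum.case expr_op_gen[OF 1(1) fr] expr_op_gen[OF 1(1) ol]
      by (simp only: sw)
    show "(\<lambda>x. deltaH q K K' d d' g f (Inr x)) = (\<lambda>x. Dmat q K K' d d' (repH q K K' g f) (Inr x) - repH q K K' g (Dmat q K K' d d' f) (Inr x))"
      unfolding deltaH_gen[OF 1(1)] Dcomm_gen_def sum.case D_block[OF 1(1) fl, symmetric]
      unfolding Dmat_def repH_def dsum_simps sum.case expr_op_gen[OF 1(1) fl] expr_op_gen[OF 1(1) or] ..
  qed
next
  case (2 c)
  have "repH q K K' (Scal c) h = (\<lambda>x. c * h x)" for h by (auto simp: repH_def intro!: sum_fun_eqI)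
  then show ?case by (simp add: Dmat_scale)
next
  case (3 s t)
  have "repH q K K' (Add s t) h = (\<lambda>x. repH q K K' s h x + repH q K K' t h x)" for h by (auto simp: repH_def intro!: sum_fun_eqI)
  then show ?case using 3 by (simp add: Dmat_add fun_eq_iff)
next
  case (4 s t)
  note f = 4(3)
  have m: "repH q K K' (Mult s t) h = repH q K K' s (repH q K K' t h)" for h by (auto simp: repH_def intro!: sum_fun_eqI)
  have R: "bounded_op H (repH q K K' s)" by (rule bounded_op_repH[OF q K])
  let ?D = "Dmat q K K' d d'"
  have u: "?D (repH q K K' t f) \<in> ell2 H" "repH q K K' t (?D f) \<in> ell2 H"
    by (intro fin_span_ell2 fin_span_Dmat fin_span_repH f)+
  have "repH q K K' s (\<lambda>x. ?D (repH q K K' t f) x + (- 1) * repH q K K' t (?D f) x)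
    = (\<lambda>x. repH q K K' s (?D (repH q K K' t f)) x + (- 1) * repH q K K' s (repH q K K' t (?D f)) x)"
    by (simp only: bounded_op_add_vec[OF R u(1) ell2_scale(1)[OF u(2)]] bounded_op_scale_vec[OF R u(2)])
  then have sub: "repH q K K' s (\<lambda>x. ?D (repH q K K' t f) x - repH q K K' t (?D f) x)
    = (\<lambda>x. repH q K K' s (?D (repH q K K' t f)) x - repH q K K' s (repH q K K' t (?D f)) x)" by simp
  show ?case unfolding m deltaH.simps 4(1)[OF fin_span_repH[OF f]] 4(2)[OF f] sub by simp
qed

text \<open>Each of the nine terms is a shift that exchanges the two summands;
  \<open>commw_bound\<close>, used in both directions, puts it into the ideal.\<close>

lemma exp_decay_commutator_gen:
  assumes g: "g \<in> gens" and g': "g' \<in> gens"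
  shows "exp_decay q H level (\<lambda>f x. oppH q K K' g' (deltaH q K K' d d' g f) x - deltaH q K K' d d' g (oppH q K K' g' f) x)"
proof -
  obtain C where C: "C \<ge> 0" "\<And>\<sigma> \<tau> a b. \<sigma> \<in> {-1,0,1} \<Longrightarrow> \<tau> \<in> {-1,0,1} \<Longrightarrow> (a, b) \<in> V_basis K \<Longrightarrow> \<bar>commw q K K' g g' \<sigma> \<tau> a b\<bar> \<le> C * q powr a"
    by (rule commw_bound[OF g g']) (rule that; assumption)
  obtain C' where C': "C' \<ge> 0" "\<And>\<sigma> \<tau> a b. \<sigma> \<in> {-1,0,1} \<Longrightarrow> \<tau> \<in> {-1,0,1} \<Longrightarrow> (a, b) \<in> V_basis K' \<Longrightarrow> \<bar>commw q K' K g g' \<sigma> \<tau> a b\<bar> \<le> C' * q powr a"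
    by (rule swapped.commw_bound[OF g g']) (rule that; assumption)
  let ?k = "mshift g - mshift g'"
  let ?T = "\<lambda>\<tau> \<sigma>. wshift H (swap_weight d d' (commw q K' K g g' \<sigma> \<tau>) (commw q K K' g g' \<sigma> \<tau>) (\<tau> + \<sigma>) ?k) (swap_shift (\<tau> + \<sigma>) ?k)"
  have dec: "exp_decay q H level (?T \<tau> \<sigma>)" if s: "\<sigma> \<in> {-1,0,1}" and t: "\<tau> \<in> {-1,0,1}" for \<sigma> \<tau>
  proof (rule exp_decay_swap_shift[OF q, of "C + C'"])
    have m: "C * q powr l \<le> (C + C') * q powr l" "C' * q powr l \<le> (C + C') * q powr l" for l
      using C(1) C'(1) by (auto intro!: mult_right_mono)
    show "\<bar>commw q K' K g g' \<sigma> \<tau> l m\<bar> \<le> (C + C') * q powr l" if "(l, m) \<in> V_basis K'" for l m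
      using C'(2)[OF s t that] m[of l] by linarith
    show "\<bar>commw q K K' g g' \<sigma> \<tau> l m\<bar> \<le> (C + C') * q powr l" if "(l, m) \<in> V_basis K" for l m
      using C(2)[OF s t that] m[of l] by linarith
    show "\<tau> + \<sigma> \<le> 2" using s t by auto
  qed (use C(1) C'(1) in simp)
  have sum: "exp_decay q H level (\<lambda>f x. \<Sum>\<tau>\<in>{-1,0,1}. \<Sum>\<sigma>\<in>{-1,0,1}. ?T \<tau> \<sigma> f x)"
    by (intro exp_decay_sum dec) auto
  show ?thesis
  proof (rule exp_decay.cong[OF sum])
    fix f assume f: "f \<in> ell2 H"
    have fl: "off (V_basis K) (\<lambda>x. f (Inl x))" and fr: "off (V_basis K') (\<lambda>x. f (Inr x))"
      using off_ell2[OF f] by (simp_all add: off_Plus)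
    show "(\<lambda>x. oppH q K K' g' (deltaH q K K' d d' g f) x - deltaH q K K' d d' g (oppH q K K' g' f) x)
      = (\<lambda>x. \<Sum>\<tau>\<in>{-1,0,1}. \<Sum>\<sigma>\<in>{-1,0,1}. ?T \<tau> \<sigma> f x)"
    proof
      fix y
      have z: "opp1 q N g' h p = 0" if "p \<notin> V_basis N" "off (V_basis N) h" for N h p
        unfolding opp1_gen[OF g' that(2)] by (rule tri_outside[OF that(1)])
      have ot: "off V (\<lambda>p. c * tri V k w h p)" for V c k w h by (simp add: off_def tri_outside)
      show "oppH q K K' g' (deltaH q K K' d d' g f) y - deltaH q K K' d d' g (oppH q K K' g' f) y
        = (\<Sum>\<tau>\<in>{-1,0,1}. \<Sum>\<sigma>\<in>{-1,0,1}. ?T \<tau> \<sigma> f y)"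
      proof (cases y)
        case (Inl p)
        obtain l m where p: "p = (l, m)" by (cases p)
        have e: "oppH q K K' g' (deltaH q K K' d d' g f) y - deltaH q K K' d d' g (oppH q K K' g' f) y
          = opp1 q K g' (\<lambda>p. d' * tri (V_basis K) (mshift g) (Dcoef q K' K g) (\<lambda>x. f (Inr x)) p) (l, m)
     - d' * tri (V_basis K) (mshift g) (Dcoef q K' K g) (opp1 q K' g' (\<lambda>x. f (Inr x))) (l, m)"
          unfolding Inl p deltaH_gen[OF g] Dcomm_gen_def oppH_def dsum_simps sum.case ..
        show ?thesis
        proof (cases "(l, m) \<in> V_basis K")
          case True
          have t: "?T \<tau> \<sigma> f y = d' * complex_of_real (commw q K' K g g' \<sigma> \<tau> (l - (\<tau> + \<sigma>)) (m - ?k)) * f (Inr (l - (\<tau> + \<sigma>), m - ?k))" for \<tau> \<sigma>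
            using True unfolding wshift_def Inl p by (simp only: InlI if_True swap_weight.simps swap_shift.simps)
          show ?thesis unfolding e t by (rule swapped.commutator_block[OF g g' fr True])
        next
          case False
          then have t: "?T \<tau> \<sigma> f y = 0" for \<tau> \<sigma> by (simp add: wshift_def Inl p)
          show ?thesis unfolding e t z[OF False ot] tri_outside[OF False] by simp
        qed
      next
        case (Inr p)
        obtain l m where p: "p = (l, m)" by (cases p)
        have e: "oppH q K K' g' (deltaH q K K' d d' g f) y - deltaH q K K' d d' g (oppH q K K' g' f) y
          = opp1 q K' g' (\<lambda>p. d * tri (V_basis K') (mshift g) (Dcoef q K K' g) (\<lambda>x. f (Inl x)) p) (l, m)
     - d * tri (V_basis K') (mshift g) (Dcoef q K K' g) (opp1 q K g' (\<lambda>x. f (Inl x))) (l, m)"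
          unfolding Inr p deltaH_gen[OF g] Dcomm_gen_def oppH_def dsum_simps sum.case ..
        show ?thesis
        proof (cases "(l, m) \<in> V_basis K'")
          case True
          have t: "?T \<tau> \<sigma> f y = d * complex_of_real (commw q K K' g g' \<sigma> \<tau> (l - (\<tau> + \<sigma>)) (m - ?k)) * f (Inl (l - (\<tau> + \<sigma>), m - ?k))" for \<tau> \<sigma>
            using True unfolding wshift_def Inr p by (simp only: InrI if_True swap_weight.simps swap_shift.simps)
          show ?thesis unfolding e t by (rule commutator_block[OF g g' fl True])
        next
          case False
          then have t: "?T \<tau> \<sigma> f y = 0" for \<tau> \<sigma> by (simp add: wshift_def Inr p)
          show ?thesis unfolding e t z[OF False ot] tri_outside[OF False] by simp
        qed
      qed
    qed
  qed
qed

text \<open>For a product of opposite elements,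
  \<open>[o1 o2, \<delta>] = o1 [o2, \<delta>] + [o1, \<delta>] o2\<close>. For a product in the
  other argument, the exact commutation of opposite elements with \<open>\<pi>\<close> gives
  \<open>[o, \<delta>(t u)] = [o, \<delta>(t)] \<pi>(u) + \<pi>(t) [o, \<delta>(u)]\<close>. Both
  expressions lie in a two-sided ideal.\<close>

lemma exp_decay_commutator:
  "exp_decay q H level (\<lambda>f x. oppH q K K' s (deltaH q K K' d d' t f) x - deltaH q K K' d d' t (oppH q K K' s f) x)"
proof -
  note O = bounded_op_oppH[OF q K] and R = bounded_op_repH[OF q K] and dl = bounded_op_deltaH
  let ?O = "oppH q K K'" and ?R = "repH q K K'" and ?d = "deltaH q K K' d d'"
  have os: "?O (Scal c) = (\<lambda>f x. cnj c * f x)" "?O (Add s t) = (\<lambda>f x. ?O s f x + ?O t f x)" "?O (Mult s t) = (\<lambda>f. ?O s (?O t f))" for c s t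
    by (auto intro!: ext sum_fun_eqI simp: oppH_def opp1_simps dsum_def split: sum.split)
  have bsub: "T (\<lambda>x. a x - b x) = (\<lambda>x. T a x - T b x)" if T: "bounded_op H T" and a: "a \<in> ell2 H" and b: "b \<in> ell2 H" for T a b
    using bounded_op_add_vec[OF T a ell2_scale(1)[OF b, of "-1"]] bounded_op_scale_vec[OF T b, of "-1"] by simp
  have gen: "exp_decay q H level (\<lambda>f x. ?O s (?d g f) x - ?d g (?O s f) x)" if g: "g \<in> gens" for g s
  proof (induction s rule: expr_induct)
    case (1 g')
    show ?case by (rule exp_decay_commutator_gen[OF g 1])
  next
    case (2 c)
    show ?case
      by (rule exp_decay.cong[OF exp_decay_zero]) (simp add: os bounded_op_scale_vec[OF dl])
  next
    case (3 s t)
    show ?case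
      by (rule exp_decay.cong[OF exp_decay.add[OF 3]]) (rule ext, simp add: os bounded_op_add_vec[OF dl] bounded_op_ell2[OF O])
  next
    case (4 s t)
    have "exp_decay q H level (\<lambda>f x. ?O s (\<lambda>x. ?O t (?d g f) x - ?d g (?O t f) x) x + (?O s (?d g (?O t f)) x - ?d g (?O s (?O t f)) x))"
      by (rule exp_decay.add[OF exp_decay.left[OF O 4(2)] exp_decay.right[OF 4(1) O]])
    then show ?case
      by (rule exp_decay.cong) (rule ext, simp add: os bsub[OF O] bounded_op_ell2[OF O] bounded_op_ell2[OF dl])
  qed
  show ?thesis
  proof (induction t rule: expr_induct)
    case (1 g)
    show ?case by (rule gen[OF 1])
  next
    case (2 c)
    show ?case
      by (rule exp_decay.cong[OF exp_decay_zero]) (simp add: bounded_op_vec_zero[OF O])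
  next
    case (3 t u)
    show ?case
      by (rule exp_decay.cong[OF exp_decay.add[OF 3]]) (rule ext, simp add: bounded_op_add_vec[OF O] bounded_op_ell2[OF dl])
  next
    case (4 t u)
    have "exp_decay q H level (\<lambda>f x. (?O s (?d t (?R u f)) x - ?d t (?O s (?R u f)) x) + ?R t (\<lambda>x. ?O s (?d u f) x - ?d u (?O s f) x) x)"
      by (rule exp_decay.add[OF exp_decay.right[OF 4(1) R] exp_decay.left[OF R 4(2)]])
    then show ?case
    proof (rule exp_decay.cong)
      fix f assume f: "f \<in> ell2 H"
      note m = bounded_op_ell2[OF dl] bounded_op_ell2[OF R] bounded_op_ell2[OF O]
      show "(\<lambda>x. ?O s (?d (Mult t u) f) x - ?d (Mult t u) (?O s f) x)
        = (\<lambda>x. (?O s (?d t (?R u f)) x - ?d t (?O s (?R u f)) x) + ?R t (\<lambda>x. ?O s (?d u f) x - ?d u (?O s f) x) x)"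
        using f by (intro ext) (simp add: bounded_op_add_vec[OF O] bsub[OF R] m oppH_repH_commute[OF q K])
    qed
  qed
qed

end

section \<open>Selfadjointness and the real structure\<close>

lemma D_op_Dmat: "D_op q N r dN dNr = Dmat q N (N + real r) dN dNr"
proof (intro ext)
  fix f :: "label cvec" and y
  show "D_op q N r dN dNr f y = Dmat q N (N + real r) dN dNr f y"
  proof (cases y)
    case (Inl p)
    obtain l m where p: "p = (l, m)" by (cases p)
    have "D_op q N r dN dNr f y = (if y \<in> H_basis N r then \<Sum>x\<in>{Inr (l, m)} \<inter> H_basis N r. f x * D_ket q N r dN dNr x y else 0)"
      unfolding D_op_def
    proof (rule mat_op_finite)
      fix x assume "x \<in> H_basis N r" "x \<notin> {Inr (l, m)} \<inter> H_basis N r"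
      then show "f x * D_ket q N r dN dNr x y = 0" by (cases x) (auto simp: Inl p ket_def split: if_splits)
    qed auto
    also have "\<dots> = Dmat q N (N + real r) dN dNr f y"
      using V_basis_bounds(1)[of l m N]
      by (cases "(l, m) \<in> V_basis (N + real r)") (auto simp: Inl p Dmat_def H_basis_def ket_def)
    finally show ?thesis .
  next
    case (Inr p)
    obtain l m where p: "p = (l, m)" by (cases p)
    have "D_op q N r dN dNr f y = (if y \<in> H_basis N r then \<Sum>x\<in>{Inl (l, m)} \<inter> H_basis N r. f x * D_ket q N r dN dNr x y else 0)"
      unfolding D_op_def
    proof (rule mat_op_finite)
      fix x assume "x \<in> H_basis N r" "x \<notin> {Inl (l, m)} \<inter> H_basis N r"
      then show "f x * D_ket q N r dN dNr x y = 0" by (cases x) (auto simp: Inr p ket_def split: if_splits)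
    qed auto
    also have "\<dots> = Dmat q N (N + real r) dN dNr f y"
      using V_basis_bounds(1)[of l m "N + real r"]
      by (cases "(l, m) \<in> V_basis N") (auto simp: Inr p Dmat_def H_basis_def ket_def)
    finally show ?thesis .
  qed
qed

lemma D_dom_iff: "f \<in> D_dom q N r dN dNr \<longleftrightarrow>
    f \<in> ell2 (H_basis N r) \<and> Dmat q N (N + real r) dN dNr f \<in> ell2 (H_basis N r)"
  by (simp add: D_dom_def mat_dom_def D_op_def[symmetric] D_op_Dmat)

lemma H_rep_repH: "H_rep q N r a = repH q N (N + real r) (SOME s. s \<in> a)"
  by (simp add: H_rep_def repH_def podles_rep_def[abs_def])

lemma podles_pair_shift:
  assumes q: "0 < q" "q < 1" and N: "2 * N \<in> \<int>"
  shows "podles_pair q N (N + real r)"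
proof
  have r: "real r \<in> \<int>" by simp
  show "2 * (N + real r) \<in> \<int>" using N by (simp add: ring_distribs)
  have e: "- (2 * N) - real r \<in> \<int>" "2 * N + real r \<in> \<int>" using N r by (auto intro: Ints_add Ints_diff Ints_minus)
  consider "\<bar>N\<bar> - \<bar>N + real r\<bar> = - real r" | "\<bar>N\<bar> - \<bar>N + real r\<bar> = real r" | "\<bar>N\<bar> - \<bar>N + real r\<bar> = - (2 * N) - real r"
    by (cases "N \<ge> 0"; cases "N + real r \<ge> 0") auto
  then show "\<bar>N\<bar> - \<bar>N + real r\<bar> \<in> \<int>" by cases (use e r in simp_all)
qed (use q N in auto)

lemma unbounded_op_D: "unbounded_op (H_basis N r) (D_dom q N r dN dNr) (D_op q N r dN dNr)"
proof -
  have "Dmat q N (N + real r) dN dNr (\<lambda>x. 0) = (\<lambda>x. 0)"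
    by (auto simp: Dmat_def fun_eq_iff split: sum.split)
  then show ?thesis
    unfolding unbounded_op_def linear_subspace_def linear_op_on_def
    by (auto simp: D_dom_iff D_op_Dmat Dmat_add Dmat_scale ell2_add ell2_scale ell2_zero)
qed

lemma commutator_extension_D:
  assumes q: "0 < q" "q < 1" and N: "2 * N \<in> \<int>"
  shows "commutator_extension (H_basis N r) (D_dom q N r dN dNr) (D_op q N r dN dNr) (H_rep q N r a)
     (deltaH q N (N + real r) dN dNr (SOME s. s \<in> a))"
proof -
  interpret podles_pair q N "N + real r" by (rule podles_pair_shift[OF q N])
  interpret podles_D q N "N + real r" dN dNr by unfold_locales
  show ?thesis
    unfolding commutator_extension_def D_dom_iff D_op_Dmat H_rep_repH H_basis_def
    using bounded_op_deltaH Dmat_commutator fin_span_ell2 fin_span_Dmat fin_span_repH by blast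
qed

lemma grading_ell2: "f \<in> ell2 (X <+> Y) \<Longrightarrow> grading f \<in> ell2 (X <+> Y)"
  using ell2_scale(1)[of _ Y "-1"] by (simp add: grading_def ell2_Plus(1))

lemma anticommutes_D: "anticommutes_with_grading (D_dom q N r dN dNr) (D_op q N r dN dNr)"
proof -
  have e: "Dmat q N (N + real r) dN dNr (grading f) = (\<lambda>x. - grading (Dmat q N (N + real r) dN dNr f) x)" for f
    by (auto simp: Dmat_def grading_def dsum_def fun_eq_iff split: sum.split)
  have "(\<lambda>x. - f x) \<in> ell2 X" if "f \<in> ell2 X" for f :: "label cvec" and X
    using ell2_scale(1)[OF that, of "-1"] by simp
  then show ?thesis
    unfolding anticommutes_with_grading_def D_op_Dmat e
    by (intro ballI conjI HOL.refl) (auto simp: D_dom_iff H_basis_def e intro!: grading_ell2)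
qed

lemma ell2_inner_ket:
  assumes "x \<in> X"
  shows "ell2_inner X (ket x) f = f x" "ell2_inner X f (ket x) = cnj (f x)"
proof -
  have "infsum (\<lambda>y. cnj (ket x y) * f y) X = infsum (\<lambda>y. f y) {x}"
    by (rule infsum_cong_neutral) (use assms in \<open>auto simp: ket_def\<close>)
  then show "ell2_inner X (ket x) f = f x" by (simp add: ell2_inner_def)
  have "infsum (\<lambda>y. cnj (f y) * ket x y) X = infsum (\<lambda>y. cnj (f y)) {x}"
    by (rule infsum_cong_neutral) (use assms in \<open>auto simp: ket_def\<close>)
  then show "ell2_inner X f (ket x) = cnj (f x)" by (simp add: ell2_inner_def)
qed

lemma ket_fin_span: "x \<in> X \<Longrightarrow> ket x \<in> fin_span X"
  by (auto simp: fin_span_def ket_def)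

text \<open>Exchanging the summands turns one series into the other term by term, so the equality
  holds for arbitrary functions, convergent or not. With the maximal domain, symmetry then already
  yields selfadjointness.\<close>

lemma Dmat_symmetric:
  "ell2_inner (V_basis K <+> V_basis K') \<phi> (Dmat q K K' d (cnj d) \<psi>) =
   ell2_inner (V_basis K <+> V_basis K') (Dmat q K K' d (cnj d) \<phi>) \<psi>"
proof -
  let ?X = "V_basis K <+> V_basis K'"
  define \<tau> :: "label \<Rightarrow> label" where "\<tau> = case_sum Inr Inl"
  define w :: "label \<Rightarrow> complex" where
    "w = case_sum (\<lambda>p. cnj d * complex_of_real (q powr (- fst p))) (\<lambda>p. d * complex_of_real (q powr (- fst p)))"
  define Y where "Y = {y \<in> ?X. \<tau> y \<in> ?X}"
  have D: "Dmat q K K' d (cnj d) f y = (if y \<in> Y then w y * f (\<tau> y) else 0)" for f y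
    by (cases y) (auto simp: Dmat_def Y_def \<tau>_def w_def)
  have tt: "\<tau> (\<tau> y) = y" for y by (cases y) (auto simp: \<tau>_def)
  have Y: "\<tau> y \<in> Y" if "y \<in> Y" for y
    using that unfolding Y_def mem_Collect_eq tt by (elim conjE) (rule conjI)
  have bij: "bij_betw \<tau> Y Y"
    by (rule bij_betw_byWitness[where f' = \<tau>]) (simp_all add: tt Y image_subset_iff)
  have wc: "cnj (w y) = w (\<tau> y)" for y by (cases y) (auto simp: w_def \<tau>_def)
  have "ell2_inner ?X \<phi> (Dmat q K K' d (cnj d) \<psi>) = infsum (\<lambda>y. cnj (\<phi> y) * (w y * \<psi> (\<tau> y))) Y"
    unfolding ell2_inner_def D by (rule infsum_cong_neutral) (auto simp: Y_def)
  also have "\<dots> = infsum (\<lambda>y. cnj (\<phi> (\<tau> y)) * (w (\<tau> y) * \<psi> (\<tau> (\<tau> y)))) Y"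
    by (rule infsum_reindex_bij_betw[OF bij, symmetric])
  also have "\<dots> = infsum (\<lambda>y. cnj (w y * \<phi> (\<tau> y)) * \<psi> y) Y"
    by (simp add: tt wc mult_ac)
  also have "\<dots> = ell2_inner ?X (Dmat q K K' d (cnj d) \<phi>) \<psi>"
    unfolding ell2_inner_def D by (rule infsum_cong_neutral) (auto simp: Y_def)
  finally show ?thesis .
qed

lemma selfadjoint_D:
  assumes q: "0 < q" "q < 1" and N: "2 * N \<in> \<int>"
  shows "selfadjoint_op (H_basis N r) (D_dom q N r dN dNr) (D_op q N r dN dNr) \<longleftrightarrow> cnj dN = dNr"
proof
  let ?K' = "N + real r"
  interpret podles_pair q N ?K' by (rule podles_pair_shift[OF q N])
  interpret podles_D q N ?K' dN dNr by unfold_locales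
  have dom: "f \<in> D_dom q N r dN dNr" if "f \<in> fin_span (H_basis N r)" for f
    using that fin_span_ell2 fin_span_Dmat unfolding D_dom_iff H_basis_def by blast
  {
    assume sa: "selfadjoint_op (H_basis N r) (D_dom q N r dN dNr) (D_op q N r dN dNr)"
    \<comment> \<open>The label \<open>m = l\<close> on the lowest level that the two summands
      share; a single matrix entry of \<open>D\<close> there compares the coefficients.\<close>
    define p where "p = (max \<bar>N\<bar> \<bar>?K'\<bar>, max \<bar>N\<bar> \<bar>?K'\<bar>)"
    have nat: "x \<in> \<nat>" if "x \<in> \<int>" "x \<ge> 0" for x :: real using that by (simp add: Nats_altdef2)
    have i2: "2 * max \<bar>N\<bar> \<bar>?K'\<bar> \<in> \<int>"
      using K Ints_minus[OF K(1)] Ints_minus[OF K(2)] by (simp add: max_def abs_if)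
    have i1: "max \<bar>N\<bar> \<bar>?K'\<bar> - \<bar>N\<bar> \<in> \<int>" "max \<bar>N\<bar> \<bar>?K'\<bar> - \<bar>?K'\<bar> \<in> \<int>"
      using KK Ints_minus[OF KK] by (cases "\<bar>N\<bar> \<le> \<bar>?K'\<bar>"; simp add: max_def del: abs_minus_commute)+
    have p: "p \<in> V_basis N" "p \<in> V_basis ?K'"
      using i2 by (auto simp: p_def V_basis_def intro!: nat i1)
    then have x: "Inl p \<in> H_basis N r" "Inr p \<in> H_basis N r" by (simp_all add: H_basis_def)
    have k: "ket (Inl p) \<in> D_dom q N r dN dNr" "ket (Inr p) \<in> D_dom q N r dN dNr"
      using x by (intro dom ket_fin_span; simp)+
    have "ell2_inner (H_basis N r) (ket (Inl p)) (D_op q N r dN dNr (ket (Inr p)))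
      = ell2_inner (H_basis N r) (D_op q N r dN dNr (ket (Inl p))) (ket (Inr p))"
      using sa k unfolding selfadjoint_op_def unbounded_op_def by (metis D_dom_iff)
    then have "dNr * complex_of_real (q powr (- fst p)) = cnj (dN * complex_of_real (q powr (- fst p)))"
      using p unfolding ell2_inner_ket[OF x(1)] ell2_inner_ket[OF x(2)] D_op_Dmat by (simp add: Dmat_def ket_def)
    then show "cnj dN = dNr" using q by simp
  }
  {
    assume eq: "cnj dN = dNr"
    have sym: "ell2_inner (H_basis N r) \<phi> (D_op q N r dN dNr \<psi>) = ell2_inner (H_basis N r) (D_op q N r dN dNr \<phi>) \<psi>" for \<phi> \<psi>
      unfolding D_op_Dmat H_basis_def eq[symmetric] by (rule Dmat_symmetric)
    show "selfadjoint_op (H_basis N r) (D_dom q N r dN dNr) (D_op q N r dN dNr)"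
      unfolding selfadjoint_op_def
    proof (intro conjI ballI unbounded_op_D)
      fix \<phi> \<eta> assume ph: "\<phi> \<in> ell2 (H_basis N r)" and et: "\<eta> \<in> ell2 (H_basis N r)"
      show "(\<forall>\<psi>\<in>D_dom q N r dN dNr. ell2_inner (H_basis N r) \<phi> (D_op q N r dN dNr \<psi>) = ell2_inner (H_basis N r) \<eta> \<psi>)
        \<longleftrightarrow> (\<phi> \<in> D_dom q N r dN dNr \<and> D_op q N r dN dNr \<phi> = \<eta>)"
      proof
        assume h: "\<forall>\<psi>\<in>D_dom q N r dN dNr. ell2_inner (H_basis N r) \<phi> (D_op q N r dN dNr \<psi>) = ell2_inner (H_basis N r) \<eta> \<psi>"
        \<comment> \<open>Basis vectors lie in the domain and determine \<open>\<eta>\<close>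
          coordinate by coordinate. As \<open>\<eta>\<close> is square-summable and the domain is
          maximal, \<open>\<phi>\<close> belongs to it.\<close>
        have "D_op q N r dN dNr \<phi> = \<eta>"
        proof
          fix y
          show "D_op q N r dN dNr \<phi> y = \<eta> y"
          proof (cases "y \<in> H_basis N r")
            case True
            have "ell2_inner (H_basis N r) (D_op q N r dN dNr \<phi>) (ket y) = ell2_inner (H_basis N r) \<eta> (ket y)"
              using h dom[OF ket_fin_span[OF True]] sym by simp
            then show ?thesis by (simp add: ell2_inner_ket[OF True])
          next
            case False
            then show ?thesis using ell2_outside[OF et False] by (simp add: D_op_def mat_op_def)
          qed
        qed
        then show "\<phi> \<in> D_dom q N r dN dNr \<and> D_op q N r dN dNr \<phi> = \<eta>"
          using ph et by (simp add: D_dom_iff D_op_Dmat)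
      next
        assume "\<phi> \<in> D_dom q N r dN dNr \<and> D_op q N r dN dNr \<phi> = \<eta>"
        then show "\<forall>\<psi>\<in>D_dom q N r dN dNr. ell2_inner (H_basis N r) \<phi> (D_op q N r dN dNr \<psi>) = ell2_inner (H_basis N r) \<eta> \<psi>"
          using sym by auto
      qed
    qed
  }
qed

section \<open>The antiunitary \<open>J\<close> and the real extension\<close>

lemma antiunitary_involution:
  assumes inv: "\<And>x. \<tau> (\<tau> x) = x" and Z: "\<And>x. x \<in> Z \<Longrightarrow> \<tau> x \<in> Z"
  shows "antiunitary Z (\<lambda>f x. cnj (f (\<tau> x)))" "f \<in> ell2 Z \<Longrightarrow> (\<lambda>x. cnj (f (\<tau> x))) \<in> ell2 Z"
proof -
  have Z': "\<tau> x \<in> Z \<longleftrightarrow> x \<in> Z" for x using Z[of x] Z[of "\<tau> x"] inv by auto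
  have bij: "bij_betw \<tau> Z Z" by (rule bij_betw_byWitness[where f' = \<tau>]) (simp_all add: inv Z image_subset_iff)
  have mem: "(\<lambda>x. cnj (f (\<tau> x))) \<in> ell2 Z" if "f \<in> ell2 Z" for f
  proof -
    have "(\<lambda>x. (cmod (f (\<tau> x)))\<^sup>2) summable_on Z"
      using that summable_on_reindex_bij_betw[OF bij, of "\<lambda>x. (cmod (f x))\<^sup>2"] by (simp add: ell2_def)
    then show ?thesis using that by (simp add: ell2_def Z')
  qed
  then show "f \<in> ell2 Z \<Longrightarrow> (\<lambda>x. cnj (f (\<tau> x))) \<in> ell2 Z" .
  have b: "bij_betw (\<lambda>f x. cnj (f (\<tau> x))) (ell2 Z) (ell2 Z)"
    by (rule bij_betw_byWitness[where f' = "\<lambda>f x. cnj (f (\<tau> x))"]) (auto simp: inv mem)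
  have i: "ell2_inner Z (\<lambda>x. cnj (f (\<tau> x))) (\<lambda>x. cnj (g (\<tau> x))) = cnj (ell2_inner Z f g)" for f g
  proof -
    have "ell2_inner Z (\<lambda>x. cnj (f (\<tau> x))) (\<lambda>x. cnj (g (\<tau> x))) = infsum (\<lambda>x. f (\<tau> x) * cnj (g (\<tau> x))) Z"
      by (simp add: ell2_inner_def)
    also have "\<dots> = infsum (\<lambda>x. f x * cnj (g x)) Z"
      by (rule infsum_reindex_bij_betw[OF bij])
    also have "\<dots> = cnj (ell2_inner Z f g)"
      unfolding ell2_inner_def infsum_cnj[symmetric] by simp
    finally show ?thesis .
  qed
  show "antiunitary Z (\<lambda>f x. cnj (f (\<tau> x)))"
    unfolding antiunitary_def using b i by simp
qed

text \<open>The summands of \<open>H'\<close> are \<open>V_{-(N+r)}\<close> and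
  \<open>V_{-N}\<close> in this order, so the partner of a first summand is a second one.
  \<open>V_K\<close> and \<open>V_{-K}\<close> have the same labels.\<close>

fun reflect :: "label + label \<Rightarrow> label + label" where
  "reflect (Inl (Inl (l, m))) = Inr (Inr (l, - m))"
| "reflect (Inl (Inr (l, m))) = Inr (Inl (l, - m))"
| "reflect (Inr (Inl (l, m))) = Inl (Inr (l, - m))"
| "reflect (Inr (Inr (l, m))) = Inl (Inl (l, - m))"

definition Jop :: "(label + label) cop" where
  "Jop f = (\<lambda>x. cnj (f (reflect x)))"

lemma reflect_reflect: "reflect (reflect x) = x"
  by (cases x rule: reflect.cases) auto

lemma Jop_Jop: "Jop (Jop f) = f"
  by (simp add: Jop_def reflect_reflect)

lemma Jop_components:
  "(\<lambda>p. Jop f (Inl (Inl p))) = flip (\<lambda>p. f (Inr (Inr p)))"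
  "(\<lambda>p. Jop f (Inl (Inr p))) = flip (\<lambda>p. f (Inr (Inl p)))"
  "(\<lambda>p. Jop f (Inr (Inl p))) = flip (\<lambda>p. f (Inl (Inr p)))"
  "(\<lambda>p. Jop f (Inr (Inr p))) = flip (\<lambda>p. f (Inl (Inl p)))"
  by (auto simp: Jop_def flip_def)

lemma sum4_eqI:
  assumes "(\<lambda>p. f (Inl (Inl p))) = (\<lambda>p. g (Inl (Inl p)))" "(\<lambda>p. f (Inl (Inr p))) = (\<lambda>p. g (Inl (Inr p)))"
    "(\<lambda>p. f (Inr (Inl p))) = (\<lambda>p. g (Inr (Inl p)))" "(\<lambda>p. f (Inr (Inr p))) = (\<lambda>p. g (Inr (Inr p)))"
  shows "f = g"
  using assms by (auto simp: fun_eq_iff split_sum_all)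

lemma opp_Jop:
  "Jop (dsum (repH q N (N + real r) s) (repH q (- N - real r) (- N - real r + real r) s) (Jop f))
   = dsum (oppH q N (N + real r) s) (oppH q (- N - real r) (- N - real r + real r) s) f"
proof -
  have e: "- (N + real r) = - N - real r" "- N - real r + real r = - N" "- (- N - real r) = N + real r" "- (- N) = N"
    by simp_all
  show ?thesis
    by (rule sum4_eqI) (simp_all only: Jop_components oppH_def repH_def dsum_simps opp1_def e)
qed

text \<open>\<open>J\<close> keeps \<open>l\<close> and conjugates scalars. It carries the component
  \<open>V_N \<rightarrow> V_{N+r}\<close> to \<open>V_{-N} \<rightarrow> V_{-(N+r)}\<close>, which
  leads from the second summand of \<open>H'\<close> to the first. Hence the order and the
  conjugates in the coefficients of \<open>D'\<close>.\<close>

lemma Jop_Dmat: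
  "Jop (dsum (Dmat q N (N + real r) dN dNr) (Dmat q (- N - real r) (- N - real r + real r) (cnj dNr) (cnj dN)) f)
   = dsum (Dmat q N (N + real r) dN dNr) (Dmat q (- N - real r) (- N - real r + real r) (cnj dNr) (cnj dN)) (Jop f)"
proof
  fix x
  have e: "V_basis (- N - real r) = V_basis (N + real r)" "V_basis (- N - real r + real r) = V_basis N"
    and e': "V_basis (- N) = V_basis N"
    using V_basis_minus[of "N + real r"] V_basis_minus[of N] by simp_all
  show "Jop (dsum (Dmat q N (N + real r) dN dNr) (Dmat q (- N - real r) (- N - real r + real r) (cnj dNr) (cnj dN)) f) x
   = dsum (Dmat q N (N + real r) dN dNr) (Dmat q (- N - real r) (- N - real r + real r) (cnj dNr) (cnj dN)) (Jop f) x"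
    by (cases x rule: reflect.cases) (auto simp: Jop_def Dmat_def e e' V_basis_neg)
qed

lemma order_one_D:
  assumes q: "0 < q" "q < 1" and N: "2 * N \<in> \<int>"
  shows "order_one_up_to_exp_decay q N r (D_dom q N r dN dNr) (D_op q N r dN dNr)"
proof -
  define M where "M = - N - real r"
  define U where "U = D_dom q N r dN dNr"
  define U' where "U' = D_dom q M r (cnj dNr) (cnj dN)"
  define T where "T = D_op q N r dN dNr"
  define T' where "T' = D_op q M r (cnj dNr) (cnj dN)"
  define Z where "Z = H_basis N r <+> H_basis M r"
  define W where "W = dsum_dom U U'"
  define DD where "DD = dsum T T'"
  define rep where "rep = (\<lambda>a. dsum (H_rep q N r a) (H_rep q M r a))"
  define opp where "opp = (\<lambda>a f. Jop (rep a (inv_into (ell2 Z) Jop f)))"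
  define ex :: "podles_expr set \<Rightarrow> podles_expr" where "ex a = (SOME s. s \<in> a)" for a
  have M: "2 * M \<in> \<int>" using N by (simp add: M_def right_diff_distrib)
  interpret P: podles_pair q N "N + real r" by (rule podles_pair_shift[OF q N])
  interpret P: podles_D q N "N + real r" dN dNr by unfold_locales
  interpret P': podles_pair q M "M + real r" by (rule podles_pair_shift[OF q M])
  interpret P': podles_D q M "M + real r" "cnj dNr" "cnj dN" by unfold_locales
  have ZZ: "Z = (V_basis N <+> V_basis (N + real r)) <+> (V_basis M <+> V_basis (M + real r))"
    by (simp add: Z_def H_basis_def)
  have VM: "V_basis M = V_basis (N + real r)" "V_basis (M + real r) = V_basis N"
    using V_basis_minus[of "N + real r"] V_basis_minus[of N] by (simp_all add: M_def)
  have rZ: "reflect x \<in> Z" if "x \<in> Z" for x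
    using that by (cases x rule: reflect.cases) (auto simp: ZZ VM V_basis_neg)
  have anti: "antiunitary Z Jop" and Jell: "\<And>f. f \<in> ell2 Z \<Longrightarrow> Jop f \<in> ell2 Z"
    unfolding Jop_def[abs_def] by (rule antiunitary_involution[OF reflect_reflect rZ]; simp)+
  have injJ: "inj_on Jop (ell2 Z)" using anti by (simp add: antiunitary_def bij_betw_def)
  \<comment> \<open>\<open>J\<close> is its own inverse, which gives the opposite representation the
    explicit form \<open>oppe\<close>.\<close>
  have invJ: "inv_into (ell2 Z) Jop f = Jop f" if "f \<in> ell2 Z" for f
    using inv_into_f_f[OF injJ Jell[OF that]] by (simp add: Jop_Jop)
  have repe: "rep a = dsum (repH q N (N + real r) (ex a)) (repH q M (M + real r) (ex a))" for a
    by (simp add: rep_def H_rep_repH ex_def)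
  have oppe: "opp a f = dsum (oppH q N (N + real r) (ex a)) (oppH q M (M + real r) (ex a)) f" if "f \<in> ell2 Z" for a f
    unfolding opp_def invJ[OF that] repe unfolding M_def by (rule opp_Jop)
  have DDe: "DD = dsum (Dmat q N (N + real r) dN dNr) (Dmat q M (M + real r) (cnj dNr) (cnj dN))"
    by (simp add: DD_def T_def T'_def D_op_Dmat)
  have JD: "Jop (DD f) = DD (Jop f)" for f unfolding DDe M_def by (rule Jop_Dmat)
  \<comment> \<open>\<open>W\<close> is the maximal domain of the direct sum, so its invariance
    under \<open>J\<close> follows from \<open>JD\<close>.\<close>
  have We: "f \<in> W \<longleftrightarrow> f \<in> ell2 Z \<and> DD f \<in> ell2 Z" for f
    by (auto simp: W_def dsum_dom_def U_def U'_def D_dom_iff ZZ H_basis_def DDe ell2_Plus(1)[of _ "V_basis N <+> V_basis (N + real r)"])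
  have JW: "Jop f \<in> W \<longleftrightarrow> f \<in> W" if "f \<in> ell2 Z" for f
    unfolding We JD[symmetric] using Jell Jop_Jop that by metis
  define S where "S a = dsum (deltaH q N (N + real r) dN dNr (ex a)) (deltaH q M (M + real r) (cnj dNr) (cnj dN) (ex a))" for a
  have Sb: "bounded_op Z (S a)" for a unfolding S_def ZZ by (rule bounded_op_dsum[OF P.bounded_op_deltaH P'.bounded_op_deltaH])
  have ce: "commutator_extension Z W DD (rep a) (S a)" for a
  proof -
    have 1: "commutator_extension (H_basis N r) U T (H_rep q N r a) (deltaH q N (N + real r) dN dNr (ex a))"
      unfolding U_def T_def ex_def by (rule commutator_extension_D[OF q N])
    have 2: "commutator_extension (H_basis M r) U' T' (H_rep q M r a) (deltaH q M (M + real r) (cnj dNr) (cnj dN) (ex a))"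
      unfolding U'_def T'_def ex_def by (rule commutator_extension_D[OF q M])
    show ?thesis
      unfolding commutator_extension_def
    proof (intro conjI ballI Sb)
      fix f assume "f \<in> fin_span Z"
      then have f: "(\<lambda>x. f (Inl x)) \<in> fin_span (H_basis N r)" "(\<lambda>x. f (Inr x)) \<in> fin_span (H_basis M r)"
        by (simp_all add: Z_def fin_span_Plus)
      note c = 1[unfolded commutator_extension_def, THEN conjunct2, rule_format, OF f(1)]
        2[unfolded commutator_extension_def, THEN conjunct2, rule_format, OF f(2)]
      show "f \<in> W" "rep a f \<in> W" using c by (simp_all add: W_def dsum_dom_def rep_def)
      show "S a f = (\<lambda>x. DD (rep a f) x - rep a (DD f) x)"
        by (rule sum_fun_eqI) (use c in \<open>simp_all add: S_def DD_def rep_def\<close>)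
    qed
  qed
  have dec: "exp_decay q Z (case_sum level level) (\<lambda>f x. opp a (S b f) x - S b (opp a f) x)" for a b
    unfolding ZZ
  proof (rule exp_decay.cong[OF exp_decay_dsum[OF P.exp_decay_commutator[of "ex a" "ex b"] P'.exp_decay_commutator[of "ex a" "ex b"]]], fold ZZ)
    fix f assume f: "f \<in> ell2 Z"
    show "(\<lambda>x. opp a (S b f) x - S b (opp a f) x) = dsum
      (\<lambda>f x. oppH q N (N + real r) (ex a) (deltaH q N (N + real r) dN dNr (ex b) f) x - deltaH q N (N + real r) dN dNr (ex b) (oppH q N (N + real r) (ex a) f) x)
      (\<lambda>f x. oppH q M (M + real r) (ex a) (deltaH q M (M + real r) (cnj dNr) (cnj dN) (ex b) f) x - deltaH q M (M + real r) (cnj dNr) (cnj dN) (ex b) (oppH q M (M + real r) (ex a) f) x) f"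
      unfolding oppe[OF f] oppe[OF bounded_op_ell2[OF Sb f]] unfolding S_def by (rule sum_fun_eqI) simp_all
  qed
  have com: "opp a (rep b f) = rep b (opp a f)" if f: "f \<in> ell2 Z" for a b f
  proof -
    have fl: "(\<lambda>x. f (Inl x)) \<in> ell2 (V_basis N <+> V_basis (N + real r))" "(\<lambda>x. f (Inr x)) \<in> ell2 (V_basis M <+> V_basis (M + real r))"
      using f unfolding ZZ by (simp_all only: ell2_Plus(1)[of _ "V_basis N <+> V_basis (N + real r)"])
    have rb: "bounded_op Z (rep b)" unfolding repe ZZ
      by (rule bounded_op_dsum[OF bounded_op_repH[OF q P.K] bounded_op_repH[OF q P'.K]])
    show ?thesis unfolding oppe[OF f] oppe[OF bounded_op_ell2[OF rb f]] unfolding repe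
      by (rule sum_fun_eqI) (simp_all only: dsum_simps oppH_repH_commute[OF q P.K fl(1)] oppH_repH_commute[OF q P'.K fl(2)])
  qed
  have bc: "has_bounded_commutator (H_basis M r) U' T' (H_rep q M r a)" for a
    unfolding has_bounded_commutator_def U'_def T'_def using commutator_extension_D[OF q M] by blast
  have ub: "unbounded_op (H_basis M r) U' T'" unfolding U'_def T'_def by (rule unbounded_op_D)
  have eps: "\<exists>\<epsilon>\<in>{1, - 1}. \<forall>f\<in>ell2 Z. Jop (Jop f) = (\<lambda>x. \<epsilon> * f x)" by (simp add: Jop_Jop)
  have JWD: "\<forall>f\<in>W. Jop (DD f) = DD (Jop f)" using JD by blast
  show ?thesis
    unfolding order_one_up_to_exp_decay_def Let_def U_def[symmetric] T_def[symmetric]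
  proof (rule exI[of _ M], rule exI[of _ U'], rule exI[of _ T'], rule exI[of _ Jop],
      unfold Z_def[symmetric] W_def[symmetric] DD_def[symmetric], intro conjI ballI)
    fix a b f assume "f \<in> ell2 Z"
    then show "Jop (dsum (H_rep q N r a) (H_rep q M r a) (inv_into (ell2 Z) Jop (dsum (H_rep q N r b) (H_rep q M r b) f)))
      = dsum (H_rep q N r b) (H_rep q M r b) (Jop (dsum (H_rep q N r a) (H_rep q M r a) (inv_into (ell2 Z) Jop f)))"
      using com[of f a b] by (simp add: opp_def rep_def)
  next
    fix a b
    show "\<exists>S. commutator_extension Z W DD (dsum (H_rep q N r b) (H_rep q M r b)) S \<and>
      exp_decay q Z (case_sum level level)
       (\<lambda>f x. Jop (dsum (H_rep q N r a) (H_rep q M r a) (inv_into (ell2 Z) Jop (S f))) x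
         - S (Jop (dsum (H_rep q N r a) (H_rep q M r a) (inv_into (ell2 Z) Jop f))) x)"
      using ce[of b] dec[of a b] unfolding opp_def rep_def by (intro exI[of _ "S b"] conjI)
  qed (use M ub bc anti eps JW JWD in simp_all)
qed

theorem proposition2p9:
  fixes q N :: real and r :: nat and dN dNr :: complex
  assumes "0 < q" and "q < 1" and "2 * N \<in> \<int>" and "r \<ge> 1"
  shows "(\<forall>a\<in>podles_algebra q.
            has_bounded_commutator (H_basis N r) (D_dom q N r dN dNr) (D_op q N r dN dNr)
              (H_rep q N r a))
       \<and> anticommutes_with_grading (D_dom q N r dN dNr) (D_op q N r dN dNr)
       \<and> order_one_up_to_exp_decay q N r (D_dom q N r dN dNr) (D_op q N r dN dNr)
       \<and> (selfadjoint_op (H_basis N r) (D_dom q N r dN dNr) (D_op q N r dN dNr)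
            \<longleftrightarrow> cnj dN = dNr)"
  using commutator_extension_D[OF assms(1-3)] anticommutes_D order_one_D[OF assms(1-3)] selfadjoint_D[OF assms(1-3)]
  unfolding has_bounded_commutator_def by blast

end
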